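(* Let $\rho_r\in(0,1)$ and $\rho_w\in(0,1/2)$, and let $C_s(\rho_r,\rho_w)$ denote the semantic secrecy capacity of the binary $(\rho_r,\rho_w)$ adversarial wiretap channel. Then \[\max\bigl(1-h(\rho_w)-\rho_r,\,0\bigr)\;\le\; C_s(\rho_r,\rho_w)\;\le\; 1-h(\rho_w)-\rho_r-\min_{p\in[0,1]} f(p),\] where $f(p)=h\bigl((2\rho_w-1)p+1-\rho_w\bigr)-h(\rho_w)-\rho_r h(p)$. Moreover, the upper bound also holds for the weak secrecy capacity.
   Context: $h(p)=-p\log_2 p-(1-p)\log_2(1-p)$ is the binary entropy function. A binary code is $C\subseteq\{0,1\}^n$ (possibly with a randomized/stochastic encoder mapping messages to codewords); its rate is $\log_2|\text{message set}|/n$. A family of codes is a sequence $(C_n\subseteq\{0,1\}^n)_{n\to\infty}$ with rate $\liminf_n R(C_n)$. The $(\rho_r,\rho_w)$ adversarial wiretap channel (AWTC): a codeword $x\in\{0,1\}^n$ encoding the message $\mathbf S$ is sent; the adversary chooses (possibly at random) a set $\mathscr S\subseteq[n]$ with $|\mathscr S|=\rho_r n$ and observes the view $\mathbf V(\mathscr S)\in\{0,1,?\}^n$, whose $i$-th coordinate is $x_i$ if $i\in\mathscr S$ and $?$ otherwise; it then adds an error vector $e$ of Hamming weight at most $\rho_w n$ whose distribution depends only on the code and the view; the receiver decodes $x+e$ (nearest-neighbor decoding) to $\hat{\mathbf S}$. Reliability: $\delta_n=\Pr[\hat{\mathbf S}\ne\mathbf S]\to0$ (for every adversary strategy). Weak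 secrecy: with $\mathbf S$ uniform, the equivocation $\Delta(C_n)=\min_{|\mathscr S|=\rho_r n}H(\mathbf S\mid\mathbf V(\mathscr S))$ satisfies $\Delta(C_n)/n\to R(\mathcal C)$. Semantic secrecy: $\mathrm{Sem}(C_n)=\max_{P_{\mathbf S},\mathscr S} I(\mathbf S;\mathbf V(\mathscr S))=e^{-\Omega(n)}$, the maximum over all message distributions $P_{\mathbf S}$ and all $\mathscr S$ of size $\rho_r n$. The weak (resp. semantic) secrecy capacity is the supremum of rates $R>0$ of code families achieving reliability and weak (resp. semantic) secrecy. *)

theory Defs
  imports "HOL-Analysis.Analysis"
begin

definition bin_entropy :: "real \<Rightarrow> real" where
  "bin_entropy p = - (p * log 2 p) - (1 - p) * log 2 (1 - p)"
  (* 0 * log 2 0 = 0 automatically, giving the convention 0 log 0 = 0 *)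

definition words :: "nat \<Rightarrow> bool list set" where
  "words n = {x. length x = n}"

definition weight :: "bool list \<Rightarrow> nat" where
  "weight e = length (filter id e)"

definition xorw :: "bool list \<Rightarrow> bool list \<Rightarrow> bool list" where
  "xorw x e = map2 (\<noteq>) x e"

definition hdist :: "bool list \<Rightarrow> bool list \<Rightarrow> nat" where
  "hdist x y = weight (xorw x y)"

definition view :: "nat set \<Rightarrow> bool list \<Rightarrow> bool option list" where
  "view S x = map (\<lambda>i. if i \<in> S then Some (x ! i) else None) [0..<length x]"

definition is_dist :: "'a set \<Rightarrow> ('a \<Rightarrow> real) \<Rightarrow> bool" where
  "is_dist A p \<longleftrightarrow> finite A \<and> (\<forall>x. 0 \<le> p x) \<and> (\<forall>x. x \<notin> A \<longrightarrow> p x = 0) \<and> sum p A = 1"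

definition nread :: "real \<Rightarrow> nat \<Rightarrow> nat" where
  "nread \<rho>r n = nat \<lfloor>\<rho>r * real n\<rfloor>"

definition rsets :: "nat \<Rightarrow> nat \<Rightarrow> nat set set" where
  "rsets n k = {S. S \<subseteq> {..<n} \<and> card S = k}"

text \<open>A code of length n: messages {..<K}, stochastic encoder enc (enc m is a
  distribution on {0,1}^n), and a nearest-neighbour decoder dec for the codebook
  (union of the supports of the enc m); ties may be broken arbitrarily.\<close>
definition codebook :: "nat \<Rightarrow> (nat \<Rightarrow> bool list \<Rightarrow> real) \<Rightarrow> bool list set" where
  "codebook K enc = {x. \<exists>m<K. enc m x > 0}"

definition valid_code ::
  "nat \<Rightarrow> nat \<Rightarrow> (nat \<Rightarrow> bool list \<Rightarrow> real) \<Rightarrow> (bool list \<Rightarrow> nat) \<Rightarrow> bool" where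
  "valid_code n K enc dec \<longleftrightarrow> K \<ge> 1 \<and>
     (\<forall>m<K. is_dist (words n) (enc m)) \<and>
     (\<forall>y \<in> words n. dec y < K \<and>
        (\<exists>x. enc (dec y) x > 0 \<and> (\<forall>x' \<in> codebook K enc. hdist x y \<le> hdist x' y)))"

definition valid_adv ::
  "real \<Rightarrow> real \<Rightarrow> nat \<Rightarrow> (nat set \<Rightarrow> real) \<Rightarrow> (bool option list \<Rightarrow> bool list \<Rightarrow> real) \<Rightarrow> bool" where
  "valid_adv \<rho>r \<rho>w n q E \<longleftrightarrow> is_dist (rsets n (nread \<rho>r n)) q \<and>
     (\<forall>v. is_dist {e \<in> words n. real (weight e) \<le> \<rho>w * real n} (E v))"

definition err_prob ::
  "real \<Rightarrow> nat \<Rightarrow> nat \<Rightarrow> (nat \<Rightarrow> bool list \<Rightarrow> real) \<Rightarrow> (bool list \<Rightarrow> nat) \<Rightarrow>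
   (nat set \<Rightarrow> real) \<Rightarrow> (bool option list \<Rightarrow> bool list \<Rightarrow> real) \<Rightarrow> real" where
  "err_prob \<rho>r n K enc dec q E =
     (\<Sum>m<K. \<Sum>S\<in>rsets n (nread \<rho>r n). \<Sum>x\<in>words n. \<Sum>e\<in>words n.
        (1 / real K) * q S * enc m x * E (view S x) e *
        (if dec (xorw x e) \<noteq> m then 1 else 0))"

definition joint ::
  "(nat \<Rightarrow> real) \<Rightarrow> nat \<Rightarrow> (nat \<Rightarrow> bool list \<Rightarrow> real) \<Rightarrow> nat set \<Rightarrow> nat \<Rightarrow> bool option list \<Rightarrow> real" where
  "joint PS n enc S m v = PS m * (\<Sum>x\<in>{x \<in> words n. view S x = v}. enc m x)"

definition pview ::
  "(nat \<Rightarrow> real) \<Rightarrow> nat \<Rightarrow> nat \<Rightarrow> (nat \<Rightarrow> bool list \<Rightarrow> real) \<Rightarrow> nat set \<Rightarrow> bool option list \<Rightarrow> real" where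
  "pview PS n K enc S v = (\<Sum>m<K. joint PS n enc S m v)"

definition mutual_info ::
  "(nat \<Rightarrow> real) \<Rightarrow> nat \<Rightarrow> nat \<Rightarrow> (nat \<Rightarrow> bool list \<Rightarrow> real) \<Rightarrow> nat set \<Rightarrow> real" where
  "mutual_info PS n K enc S =
     (\<Sum>m<K. \<Sum>v\<in>view S ` words n.
        joint PS n enc S m v * log 2 (joint PS n enc S m v / (PS m * pview PS n K enc S v)))"

definition unif :: "nat \<Rightarrow> nat \<Rightarrow> real" where
  "unif K m = (if m < K then 1 / real K else 0)"

definition cond_entropy :: "nat \<Rightarrow> nat \<Rightarrow> (nat \<Rightarrow> bool list \<Rightarrow> real) \<Rightarrow> nat set \<Rightarrow> real" where
  "cond_entropy n K enc S =
     - (\<Sum>m<K. \<Sum>v\<in>view S ` words n.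
        joint (unif K) n enc S m v *
          log 2 (joint (unif K) n enc S m v / pview (unif K) n K enc S v))"

definition equivocation :: "real \<Rightarrow> nat \<Rightarrow> nat \<Rightarrow> (nat \<Rightarrow> bool list \<Rightarrow> real) \<Rightarrow> real" where
  "equivocation \<rho>r n K enc = Min ((\<lambda>S. cond_entropy n K enc S) ` rsets n (nread \<rho>r n))"

definition family_rate :: "(nat \<Rightarrow> nat) \<Rightarrow> ereal" where
  "family_rate K = liminf (\<lambda>n. ereal (log 2 (real (K n)) / real n))"

definition reliable ::
  "real \<Rightarrow> real \<Rightarrow> (nat \<Rightarrow> nat) \<Rightarrow> (nat \<Rightarrow> nat \<Rightarrow> bool list \<Rightarrow> real) \<Rightarrow> (nat \<Rightarrow> bool list \<Rightarrow> nat) \<Rightarrow> bool" where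
  "reliable \<rho>r \<rho>w K enc dec \<longleftrightarrow>
     (\<forall>q E. (\<forall>n. valid_adv \<rho>r \<rho>w n (q n) (E n)) \<longrightarrow>
        (\<lambda>n. err_prob \<rho>r n (K n) (enc n) (dec n) (q n) (E n)) \<longlonglongrightarrow> 0)"

definition weak_secret :: "real \<Rightarrow> (nat \<Rightarrow> nat) \<Rightarrow> (nat \<Rightarrow> nat \<Rightarrow> bool list \<Rightarrow> real) \<Rightarrow> bool" where
  "weak_secret \<rho>r K enc \<longleftrightarrow>
     (\<lambda>n. ereal (equivocation \<rho>r n (K n) (enc n) / real n)) \<longlonglongrightarrow> family_rate K"

definition semantic_secret :: "real \<Rightarrow> (nat \<Rightarrow> nat) \<Rightarrow> (nat \<Rightarrow> nat \<Rightarrow> bool list \<Rightarrow> real) \<Rightarrow> bool" where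
  "semantic_secret \<rho>r K enc \<longleftrightarrow>
     (\<exists>c>0. \<forall>\<^sub>F n in sequentially. \<forall>PS S. is_dist {..<K n} PS \<and> S \<in> rsets n (nread \<rho>r n) \<longrightarrow>
        mutual_info PS n (K n) (enc n) S \<le> exp (- c * real n))"

definition valid_family ::
  "(nat \<Rightarrow> nat) \<Rightarrow> (nat \<Rightarrow> nat \<Rightarrow> bool list \<Rightarrow> real) \<Rightarrow> (nat \<Rightarrow> bool list \<Rightarrow> nat) \<Rightarrow> bool" where
  "valid_family K enc dec \<longleftrightarrow> (\<forall>n. valid_code n (K n) (enc n) (dec n))"

definition weak_capacity :: "real \<Rightarrow> real \<Rightarrow> ereal" where
  "weak_capacity \<rho>r \<rho>w = Sup (insert 0 {R. R > 0 \<and> (\<exists>K enc dec. valid_family K enc dec \<and>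
      reliable \<rho>r \<rho>w K enc dec \<and> weak_secret \<rho>r K enc \<and> R = family_rate K)})"

definition sem_capacity :: "real \<Rightarrow> real \<Rightarrow> ereal" where
  "sem_capacity \<rho>r \<rho>w = Sup (insert 0 {R. R > 0 \<and> (\<exists>K enc dec. valid_family K enc dec \<and>
      reliable \<rho>r \<rho>w K enc dec \<and> semantic_secret \<rho>r K enc \<and> R = family_rate K)})"

end

(* Upper bounds. Let the adversary read each position independently with a probability slightly below
   rho_r and flip each position independently with a probability slightly below rho_w; by Chebyshev this
   is, up to a vanishing probability, an admissible attack which ignores the view. With Y the received
   word and V the view, H(M|V) <= (H(M|V) - H(M|Y)) + H(M|Y). Fano's inequality bounds the last term. The
   difference is I(M;Y) - I(M;V), which is exchanged position by position; each position contributes at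
   most the largest value of G(p) - E G(p_s) over p = E p_s, where G(p) = f(p) + h(rho_w). Since G'
   first increases and then decreases to 0 at 1/2, this is at most G(1/2) - min G: either G(p) <= G(1/2),
   or the tangent of G at p lies below G.

   Lower bound. For R < 1 - h(rho_w) - rho_r take 2^(nR) messages with about 2^(n(rho_r + g/2)) codewords
   each, g being the slack. The codewords are chosen one after another so that all counts of interest
   stay near their means: every view is met equally often by the codewords of each message (secrecy), and
   for all S, v, e only a vanishing fraction of the codewords x with view v has another codeword within
   distance rho_w n of x + e (reliability, against errors depending on the view). *)

theory Submission
  imports Defs "HOL-Real_Asymp.Real_Asymp"
begin

section \<open>The single-letter gap\<close>

text \<open>In general \<open>gap r \<rho>\<close> is neither convex nor concave, so Jensen's
  inequality fails in both directions and only its defect can be bounded. Conditioning on symbols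
  already revealed would divide by masses that may be zero; all entropies are therefore taken of
  unnormalised weights, for which conditioning is restriction and the single-letter expressions are
  homogeneous. \<open>valid_code\<close> puts no bound on the number of messages, as messages may
  share codewords. The term error times \<open>log 2 K\<close> is under control only because
  reliability itself forces \<open>K\<close> to be at most \<open>2 ^ (n + 1)\<close> eventually. In
  the lower bound an error depending on the view calls for control over all triples of reading set,
  view and error. There are only exponentially many, so their logarithm is linear in
  \<open>n\<close>, against means that grow exponentially. Whether a codeword is spoiled depends on
  the whole codebook, hence is not decided at the moment it is chosen. The count is split: an
  earlier neighbour is charged when the codeword is chosen, a later one when that neighbour is
  chosen.\<close>

definition eta :: "real \<Rightarrow> real" where
  "eta t = - (t * log 2 t)"

lemma eta_0 [simp]: "eta 0 = 0"
  by (simp add: eta_def)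

lemma eta_nonneg: "0 \<le> t \<Longrightarrow> t \<le> 1 \<Longrightarrow> 0 \<le> eta t"
  by (cases "t = 0") (auto simp: eta_def mult_nonneg_nonpos)

lemma eta_mult: "0 \<le> s \<Longrightarrow> 0 \<le> t \<Longrightarrow> eta (s * t) = s * eta t + t * eta s"
  by (cases "s = 0"; cases "t = 0") (auto simp: eta_def log_mult algebra_simps)

lemma bin_entropy_eta: "bin_entropy p = eta p + eta (1 - p)"
  by (simp add: bin_entropy_def eta_def)

lemma bin_entropy_flip: "bin_entropy (1 - p) = bin_entropy p"
  by (simp add: bin_entropy_eta)

lemma bin_entropy_half: "bin_entropy (1/2) = 1"
  by (simp add: bin_entropy_def log_divide)

lemma continuous_on_eta: "continuous_on {0..} eta"
proof (rule continuous_on_eq_continuous_within[THEN iffD2], rule ballI)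
  fix x :: real assume "x \<in> {0..}"
  show "continuous (at x within {0..}) eta"
  proof (cases "x = 0")
    case True
    have "((\<lambda>x::real. - (x * (ln x / ln 2))) \<longlongrightarrow> 0) (at_right 0)" by real_asymp
    then have "(eta \<longlongrightarrow> 0) (at_right 0)" by (simp add: eta_def[abs_def] log_def)
    then show ?thesis using True by (simp add: continuous_within at_within_Ici_at_right)
  next
    case False
    with \<open>x \<in> {0..}\<close> have "x > 0" by simp
    then have "isCont (\<lambda>x. - (x * (ln x / ln 2))) x" by (intro continuous_intros) auto
    then show ?thesis by (simp add: eta_def[abs_def] log_def continuous_at_imp_continuous_within)
  qed
qed

lemma continuous_on_bin_entropy: "continuous_on {0..1} bin_entropy"
proof -
  have "continuous_on {0..1} (\<lambda>p. eta p + eta (1 - p))"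
    by (intro continuous_on_add continuous_on_subset[OF continuous_on_eta]
        continuous_on_compose2[OF continuous_on_eta] continuous_intros) auto
  then show ?thesis by (simp add: bin_entropy_eta[abs_def])
qed

lemma bin_entropy_nonneg: "0 \<le> p \<Longrightarrow> p \<le> 1 \<Longrightarrow> 0 \<le> bin_entropy p"
  by (simp add: bin_entropy_eta eta_nonneg)

lemma has_derivative_bin_entropy:
  assumes "0 < p" "p < 1"
  shows "(bin_entropy has_real_derivative (log 2 (1 - p) - log 2 p)) (at p)"
proof -
  have a: "((\<lambda>p. p * ln p) has_real_derivative (ln x + 1)) (at x)" if "0 < x" for x :: real
    using that by (auto intro!: derivative_eq_intros)
  have b: "((\<lambda>p. (1 - p) * ln (1 - p)) has_real_derivative (ln (1 - p) + 1) * (- 1)) (at p)"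
    by (rule DERIV_chain2[where f = "\<lambda>p. p * ln p" and g = "\<lambda>p. 1 - p", OF a])
       (use assms in \<open>auto intro!: derivative_eq_intros\<close>)
  have "((\<lambda>p. - ((p * ln p + (1 - p) * ln (1 - p)) / ln 2)) has_real_derivative
      - ((ln p + 1 + (ln (1 - p) + 1) * (- 1)) / ln 2)) (at p)"
    by (intro DERIV_minus DERIV_cdivide DERIV_add a b assms)
  then show ?thesis by (simp add: bin_entropy_def[abs_def] log_def add_divide_distrib diff_divide_distrib)
qed

text \<open>For one input bit that is \<open>True\<close> with probability \<open>p\<close>: entropy
  of the output of the symmetric channel minus entropy of the output of the erasure channel given
  whether the bit is revealed.\<close>

definition gap :: "real \<Rightarrow> real \<Rightarrow> real \<Rightarrow> real" where
  "gap r \<rho> p = bin_entropy (\<rho> + (1 - 2 * \<rho>) * p) - r * bin_entropy p"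

definition gap' :: "real \<Rightarrow> real \<Rightarrow> real \<Rightarrow> real" where
  "gap' r \<rho> p = (1 - 2 * \<rho>) * (log 2 (1 - (\<rho> + (1 - 2 * \<rho>) * p)) - log 2 (\<rho> + (1 - 2 * \<rho>) * p))
     - r * (log 2 (1 - p) - log 2 p)"

lemma gap_flip: "gap r \<rho> (1 - p) = gap r \<rho> p"
proof -
  have "\<rho> + (1 - 2 * \<rho>) * (1 - p) = 1 - (\<rho> + (1 - 2 * \<rho>) * p)" by (simp add: algebra_simps)
  then show ?thesis unfolding gap_def bin_entropy_flip by (simp only: bin_entropy_flip)
qed

locale gap_params =
  fixes r \<rho> :: real
  assumes r: "0 < r" "r < 1" and \<rho>: "0 < \<rho>" "\<rho> < 1/2"
begin

lemma noisy_bounds: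
  assumes "0 \<le> p" "p \<le> 1"
  shows "0 < \<rho> + (1 - 2 * \<rho>) * p" "\<rho> + (1 - 2 * \<rho>) * p < 1"
proof -
  have "0 \<le> (1 - 2 * \<rho>) * p" using \<rho> assms by simp
  then show "0 < \<rho> + (1 - 2 * \<rho>) * p" using \<rho> by simp
  have "\<rho> + x < 1" if "x \<le> 1 - 2 * \<rho>" for x using \<rho> that by linarith
  from this[OF mult_left_le] show "\<rho> + (1 - 2 * \<rho>) * p < 1" using \<rho> assms by simp
qed

lemma noisy_bounds_le:
  assumes "0 \<le> p" "p \<le> 1"
  shows "0 \<le> \<rho> + (1 - 2 * \<rho>) * p" "\<rho> + (1 - 2 * \<rho>) * p \<le> 1"
  using noisy_bounds[OF assms] by linarith+

lemma continuous_on_gap: "continuous_on {0..1} (gap r \<rho>)"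
  unfolding gap_def[abs_def]
  by (intro continuous_intros continuous_on_compose2[OF continuous_on_bin_entropy]
      continuous_on_bin_entropy) (auto intro!: noisy_bounds_le)

lemma has_derivative_gap:
  assumes "0 < p" "p < 1"
  shows "(gap r \<rho> has_real_derivative gap' r \<rho> p) (at p)"
proof -
  have b: "0 < \<rho> + (1 - 2 * \<rho>) * p" "\<rho> + (1 - 2 * \<rho>) * p < 1"
    using noisy_bounds[of p] assms by auto
  have "((\<lambda>p. bin_entropy (\<rho> + (1 - 2 * \<rho>) * p)) has_real_derivative
     (log 2 (1 - (\<rho> + (1 - 2 * \<rho>) * p)) - log 2 (\<rho> + (1 - 2 * \<rho>) * p)) * (1 - 2 * \<rho>)) (at p)"
    by (rule DERIV_chain2[where f = bin_entropy and g = "\<lambda>p. \<rho> + (1 - 2 * \<rho>) * p", OF has_derivative_bin_entropy[OF b]])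
       (auto intro!: derivative_eq_intros)
  from DERIV_diff[OF this DERIV_cmult[OF has_derivative_bin_entropy[OF assms], of r]]
  show ?thesis by (simp add: gap_def[abs_def] gap'_def algebra_simps)
qed

text \<open>The two logarithmic terms contribute reciprocals of \<open>s * (1 - s)\<close> and
  \<open>p * (1 - p)\<close>. Once \<open>s * (1 - s)\<close> is expressed through
  \<open>p * (1 - p)\<close>, the numerator is affine in \<open>p * (1 - p)\<close>, so its sign
  changes at most once on the left half.\<close>

lemma has_derivative_gap':
  assumes "0 < p" "p < 1"
  shows "(gap' r \<rho> has_real_derivative
     (r * (\<rho> * (1 - \<rho>)) - (1 - r) * (1 - 2 * \<rho>)\<^sup>2 * (p * (1 - p))) /
     (ln 2 * (p * (1 - p)) * ((\<rho> + (1 - 2 * \<rho>) * p) * (1 - (\<rho> + (1 - 2 * \<rho>) * p))))) (at p)"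
proof -
  define s where "s = \<rho> + (1 - 2 * \<rho>) * p"
  have b: "0 < s" "s < 1"
    using noisy_bounds[of p] assms by (auto simp: s_def)
  \<comment> \<open>The variance of the noisy bit is that of the flip plus the contracted variance
    of the input.\<close>
  have ss: "s * (1 - s) = \<rho> * (1 - \<rho>) + (1 - 2 * \<rho>)\<^sup>2 * (p * (1 - p))"
    by (simp add: s_def power2_eq_square algebra_simps)
  have 0: "((\<lambda>p. ln (1 - p) / ln 2 - ln p / ln 2) has_real_derivative (- 1 / (1 - x) / ln 2 - 1 / x / ln 2)) (at x)"
    if "0 < x" "x < 1" for x :: real
    using that by (auto intro!: derivative_eq_intros)
  have 2: "((\<lambda>p. ln (1 - (\<rho> + (1 - 2 * \<rho>) * p)) / ln 2 - ln (\<rho> + (1 - 2 * \<rho>) * p) / ln 2) has_real_derivative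
     (- 1 / (1 - s) / ln 2 - 1 / s / ln 2) * (1 - 2 * \<rho>)) (at p)"
    by (rule DERIV_chain2[where f = "\<lambda>p. ln (1 - p) / ln 2 - ln p / ln 2" and g = "\<lambda>p. \<rho> + (1 - 2 * \<rho>) * p"],
        fold s_def, rule 0[OF b]) (auto intro!: derivative_eq_intros)
  have 1: "((\<lambda>p. (1 - 2 * \<rho>) * (ln (1 - (\<rho> + (1 - 2 * \<rho>) * p)) / ln 2 - ln (\<rho> + (1 - 2 * \<rho>) * p) / ln 2)
      - r * (ln (1 - p) / ln 2 - ln p / ln 2)) has_real_derivative
     (1 - 2 * \<rho>) * ((- 1 / (1 - s) / ln 2 - 1 / s / ln 2) * (1 - 2 * \<rho>)) - r * (- 1 / (1 - p) / ln 2 - 1 / p / ln 2)) (at p)"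
    by (rule DERIV_diff[OF DERIV_cmult[OF 2] DERIV_cmult[OF 0[OF assms]]])
  have e1: "(- 1 / (1 - s) / ln 2 - 1 / s / ln 2) * (1 - 2 * \<rho>) = - (1 - 2 * \<rho>) / (ln 2 * (s * (1 - s)))"
    using b by (simp add: field_simps)
  have e2: "- 1 / (1 - p) / ln 2 - 1 / p / ln 2 = - 1 / (ln 2 * (p * (1 - p)))"
    using assms by (simp add: field_simps)
  have pp: "p * (1 - p) \<noteq> 0" "s * (1 - s) \<noteq> 0" using assms b by auto
  have "(1 - 2 * \<rho>) * (- (1 - 2 * \<rho>) / (ln 2 * (s * (1 - s)))) - r * (- 1 / (ln 2 * (p * (1 - p))))
     = (r * (s * (1 - s)) - (1 - 2 * \<rho>)\<^sup>2 * (p * (1 - p))) / (ln 2 * (p * (1 - p)) * (s * (1 - s)))"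
  proof -
    have "c * (- c / (L * S)) - r * (- 1 / (L * P)) = (r * S - c\<^sup>2 * P) / (L * P * S)"
      if "L \<noteq> 0" "S \<noteq> 0" "P \<noteq> 0" for c L S P :: real
      using that by (simp add: field_simps power2_eq_square)
    note * = this
    show ?thesis by (rule *) (use pp in simp_all)
  qed
  also have "r * (s * (1 - s)) - (1 - 2 * \<rho>)\<^sup>2 * (p * (1 - p)) =
      r * (\<rho> * (1 - \<rho>)) - (1 - r) * (1 - 2 * \<rho>)\<^sup>2 * (p * (1 - p))"
    unfolding ss by (simp add: algebra_simps)
  finally have e3: "(1 - 2 * \<rho>) * (- (1 - 2 * \<rho>) / (ln 2 * (s * (1 - s)))) - r * (- 1 / (ln 2 * (p * (1 - p))))
     = (r * (\<rho> * (1 - \<rho>)) - (1 - r) * (1 - 2 * \<rho>)\<^sup>2 * (p * (1 - p))) / (ln 2 * (p * (1 - p)) * (s * (1 - s)))" .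
  show ?thesis
    using 1 unfolding e1 e2 e3 unfolding s_def gap'_def[abs_def] log_def .
qed

lemma gap'_half: "gap' r \<rho> (1/2) = 0"
proof -
  have "1 - (\<rho> + (1 - 2 * \<rho>) * (1/2)) = \<rho> + (1 - 2 * \<rho>) * (1/2)" by (simp add: field_simps)
  then show ?thesis unfolding gap'_def by (simp only:) simp
qed

text \<open>Nonnegativity of the numerator of the second derivative: for \<open>0 < p < 1\<close> it
  says that \<open>gap r \<rho>\<close> is convex at \<open>p\<close>.\<close>

definition thr where "thr p \<longleftrightarrow> (1 - r) * (1 - 2 * \<rho>)\<^sup>2 * (p * (1 - p)) \<le> r * (\<rho> * (1 - \<rho>))"

lemma thr_mono:
  assumes "p \<le> q" "q \<le> 1/2" "thr q" shows "thr p"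
proof -
  have "0 \<le> (q - p) * (1 - p - q)" using assms by (intro mult_nonneg_nonneg) auto
  then have "p * (1 - p) \<le> q * (1 - q)" by (simp add: algebra_simps)
  then have "(1 - r) * (1 - 2 * \<rho>)\<^sup>2 * (p * (1 - p)) \<le> (1 - r) * (1 - 2 * \<rho>)\<^sup>2 * (q * (1 - q))"
    using r by (intro mult_left_mono) auto
  then show ?thesis using assms unfolding thr_def by linarith
qed

lemma gap'_mono:
  assumes "0 < p" "p \<le> q" "q \<le> 1/2" "thr q"
  shows "gap' r \<rho> p \<le> gap' r \<rho> q"
proof (rule DERIV_nonneg_imp_nondecreasing[OF assms(2)])
  fix x assume x: "p \<le> x" "x \<le> q"
  with assms have x': "0 < x" "x < 1" by auto
  have "thr x" using thr_mono assms x by blast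
  then have "0 \<le> (r * (\<rho> * (1 - \<rho>)) - (1 - r) * (1 - 2 * \<rho>)\<^sup>2 * (x * (1 - x))) /
     (ln 2 * (x * (1 - x)) * ((\<rho> + (1 - 2 * \<rho>) * x) * (1 - (\<rho> + (1 - 2 * \<rho>) * x))))"
    unfolding thr_def using x' noisy_bounds[of x]
    by (intro divide_nonneg_nonneg mult_nonneg_nonneg) auto
  with has_derivative_gap'[OF x']
  show "\<exists>y. (gap' r \<rho> has_real_derivative y) (at x) \<and> 0 \<le> y" by blast
qed

text \<open>Past the threshold \<open>gap'\<close> decreases all the way to \<open>1/2\<close>,
  where it vanishes by symmetry.\<close>

lemma gap'_nonneg:
  assumes "0 < p" "p \<le> 1/2" "\<not> thr p"
  shows "0 \<le> gap' r \<rho> p"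
proof -
  have "gap' r \<rho> (1/2) \<le> gap' r \<rho> p"
  proof (rule DERIV_nonpos_imp_nonincreasing[OF assms(2)])
    fix x assume x: "p \<le> x" "x \<le> 1/2"
    with assms have x': "0 < x" "x < 1" by auto
    have "\<not> thr x" using thr_mono assms x by blast
    then have "(r * (\<rho> * (1 - \<rho>)) - (1 - r) * (1 - 2 * \<rho>)\<^sup>2 * (x * (1 - x))) /
       (ln 2 * (x * (1 - x)) * ((\<rho> + (1 - 2 * \<rho>) * x) * (1 - (\<rho> + (1 - 2 * \<rho>) * x)))) \<le> 0"
      unfolding thr_def using x' noisy_bounds[of x]
      by (intro divide_nonpos_nonneg mult_nonneg_nonneg) auto
    with has_derivative_gap'[OF x']
    show "\<exists>y. (gap' r \<rho> has_real_derivative y) (at x) \<and> y \<le> 0" by blast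
  qed
  then show ?thesis by (simp add: gap'_half)
qed

text \<open>The gap derivative first increases, then decreases to \<open>0\<close> at \<open>1/2\<close>: once nonnegative it stays so.\<close>

lemma gap'_nonneg_later:
  assumes "0 < p" "p \<le> q" "q \<le> 1/2" "0 \<le> gap' r \<rho> p"
  shows "0 \<le> gap' r \<rho> q"
  using gap'_mono[of p q] gap'_nonneg[of q] assms by fastforce

lemma gap_le_half:
  assumes "0 < p" "p \<le> 1/2" "0 \<le> gap' r \<rho> p"
  shows "gap r \<rho> p \<le> gap r \<rho> (1/2)"
proof (rule DERIV_nonneg_imp_nondecreasing[OF assms(2)])
  fix x assume x: "p \<le> x" "x \<le> 1/2"
  with assms have x': "0 < x" "x < 1" by auto
  from gap'_nonneg_later[of p x] assms x has_derivative_gap[OF x']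
  show "\<exists>y. (gap r \<rho> has_real_derivative y) (at x) \<and> 0 \<le> y" by blast
qed

lemma gap_mvt:
  assumes "0 \<le> a" "a < b" "b \<le> 1"
  obtains z where "a < z" "z < b" "gap r \<rho> b - gap r \<rho> a = gap' r \<rho> z * (b - a)"
proof -
  have "continuous_on {a..b} (gap r \<rho>)"
    by (rule continuous_on_subset[OF continuous_on_gap]) (use assms in auto)
  moreover have "(gap r \<rho> has_derivative (\<lambda>h. gap' r \<rho> x * h)) (at x)" if "a < x" "x < b" for x
    using has_derivative_gap[of x] that assms by (simp add: has_field_derivative_def)
  ultimately obtain z where "a < z" "z < b" "gap r \<rho> b - gap r \<rho> a = gap' r \<rho> z * (b - a)"
    using mvt[OF assms(2), of "gap r \<rho>" "\<lambda>x h. gap' r \<rho> x * h"] by blast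
  then show ?thesis using that by blast
qed

text \<open>A negative slope places \<open>p\<close> in the convex region. To the left the slopes
  are smaller; to the right they are larger, either by convexity or because they are nonnegative
  beyond the threshold. The mean value theorem then gives the bound on the left half, and reflection
  gives the rest.\<close>

lemma gap_tangent:
  assumes p: "0 < p" "p \<le> 1/2" "gap' r \<rho> p < 0" and q: "0 \<le> q" "q \<le> 1"
  shows "gap r \<rho> p + gap' r \<rho> p * (q - p) \<le> gap r \<rho> q"
proof -
  have thr: "thr p" using gap'_nonneg p by force
  have half: "gap r \<rho> p + gap' r \<rho> p * (q - p) \<le> gap r \<rho> q" if q: "0 \<le> q" "q \<le> 1/2" for q
  proof -
    consider "q < p" | "q = p" | "p < q" by linarith
    then show ?thesis
    proof cases
      case 1
      then obtain z where z: "q < z" "z < p" "gap r \<rho> p - gap r \<rho> q = gap' r \<rho> z * (p - q)"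
        using gap_mvt[of q p] p q by auto
      have "gap' r \<rho> z \<le> gap' r \<rho> p" using gap'_mono[of z p] z p q thr by auto
      then have "gap' r \<rho> z * (p - q) \<le> gap' r \<rho> p * (p - q)" using 1 by (intro mult_right_mono) auto
      then show ?thesis using z(3) by (simp add: algebra_simps)
    next
      case 3
      then obtain z where z: "p < z" "z < q" "gap r \<rho> q - gap r \<rho> p = gap' r \<rho> z * (q - p)"
        using gap_mvt[of p q] p q by auto
      have "gap' r \<rho> p \<le> gap' r \<rho> z"
      proof (cases "thr z")
        case True
        then show ?thesis using gap'_mono[of p z] z p q by auto
      next
        case False
        then show ?thesis using gap'_nonneg[of z] z p q by auto
      qed
      then have "gap' r \<rho> p * (q - p) \<le> gap' r \<rho> z * (q - p)" using 3 by (intro mult_right_mono) auto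
      then show ?thesis using z(3) by (simp add: algebra_simps)
    qed simp
  qed
  show ?thesis
  proof (cases "q \<le> 1/2")
    case False
    \<comment> \<open>As the slope is negative, the tangent is higher at the reflected point
      \<open>1 - q\<close>, which lies in the half already treated and has the same gap.\<close>
    have "gap' r \<rho> p * (q - p) \<le> gap' r \<rho> p * ((1 - q) - p)"
      using False p by (intro mult_left_mono_neg) auto
    also have "gap r \<rho> p + \<dots> \<le> gap r \<rho> (1 - q)" using half[of "1 - q"] False q by simp
    finally show ?thesis by (simp add: gap_flip)
  qed (use half q in auto)
qed

lemma gap_jensen_half:
  assumes m: "\<And>q. 0 \<le> q \<Longrightarrow> q \<le> 1 \<Longrightarrow> m \<le> gap r \<rho> q"
    and l: "\<And>s. s \<in> A \<Longrightarrow> 0 \<le> l s" "sum l A = 1" 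
    and p: "\<And>s. s \<in> A \<Longrightarrow> 0 \<le> p s \<and> p s \<le> 1"
    and P: "P = (\<Sum>s\<in>A. l s * p s)" "P \<le> 1/2"
  shows "gap r \<rho> P - (\<Sum>s\<in>A. l s * gap r \<rho> (p s)) \<le> gap r \<rho> (1/2) - m"
proof -
  have fin: "finite A" using l(2) by (metis sum.infinite zero_neq_one)
  have P0: "0 \<le> P" unfolding P using l p by (intro sum_nonneg) auto
  have avg: "(\<Sum>s\<in>A. l s * c) = c" for c using l(2) by (simp add: sum_distrib_right[symmetric])
  have low: "m \<le> (\<Sum>s\<in>A. l s * gap r \<rho> (p s))"
    using sum_mono[of A "\<lambda>s. l s * m" "\<lambda>s. l s * gap r \<rho> (p s)"] l p m by (simp add: avg mult_left_mono)
  have hm: "m \<le> gap r \<rho> (1/2)" by (rule m) auto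
  consider "P = 0" | "0 < P" "0 \<le> gap' r \<rho> P" | "0 < P" "gap' r \<rho> P < 0" using P0 by linarith
  then show ?thesis
  proof cases
    \<comment> \<open>The derivative is available only inside the interval. For \<open>P = 0\<close>
      every \<open>p s\<close> of positive weight is \<open>0\<close>, so there is no Jensen defect
      at all.\<close>
    case 1
    then have "\<forall>s\<in>A. l s * p s = 0" using P(1) l p fin by (subst (asm) eq_commute) (simp add: sum_nonneg_eq_0_iff)
    then have "(\<Sum>s\<in>A. l s * gap r \<rho> (p s)) = (\<Sum>s\<in>A. l s * gap r \<rho> 0)" by (intro sum.cong) auto
    then show ?thesis using avg 1 hm by simp
  next
    case 2
    then show ?thesis using gap_le_half[of P] P low by linarith
  next
    case 3
    \<comment> \<open>The linear part of the tangent averages to \<open>0\<close> around the mean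
      \<open>P\<close>.\<close>
    have "(\<Sum>s\<in>A. l s * (gap r \<rho> P + gap' r \<rho> P * (p s - P))) \<le> (\<Sum>s\<in>A. l s * gap r \<rho> (p s))"
      using l p 3 P by (intro sum_mono mult_left_mono gap_tangent) auto
    moreover have "(\<Sum>s\<in>A. l s * (gap r \<rho> P + gap' r \<rho> P * (p s - P))) = gap r \<rho> P"
    proof -
      have "(\<Sum>s\<in>A. l s * (gap r \<rho> P + gap' r \<rho> P * (p s - P))) =
        (\<Sum>s\<in>A. l s * (gap r \<rho> P - gap' r \<rho> P * P)) + gap' r \<rho> P * (\<Sum>s\<in>A. l s * p s)"
        unfolding sum_distrib_left sum.distrib[symmetric] by (intro sum.cong) (auto simp: algebra_simps)
      then show ?thesis using avg P(1) by simp
    qed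
    ultimately show ?thesis using hm by linarith
  qed
qed

lemma gap_jensen:
  assumes m: "\<And>q. 0 \<le> q \<Longrightarrow> q \<le> 1 \<Longrightarrow> m \<le> gap r \<rho> q"
    and l: "\<And>s. s \<in> A \<Longrightarrow> 0 \<le> l s" "sum l A = 1" 
    and p: "\<And>s. s \<in> A \<Longrightarrow> 0 \<le> p s \<and> p s \<le> 1"
  shows "gap r \<rho> (\<Sum>s\<in>A. l s * p s) - (\<Sum>s\<in>A. l s * gap r \<rho> (p s)) \<le> gap r \<rho> (1/2) - m"
proof (cases "(\<Sum>s\<in>A. l s * p s) \<le> 1/2")
  case True
  then show ?thesis by (intro gap_jensen_half assms) auto
next
  case False
  have e: "(\<Sum>s\<in>A. l s * (1 - p s)) = 1 - (\<Sum>s\<in>A. l s * p s)"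
    using l(2) by (simp add: right_diff_distrib sum_subtractf)
  have "gap r \<rho> (\<Sum>s\<in>A. l s * (1 - p s)) - (\<Sum>s\<in>A. l s * gap r \<rho> (1 - p s)) \<le> gap r \<rho> (1/2) - m"
    using False e p l by (intro gap_jensen_half[where p = "\<lambda>s. 1 - p s"] m) auto
  then show ?thesis unfolding e gap_flip by simp
qed

text \<open>The homogeneous form of the gap for an unnormalised input distribution \<open>(a, b)\<close>.\<close>

definition hgap :: "real \<Rightarrow> real \<Rightarrow> real" where
  "hgap a b = eta ((1 - \<rho>) * a + \<rho> * b) + eta (\<rho> * a + (1 - \<rho>) * b)
     - (1 - r) * eta (a + b) - r * (eta a + eta b)"

text \<open>By the product rule \<open>eta_mult\<close> the total mass \<open>t\<close> enters
  through \<open>eta t\<close> with coefficient \<open>1 - (1 - r) - r = 0\<close>, which leaves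
  only a factor \<open>t\<close>.\<close>

lemma hgap_eq:
  assumes "0 \<le> a" "0 \<le> b"
  shows "hgap a b = (a + b) * gap r \<rho> (b / (a + b))"
proof (cases "a + b = 0")
  case True
  then have "a = 0" "b = 0" using assms by auto
  then show ?thesis by (simp add: hgap_def)
next
  case False
  define t p where "t = a + b" and "p = b / (a + b)"
  have t: "t > 0" using False assms by (simp add: t_def)
  have p: "0 \<le> p" "p \<le> 1" using assms t by (auto simp: p_def t_def divide_simps)
  have a: "a = t * (1 - p)" and b: "b = t * p" using t by (auto simp: p_def t_def field_simps)
  define s where "s = \<rho> + (1 - 2 * \<rho>) * p"
  have s: "0 \<le> s" "s \<le> 1" using noisy_bounds[of p] p by (auto simp: s_def)
  have e: "(1 - \<rho>) * a + \<rho> * b = t * (1 - s)" "\<rho> * a + (1 - \<rho>) * b = t * s" "a + b = t"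
    unfolding a b s_def by (simp_all add: algebra_simps)
  have "hgap a b = t * (bin_entropy s - r * bin_entropy p)"
    unfolding hgap_def e unfolding a b bin_entropy_eta
    using t p s by (simp add: eta_mult) (simp add: algebra_simps)
  then show ?thesis by (simp add: gap_def s_def t_def p_def)
qed

lemma hgap_jensen:
  assumes m: "\<And>q. 0 \<le> q \<Longrightarrow> q \<le> 1 \<Longrightarrow> m \<le> gap r \<rho> q"
    and A: "finite A" "\<And>s. s \<in> A \<Longrightarrow> 0 \<le> a s" "\<And>s. s \<in> A \<Longrightarrow> 0 \<le> b s"
  shows "hgap (sum a A) (sum b A) - (\<Sum>s\<in>A. hgap (a s) (b s))
     \<le> (gap r \<rho> (1/2) - m) * (sum a A + sum b A)"
proof (cases "sum a A + sum b A = 0")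
  case True
  have ab: "0 \<le> sum a A" "0 \<le> sum b A" using A by (auto intro: sum_nonneg)
  then have "sum a A = 0" "sum b A = 0" using True by linarith+
  moreover from this have "\<forall>s\<in>A. a s = 0 \<and> b s = 0" using A by (simp add: sum_nonneg_eq_0_iff)
  ultimately show ?thesis by (simp add: hgap_def)
next
  case False
  define t where "t = sum a A + sum b A"
  have ab: "0 \<le> sum a A" "0 \<le> sum b A" using A by (auto intro: sum_nonneg)
  then have t: "t > 0" using False by (simp add: t_def)
  \<comment> \<open>If \<open>a s + b s = 0\<close>, division by zero makes \<open>p s\<close> equal
    to \<open>0\<close>, which is harmless because the weight \<open>l s\<close> is \<open>0\<close>
    too.\<close>
  define l p where "l = (\<lambda>s. (a s + b s) / t)" and "p = (\<lambda>s. b s / (a s + b s))"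
  have lp: "l s * p s = b s / t" if "s \<in> A" for s
    using A(2,3)[OF that] by (cases "a s + b s = 0") (auto simp: l_def p_def)
  then have P: "(\<Sum>s\<in>A. l s * p s) = sum b A / t" by (simp add: sum_divide_distrib)
  have l: "sum l A = 1" using t by (simp add: l_def sum_divide_distrib[symmetric] sum.distrib t_def)
  have "gap r \<rho> (\<Sum>s\<in>A. l s * p s) - (\<Sum>s\<in>A. l s * gap r \<rho> (p s)) \<le> gap r \<rho> (1/2) - m"
  proof (rule gap_jensen[OF m _ l])
    show "0 \<le> l s" if "s \<in> A" for s using A(2,3)[OF that] t by (simp add: l_def)
    show "0 \<le> p s \<and> p s \<le> 1" if "s \<in> A" for s using A(2,3)[OF that] by (auto simp: p_def divide_simps)
  qed
  from mult_left_mono[OF this, of t] t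
  have "t * gap r \<rho> (sum b A / t) - (\<Sum>s\<in>A. t * (l s * gap r \<rho> (p s))) \<le> t * (gap r \<rho> (1/2) - m)"
    by (simp add: P right_diff_distrib sum_distrib_left)
  moreover have "t * gap r \<rho> (sum b A / t) = hgap (sum a A) (sum b A)"
    using hgap_eq[OF ab] by (simp add: t_def)
  moreover have "(\<Sum>s\<in>A. t * (l s * gap r \<rho> (p s))) = (\<Sum>s\<in>A. hgap (a s) (b s))"
    using t by (intro sum.cong refl, subst hgap_eq) (auto simp: A l_def p_def)
  ultimately show ?thesis by (simp add: t_def mult.commute)
qed

end

section \<open>Comparison of the two channels\<close>

lemma finite_words [simp]: "finite (words n)"
proof -
  have "words n = {xs. set xs \<subseteq> UNIV \<and> length xs = n}" by (auto simp: words_def)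
  then show ?thesis using finite_lists_length_eq[of "UNIV :: bool set" n] by simp
qed

lemma words_0 [simp]: "words 0 = {[]}"
  by (auto simp: words_def)

lemma sum_words_Suc:
  "(\<Sum>x\<in>words (Suc n). g x) = (\<Sum>x\<in>words n. g (False # x)) + (\<Sum>x\<in>words n. g (True # x))"
proof -
  have e: "words (Suc n) = Cons False ` words n \<union> Cons True ` words n"
    by (auto simp: words_def length_Suc_conv image_iff) 
  show ?thesis unfolding e
    by (subst sum.union_disjoint) (auto simp: sum.reindex)
qed

text \<open>The i.i.d. Bernoulli law on words. It serves both for error vectors and, with parameter
  \<open>r\<close>, for the pattern of positions that are read.\<close>

definition noise :: "real \<Rightarrow> bool list \<Rightarrow> real" where
  "noise \<rho> e = prod_list (map (\<lambda>b. if b then \<rho> else 1 - \<rho>) e)"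

lemma noise_simps [simp]:
  "noise \<rho> [] = 1" "noise \<rho> (b # e) = (if b then \<rho> else 1 - \<rho>) * noise \<rho> e"
  by (simp_all add: noise_def)

lemma weight_simps [simp]: "weight [] = 0" "weight (b # e) = (if b then Suc (weight e) else weight e)"
  by (simp_all add: weight_def)

lemma xorw_simps [simp]: "xorw [] [] = []" "xorw (a # x) (b # y) = (a \<noteq> b) # xorw x y"
  by (simp_all add: xorw_def)

lemma noise_nonneg: "0 \<le> \<rho> \<Longrightarrow> \<rho> \<le> 1 \<Longrightarrow> 0 \<le> noise \<rho> e"
  by (induction e) auto

lemma sum_noise: "(\<Sum>e\<in>words n. noise \<rho> e) = 1"
  by (induction n) (simp_all add: sum_words_Suc sum_distrib_left[symmetric])

text \<open>The arbitrary centre \<open>c\<close> carries the induction: a leading 1 turns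
  \<open>c\<close> into \<open>c - 1\<close>. The value is variance plus squared bias.\<close>

lemma noise_second_moment:
  "(\<Sum>e\<in>words n. noise \<rho> e * (real (weight e) - c)\<^sup>2) = real n * \<rho> * (1 - \<rho>) + (real n * \<rho> - c)\<^sup>2"
proof (induction n arbitrary: c)
  case (Suc n)
  have "(\<Sum>e\<in>words (Suc n). noise \<rho> e * (real (weight e) - c)\<^sup>2) =
    (1 - \<rho>) * (\<Sum>e\<in>words n. noise \<rho> e * (real (weight e) - c)\<^sup>2) +
    \<rho> * (\<Sum>e\<in>words n. noise \<rho> e * (real (weight e) - (c - 1))\<^sup>2)"
    by (simp add: sum_words_Suc sum_distrib_left algebra_simps)
  also have "\<dots> = real (Suc n) * \<rho> * (1 - \<rho>) + (real (Suc n) * \<rho> - c)\<^sup>2"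
    unfolding Suc.IH by (simp add: power2_eq_square algebra_simps)
  finally show ?case .
qed (simp add: power2_eq_square)

text \<open>Chebyshev's inequality, with the variance \<open>n * \<rho> * (1 - \<rho>)\<close>
  replaced by \<open>n\<close>.\<close>

lemma noise_tail:
  assumes "0 \<le> \<rho>" "\<rho> < \<tau>" "\<rho> \<le> 1" "0 < n"
  shows "(\<Sum>e\<in>{e \<in> words n. \<tau> * real n < real (weight e)}. noise \<rho> e) \<le> 1 / (real n * (\<tau> - \<rho>)\<^sup>2)"
proof -
  let ?B = "{e \<in> words n. \<tau> * real n < real (weight e)}"
  have "(\<Sum>e\<in>?B. noise \<rho> e) * (real n * (\<tau> - \<rho>))\<^sup>2 \<le> (\<Sum>e\<in>?B. noise \<rho> e * (real (weight e) - real n * \<rho>)\<^sup>2)"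
    unfolding sum_distrib_right
  proof (intro sum_mono mult_left_mono noise_nonneg assms)
    fix e assume "e \<in> ?B"
    then have "real n * (\<tau> - \<rho>) \<le> real (weight e) - real n * \<rho>" by (auto simp: algebra_simps)
    then show "(real n * (\<tau> - \<rho>))\<^sup>2 \<le> (real (weight e) - real n * \<rho>)\<^sup>2"
      using assms by (intro power_mono) auto
  qed
  also have "\<dots> \<le> (\<Sum>e\<in>words n. noise \<rho> e * (real (weight e) - real n * \<rho>)\<^sup>2)"
    by (intro sum_mono2) (auto intro!: mult_nonneg_nonneg noise_nonneg assms)
  also have "\<dots> = real n * (\<rho> * (1 - \<rho>))" by (simp add: noise_second_moment)
  also have "\<dots> \<le> real n * 1"
    using assms by (intro mult_left_mono) (auto intro: mult_le_one)
  finally have "(\<Sum>e\<in>?B. noise \<rho> e) * (real n * (\<tau> - \<rho>))\<^sup>2 \<le> real n" by simp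
  then have "real n * ((\<Sum>e\<in>?B. noise \<rho> e) * (real n * (\<tau> - \<rho>)\<^sup>2)) \<le> real n * 1"
    by (simp add: power2_eq_square mult.assoc mult.left_commute)
  then have "(\<Sum>e\<in>?B. noise \<rho> e) * (real n * (\<tau> - \<rho>)\<^sup>2) \<le> 1"
    using assms by (simp only: mult_le_cancel_left_pos of_nat_0_less_iff)
  moreover have "0 < real n * (\<tau> - \<rho>)\<^sup>2" using assms by simp
  ultimately show ?thesis by (simp only: pos_le_divide_eq)
qed

text \<open>Entropies of the outputs of the binary symmetric channel and of the erasure channel
  (which reveals each position with probability \<open>r\<close>) for an unnormalised input distribution \<open>w\<close>.\<close>

primrec HY :: "real \<Rightarrow> nat \<Rightarrow> (bool list \<Rightarrow> real) \<Rightarrow> real" where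
  "HY \<rho> 0 w = eta (w [])"
| "HY \<rho> (Suc n) w = HY \<rho> n (\<lambda>x. (1 - \<rho>) * w (False # x) + \<rho> * w (True # x))
     + HY \<rho> n (\<lambda>x. \<rho> * w (False # x) + (1 - \<rho>) * w (True # x))"

primrec HZ :: "real \<Rightarrow> nat \<Rightarrow> (bool list \<Rightarrow> real) \<Rightarrow> real" where
  "HZ r 0 w = eta (w [])"
| "HZ r (Suc n) w = (1 - r) * HZ r n (\<lambda>x. w (False # x) + w (True # x))
     + r * (HZ r n (\<lambda>x. w (False # x)) + HZ r n (\<lambda>x. w (True # x)))"

lemma HY_eq: "HY \<rho> n w = (\<Sum>y\<in>words n. eta (\<Sum>x\<in>words n. noise \<rho> (xorw x y) * w x))"
proof (induction n arbitrary: w)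
  case (Suc n)
  show ?case
    unfolding HY.simps Suc.IH sum_words_Suc sum_distrib_left
    by (intro arg_cong2[where f = "(+)"] sum.cong refl arg_cong[where f = eta])
       (simp_all add: sum.distrib[symmetric] algebra_simps)
qed simp

definition positions :: "bool list \<Rightarrow> nat set" where
  "positions s = {i. i < length s \<and> s ! i}"

lemma view_positions_Cons:
  assumes "length x = length s"
  shows "view (positions (b # s)) (a # x) = (if b then Some a else None) # view (positions s) x"
proof -
  have "[0..<Suc (length x)] = 0 # map Suc [0..<length x]"
    by (simp add: upt_conv_Cons map_Suc_upt del: upt_Suc)
  then have "view (positions (b # s)) (a # x) =
    (if 0 \<in> positions (b # s) then Some a else None) # map (\<lambda>i. if Suc i \<in> positions (b # s) then Some (x ! i) else None) [0..<length x]"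
    by (simp add: view_def del: upt_Suc)
  moreover have "0 \<in> positions (b # s) \<longleftrightarrow> b" "Suc i \<in> positions (b # s) \<longleftrightarrow> i \<in> positions s" for i
    by (auto simp: positions_def)
  ultimately show ?thesis by (simp add: view_def)
qed

lemma positions_Nil [simp]: "positions [] = {}"
  by (simp add: positions_def)

lemma positions_subset: "length s = n \<Longrightarrow> positions s \<subseteq> {..<n}"
  by (auto simp: positions_def)

lemma card_positions: "card (positions s) = weight s"
proof -
  have "positions s = {i. i < length s \<and> id (s ! i)}" by (simp add: positions_def)
  then show ?thesis by (simp add: weight_def length_filter_conv_card)
qed

definition HV :: "nat \<Rightarrow> (bool list \<Rightarrow> real) \<Rightarrow> nat set \<Rightarrow> real" where
  "HV n w S = (\<Sum>v\<in>view S ` words n. eta (\<Sum>x\<in>{x \<in> words n. view S x = v}. w x))"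

text \<open>If the first position is read, the views split according to its value; otherwise words
  differing only there share a view and their weights merge.\<close>

lemma HV_Cons:
  assumes "length s = n"
  shows "HV (Suc n) w (positions (b # s)) = (if b
     then HV n (\<lambda>x. w (False # x)) (positions s) + HV n (\<lambda>x. w (True # x)) (positions s)
     else HV n (\<lambda>x. w (False # x) + w (True # x)) (positions s))"
proof -
  let ?f = "\<lambda>a. if b then Some a else None"
  have vw: "view (positions (b # s)) (a # x) = ?f a # view (positions s) x" if "x \<in> words n" for a x
    using view_positions_Cons assms that by (simp add: words_def)
  have W: "words (Suc n) = Cons False ` words n \<union> Cons True ` words n"
    by (auto simp: words_def length_Suc_conv image_iff)
  have im: "view (positions (b # s)) ` words (Suc n) =
     Cons (?f False) ` view (positions s) ` words n \<union> Cons (?f True) ` view (positions s) ` words n"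
    unfolding W image_Un image_image by (intro arg_cong2[where f = "(\<union>)"] image_cong refl vw)
  have fib: "(\<Sum>x\<in>{x \<in> words (Suc n). view (positions (b # s)) x = c # v}. w x) =
      (\<Sum>x\<in>{x \<in> words n. view (positions s) x = v}. (if c = ?f False then w (False # x) else 0) + (if c = ?f True then w (True # x) else 0))"
    for c v
  proof -
    have "(\<Sum>x\<in>{x \<in> words (Suc n). view (positions (b # s)) x = c # v}. w x)
      = (\<Sum>x\<in>words (Suc n). if view (positions (b # s)) x = c # v then w x else 0)"
      by (simp add: sum.inter_filter)
    also have "\<dots> = (\<Sum>x\<in>words n. (if ?f False = c \<and> view (positions s) x = v then w (False # x) else 0)
         + (if ?f True = c \<and> view (positions s) x = v then w (True # x) else 0))"
      unfolding sum_words_Suc sum.distrib[symmetric] by (intro sum.cong refl) (simp add: vw)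
    also have "\<dots> = (\<Sum>x\<in>{x \<in> words n. view (positions s) x = v}. (if c = ?f False then w (False # x) else 0) + (if c = ?f True then w (True # x) else 0))"
      unfolding sum.inter_filter[OF finite_words] by (intro sum.cong refl) auto
    finally show ?thesis .
  qed
  show ?thesis
  proof (cases b)
    case True
    have d: "Cons (Some False) ` view (positions s) ` words n \<inter> Cons (Some True) ` view (positions s) ` words n = {}" by auto
    have "HV (Suc n) w (positions (b # s)) =
      (\<Sum>v\<in>view (positions s) ` words n. eta (\<Sum>x\<in>{x \<in> words (Suc n). view (positions (b # s)) x = Some False # v}. w x))
      + (\<Sum>v\<in>view (positions s) ` words n. eta (\<Sum>x\<in>{x \<in> words (Suc n). view (positions (b # s)) x = Some True # v}. w x))"
      unfolding HV_def im using True d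
      by (simp add: sum.union_disjoint) (simp add: sum.reindex)
    also have "\<dots> = HV n (\<lambda>x. w (False # x)) (positions s) + HV n (\<lambda>x. w (True # x)) (positions s)"
      unfolding fib HV_def using True by simp
    finally show ?thesis using True by simp
  next
    case False
    have "HV (Suc n) w (positions (b # s)) =
      (\<Sum>v\<in>view (positions s) ` words n. eta (\<Sum>x\<in>{x \<in> words (Suc n). view (positions (b # s)) x = None # v}. w x))"
      unfolding HV_def im using False by (simp add: sum.reindex)
    also have "\<dots> = HV n (\<lambda>x. w (False # x) + w (True # x)) (positions s)"
      unfolding fib HV_def using False by simp
    finally show ?thesis using False by simp
  qed
qed

text \<open>Thus \<open>HZ\<close> is an average over reading patterns: the entropy of the view
  given the pattern, without the entropy of the pattern itself. This links the recursion to the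
  deterministic reading sets of the channel.\<close>

lemma HZ_eq: "HZ r n w = (\<Sum>s\<in>words n. noise r s * HV n w (positions s))"
proof (induction n arbitrary: w)
  case 0
  show ?case by (simp add: HV_def view_def)
next
  case (Suc n)
  have "(\<Sum>s\<in>words n. noise r (b # s) * HV (Suc n) w (positions (b # s))) =
     (if b then r * (HZ r n (\<lambda>x. w (False # x)) + HZ r n (\<lambda>x. w (True # x)))
      else (1 - r) * HZ r n (\<lambda>x. w (False # x) + w (True # x)))" for b
    unfolding Suc.IH
    by (auto simp: HV_Cons words_def sum_distrib_left sum.distrib[symmetric] algebra_simps intro!: sum.cong)
  from this[of False] this[of True] show ?case
    unfolding HZ.simps sum_words_Suc by (simp only: if_True if_False)
qed

section \<open>Exchange of the symmetric channel for the erasure channel, one position at a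
  time\<close>

context gap_params
begin

text \<open>\<open>u\<close> and \<open>v\<close> are the restrictions of a weight on words of
  length \<open>n + 1\<close> to the leading symbols \<open>False\<close> and \<open>True\<close>.
  The value is the entropy when only the leading position passes the symmetric channel, minus the
  entropy when all positions pass the erasure channel.\<close>

definition Psi :: "nat \<Rightarrow> (bool list \<Rightarrow> real) \<Rightarrow> (bool list \<Rightarrow> real) \<Rightarrow> real" where
  "Psi n u v = HZ r n (\<lambda>x. (1 - \<rho>) * u x + \<rho> * v x) + HZ r n (\<lambda>x. \<rho> * u x + (1 - \<rho>) * v x)
     - (1 - r) * HZ r n (\<lambda>x. u x + v x) - r * (HZ r n u + HZ r n v)"

text \<open>The channel at the leading position acts linearly on the pair \<open>(u, v)\<close>,
  hence commutes with erasing or revealing another position.\<close>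

lemma Psi_Suc:
  "Psi (Suc n) u v = (1 - r) * Psi n (\<lambda>x. u (False # x) + u (True # x)) (\<lambda>x. v (False # x) + v (True # x))
     + r * (Psi n (\<lambda>x. u (False # x)) (\<lambda>x. v (False # x)) + Psi n (\<lambda>x. u (True # x)) (\<lambda>x. v (True # x)))"
proof -
  have 1: "(\<lambda>x. a * u (False # x) + b * v (False # x) + (a * u (True # x) + b * v (True # x)))
    = (\<lambda>x. a * (u (False # x) + u (True # x)) + b * (v (False # x) + v (True # x)))" for a b
    by (auto simp: algebra_simps)
  have 2: "(\<lambda>x. u (False # x) + v (False # x) + (u (True # x) + v (True # x)))
    = (\<lambda>x. u (False # x) + u (True # x) + (v (False # x) + v (True # x)))"
    by (auto simp: algebra_simps)
  show ?thesis unfolding Psi_def HZ.simps 1 2 by (simp add: algebra_simps)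
qed

text \<open>The symbols at the other positions are processed one by one: an erased one merges
  weights, a revealed one splits them, and both branches again satisfy the hypotheses. At the end
  only the single-letter inequality \<open>hgap_jensen\<close> is left. The index \<open>s\<close>
  will be the message.\<close>

lemma Psi_le:
  assumes m: "\<And>q. 0 \<le> q \<Longrightarrow> q \<le> 1 \<Longrightarrow> m \<le> gap r \<rho> q"
    and A: "finite A" "\<And>s x. s \<in> A \<Longrightarrow> 0 \<le> u s x" "\<And>s x. s \<in> A \<Longrightarrow> 0 \<le> v s x"
  shows "Psi n (\<lambda>x. \<Sum>s\<in>A. u s x) (\<lambda>x. \<Sum>s\<in>A. v s x) - (\<Sum>s\<in>A. Psi n (u s) (v s))
    \<le> (gap r \<rho> (1/2) - m) * (\<Sum>s\<in>A. \<Sum>x\<in>words n. u s x + v s x)"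
  using A(2,3)
proof (induction n arbitrary: u v)
  case 0
  have "Psi 0 a b = hgap (a []) (b [])" for a b by (simp add: Psi_def hgap_def)
  then show ?case using hgap_jensen[OF m A(1), of "\<lambda>s. u s []" "\<lambda>s. v s []"] 0
    by (simp add: sum.distrib)
next
  case (Suc n)
  let ?D = "gap r \<rho> (1/2) - m"
  let ?c = "\<lambda>b u s x. u s (b # x)"
  let ?T = "\<lambda>u v. (\<Sum>s\<in>A. \<Sum>x\<in>words n. u s x + v s x)"
  let ?L = "\<lambda>u v. Psi n (\<lambda>x. \<Sum>s\<in>A. u s x) (\<lambda>x. \<Sum>s\<in>A. v s x) - (\<Sum>s\<in>A. Psi n (u s) (v s))"
  let ?p = "\<lambda>u s x. u s (False # x) + u s (True # x)"
  have a: "?L (?p u) (?p v) \<le> ?D * ?T (?p u) (?p v)"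
    using Suc.IH[of "?p u" "?p v"] Suc.prems by simp
  have b: "?L (?c c u) (?c c v) \<le> ?D * ?T (?c c u) (?c c v)" for c
    using Suc.IH[of "?c c u" "?c c v"] Suc.prems by simp
  have "Psi (Suc n) (\<lambda>x. \<Sum>s\<in>A. u s x) (\<lambda>x. \<Sum>s\<in>A. v s x) - (\<Sum>s\<in>A. Psi (Suc n) (u s) (v s))
    = (1 - r) * ?L (?p u) (?p v) + r * (?L (?c False u) (?c False v) + ?L (?c True u) (?c True v))"
    unfolding Psi_Suc sum.distrib sum_distrib_left[symmetric] by (simp add: algebra_simps)
  also have "\<dots> \<le> (1 - r) * (?D * ?T (?p u) (?p v)) + r * (?D * ?T (?c False u) (?c False v) + ?D * ?T (?c True u) (?c True v))"
    using a b r by (intro add_mono mult_left_mono) auto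
  also have "\<dots> = ?D * (\<Sum>s\<in>A. \<Sum>x\<in>words (Suc n). u s x + v s x)"
    unfolding sum_words_Suc by (simp add: sum.distrib algebra_simps)
  finally show ?case .
qed

text \<open>Both channels are compared through the hybrid output whose first position went through
  the symmetric channel and whose other positions went through the erasure channel.\<close>

lemma entropy_gap_le:
  assumes m: "\<And>q. 0 \<le> q \<Longrightarrow> q \<le> 1 \<Longrightarrow> m \<le> gap r \<rho> q"
    and A: "finite A" "\<And>s x. s \<in> A \<Longrightarrow> 0 \<le> w s x"
  shows "(HY \<rho> n (\<lambda>x. \<Sum>s\<in>A. w s x) - HZ r n (\<lambda>x. \<Sum>s\<in>A. w s x)) - (\<Sum>s\<in>A. HY \<rho> n (w s) - HZ r n (w s))
    \<le> real n * (gap r \<rho> (1/2) - m) * (\<Sum>s\<in>A. \<Sum>x\<in>words n. w s x)"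
  using A(2)
proof (induction n arbitrary: w)
  case (Suc n)
  let ?D = "gap r \<rho> (1/2) - m"
  let ?T = "\<lambda>w. (\<Sum>s\<in>A. \<Sum>x\<in>words n. w s x)"
  let ?L = "\<lambda>w. (HY \<rho> n (\<lambda>x. \<Sum>s\<in>A. w s x) - HZ r n (\<lambda>x. \<Sum>s\<in>A. w s x)) - (\<Sum>s\<in>A. HY \<rho> n (w s) - HZ r n (w s))"
  let ?y = "\<lambda>a b w (x :: bool list). a * w (False # x) + b * (w (True # x) :: real)"
  have lin: "?y a b (\<lambda>x. \<Sum>s\<in>A. w s x) = (\<lambda>x. \<Sum>s\<in>A. ?y a b (w s) x)" for a b
    by (auto simp: sum_distrib_left sum.distrib)
  \<comment> \<open>The entropy of the hybrid is added and subtracted. Each output value of the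
    first position leaves a weight on \<open>n\<close> positions for the induction hypothesis, and
    \<open>Psi\<close> is the cost of exchanging the first channel.\<close>
  have split: "HY \<rho> (Suc n) w' - HZ r (Suc n) w' =
     (HY \<rho> n (?y (1 - \<rho>) \<rho> w') - HZ r n (?y (1 - \<rho>) \<rho> w')) + (HY \<rho> n (?y \<rho> (1 - \<rho>) w') - HZ r n (?y \<rho> (1 - \<rho>) w'))
     + Psi n (\<lambda>x. w' (False # x)) (\<lambda>x. w' (True # x))" for w'
    by (simp add: Psi_def algebra_simps)
  have 1: "?L (\<lambda>s. ?y (1 - \<rho>) \<rho> (w s)) \<le> real n * ?D * ?T (\<lambda>s. ?y (1 - \<rho>) \<rho> (w s))"
    "?L (\<lambda>s. ?y \<rho> (1 - \<rho>) (w s)) \<le> real n * ?D * ?T (\<lambda>s. ?y \<rho> (1 - \<rho>) (w s))"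
    using Suc.IH[of "\<lambda>s. ?y (1 - \<rho>) \<rho> (w s)"] Suc.IH[of "\<lambda>s. ?y \<rho> (1 - \<rho>) (w s)"] Suc.prems \<rho>
    by simp_all
  have 2: "Psi n (\<lambda>x. \<Sum>s\<in>A. w s (False # x)) (\<lambda>x. \<Sum>s\<in>A. w s (True # x)) - (\<Sum>s\<in>A. Psi n (\<lambda>x. w s (False # x)) (\<lambda>x. w s (True # x)))
    \<le> ?D * (\<Sum>s\<in>A. \<Sum>x\<in>words n. w s (False # x) + w s (True # x))"
    using Psi_le[OF m A(1), of "\<lambda>s x. w s (False # x)" "\<lambda>s x. w s (True # x)"] Suc.prems by simp
  have "(HY \<rho> (Suc n) (\<lambda>x. \<Sum>s\<in>A. w s x) - HZ r (Suc n) (\<lambda>x. \<Sum>s\<in>A. w s x)) - (\<Sum>s\<in>A. HY \<rho> (Suc n) (w s) - HZ r (Suc n) (w s))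
    = ?L (\<lambda>s. ?y (1 - \<rho>) \<rho> (w s)) + ?L (\<lambda>s. ?y \<rho> (1 - \<rho>) (w s)) +
      (Psi n (\<lambda>x. \<Sum>s\<in>A. w s (False # x)) (\<lambda>x. \<Sum>s\<in>A. w s (True # x)) - (\<Sum>s\<in>A. Psi n (\<lambda>x. w s (False # x)) (\<lambda>x. w s (True # x))))"
    unfolding split lin sum.distrib by simp
  also have "\<dots> \<le> real n * ?D * ?T (\<lambda>s. ?y (1 - \<rho>) \<rho> (w s)) + real n * ?D * ?T (\<lambda>s. ?y \<rho> (1 - \<rho>) (w s))
     + ?D * (\<Sum>s\<in>A. \<Sum>x\<in>words n. w s (False # x) + w s (True # x))"
    using 1 2 by (intro add_mono) auto
  also have "\<dots> = real n * ?D * (?T (\<lambda>s. ?y (1 - \<rho>) \<rho> (w s)) + ?T (\<lambda>s. ?y \<rho> (1 - \<rho>) (w s)))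
     + ?D * (\<Sum>s\<in>A. \<Sum>x\<in>words n. w s (False # x) + w s (True # x))"
    by (simp only: distrib_left)
  \<comment> \<open>For each input bit the two transition probabilities add up to 1, so mass is
    preserved.\<close>
  also have "?T (\<lambda>s. ?y (1 - \<rho>) \<rho> (w s)) + ?T (\<lambda>s. ?y \<rho> (1 - \<rho>) (w s)) = (\<Sum>s\<in>A. \<Sum>x\<in>words n. w s (False # x) + w s (True # x))"
    unfolding sum.distrib[symmetric] by (intro sum.cong refl) (simp add: algebra_simps)
  also have "real n * ?D * (\<Sum>s\<in>A. \<Sum>x\<in>words n. w s (False # x) + w s (True # x)) + ?D * (\<Sum>s\<in>A. \<Sum>x\<in>words n. w s (False # x) + w s (True # x))
    = real (Suc n) * ?D * (\<Sum>s\<in>A. \<Sum>x\<in>words (Suc n). w s x)"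
    unfolding sum_words_Suc sum.distrib by (simp add: algebra_simps)
  finally show ?case .
qed simp

end

section \<open>Equivocation of reliable codes\<close>

text \<open>Each term is compared with the common ratio \<open>B / A\<close> through
  \<open>ln x \<le> x - 1\<close>; the corrections sum to zero. This one inequality later yields
  data processing, the bound \<open>log 2 K\<close>, Fano's inequality and the secrecy
  estimate.\<close>

lemma log_sum_inequality:
  assumes I: "finite I" and a: "\<And>i. i \<in> I \<Longrightarrow> 0 \<le> a i" and b: "\<And>i. i \<in> I \<Longrightarrow> 0 \<le> b i"
    and ab: "\<And>i. i \<in> I \<Longrightarrow> b i = 0 \<Longrightarrow> a i = 0"
  shows "(\<Sum>i\<in>I. a i * log 2 (b i / a i)) \<le> sum a I * log 2 (sum b I / sum a I)"
proof (cases "sum a I = 0")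
  case True
  then have "\<forall>i\<in>I. a i = 0" using a I by (simp add: sum_nonneg_eq_0_iff)
  then show ?thesis using True by simp
next
  case False
  define A B where "A = sum a I" and "B = sum b I"
  have A: "A > 0" using False sum_nonneg[of I a] a by (simp add: A_def)
  have B: "B > 0"
  proof (rule ccontr)
    assume "\<not> B > 0"
    then have "B = 0" using sum_nonneg[of I b] b by (simp add: B_def)
    then have "\<forall>i\<in>I. b i = 0" using b I by (simp add: sum_nonneg_eq_0_iff B_def)
    then have "\<forall>i\<in>I. a i = 0" using ab by blast
    then show False using False by simp
  qed
  have "a i * log 2 (b i / a i) \<le> a i * log 2 (B / A) + (b i * A / B - a i) / ln 2" if "i \<in> I" for i
  proof (cases "a i = 0")
    case True
    then show ?thesis using b[OF that] A B by simp
  next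
    case False
    then have ai: "a i > 0" using a[OF that] by simp
    then have bi: "b i > 0" using ab[OF that] b[OF that] by force
    have "ln (b i * A / (a i * B)) \<le> b i * A / (a i * B) - 1"
      using ai bi A B by (intro ln_le_minus_one) simp
    then have "a i * (ln (b i * A / (a i * B)) / ln 2) \<le> a i * ((b i * A / (a i * B) - 1) / ln 2)"
      using ai by (intro mult_left_mono divide_right_mono) auto
    also have "a i * ((b i * A / (a i * B) - 1) / ln 2) = (b i * A / B - a i) / ln 2"
      using ai B by (simp add: field_simps)
    also have "ln (b i * A / (a i * B)) / ln 2 = log 2 (b i / a i) - log 2 (B / A)"
      using ai bi A B by (simp add: log_def ln_mult ln_div diff_divide_distrib add_divide_distrib)
    finally show ?thesis by (simp add: right_diff_distrib)
  qed
  then have "(\<Sum>i\<in>I. a i * log 2 (b i / a i)) \<le> (\<Sum>i\<in>I. a i * log 2 (B / A) + (b i * A / B - a i) / ln 2)"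
    by (rule sum_mono)
  also have "\<dots> = A * log 2 (B / A) + (B * A / B - A) / ln 2"
    by (simp add: sum.distrib sum_distrib_right[symmetric] sum_divide_distrib[symmetric] sum_subtractf A_def B_def)
  also have "\<dots> = A * log 2 (B / A)" using B by simp
  finally show ?thesis by (simp add: A_def B_def)
qed

lemma sum_eta_diff:
  assumes "finite M" "\<And>m. m \<in> M \<Longrightarrow> 0 \<le> a m"
  shows "(\<Sum>m\<in>M. eta (a m)) - eta (sum a M) = (\<Sum>m\<in>M. a m * log 2 (sum a M / a m))"
proof -
  have "eta (a m) + a m * log 2 (sum a M) = a m * log 2 (sum a M / a m)" if "m \<in> M" for m
  proof (cases "a m = 0")
    case False
    then have "0 < a m" using assms(2)[OF that] by simp
    moreover have "a m \<le> sum a M" using assms that by (intro member_le_sum) auto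
    ultimately show ?thesis by (simp add: eta_def log_divide algebra_simps)
  qed (simp add: eta_def)
  then have "(\<Sum>m\<in>M. a m * log 2 (sum a M / a m)) = (\<Sum>m\<in>M. eta (a m) + a m * log 2 (sum a M))"
    by simp
  also have "\<dots> = (\<Sum>m\<in>M. eta (a m)) - eta (sum a M)"
    unfolding sum.distrib sum_distrib_right[symmetric] by (simp add: eta_def)
  finally show ?thesis by simp
qed

text \<open>A crude constant: it enters only the additive term of Fano's inequality, which
  disappears after division by \<open>n\<close>.\<close>

lemma eta_le: "0 \<le> t \<Longrightarrow> eta t \<le> 2"
proof (cases "t = 0")
  case False
  assume "0 \<le> t"
  with False have t: "t > 0" by simp
  have "ln (1 / t) \<le> 1 / t - 1" using t by (intro ln_le_minus_one) simp
  then have "t * ln (1 / t) \<le> t * (1 / t - 1)" using t by (intro mult_left_mono) auto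
  also have "\<dots> \<le> 1" using t by (simp add: field_simps)
  finally have "- (t * ln t) \<le> 1" using t by (simp add: ln_div)
  moreover have "ln 2 \<ge> (1/2 :: real)" using ln_add1_ge[of "1::real"] ln2_ge_two_thirds by simp
  ultimately have "- (t * ln t) \<le> 2 * ln 2" by linarith
  then show ?thesis by (simp add: eta_def log_def field_simps)
qed simp

section \<open>Conditional entropy of the message given the view\<close>

definition view_mass :: "nat \<Rightarrow> (bool list \<Rightarrow> real) \<Rightarrow> nat set \<Rightarrow> bool option list \<Rightarrow> real" where
  "view_mass n w S v = (\<Sum>x\<in>{x \<in> words n. view S x = v}. w x)"

lemma view_mass_sum: "(\<Sum>m\<in>M. view_mass n (w m) S v) = view_mass n (\<lambda>x. \<Sum>m\<in>M. w m x) S v"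
  unfolding view_mass_def by (rule sum.swap)

lemma sum_view_mass: "(\<Sum>v\<in>view S ` words n. view_mass n w S v) = sum w (words n)"
  unfolding view_mass_def by (rule sum.image_gen[symmetric]) simp

text \<open>Joint entropy of message and view minus entropy of the view, so the conditional entropy
  of the index \<open>m\<close> given the view of \<open>S\<close>.\<close>

lemma HV_diff:
  assumes "finite M" "\<And>m x. m \<in> M \<Longrightarrow> 0 \<le> w m x"
  shows "(\<Sum>m\<in>M. HV n (w m) S) - HV n (\<lambda>x. \<Sum>m\<in>M. w m x) S =
    (\<Sum>m\<in>M. \<Sum>v\<in>view S ` words n. view_mass n (w m) S v *
       log 2 (view_mass n (\<lambda>x. \<Sum>m\<in>M. w m x) S v / view_mass n (w m) S v))"
proof -
  have "(\<Sum>m\<in>M. HV n (w m) S) - HV n (\<lambda>x. \<Sum>m\<in>M. w m x) S =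
    (\<Sum>v\<in>view S ` words n. (\<Sum>m\<in>M. eta (view_mass n (w m) S v)) - eta (\<Sum>m\<in>M. view_mass n (w m) S v))"
    unfolding view_mass_sum unfolding HV_def view_mass_def[symmetric] sum_subtractf
    by (subst sum.swap) simp
  also have "\<dots> = (\<Sum>v\<in>view S ` words n. \<Sum>m\<in>M. view_mass n (w m) S v *
       log 2 (view_mass n (\<lambda>x. \<Sum>m\<in>M. w m x) S v / view_mass n (w m) S v))"
    unfolding view_mass_sum[symmetric] using assms
    by (intro sum.cong refl sum_eta_diff) (auto simp: view_mass_def intro: sum_nonneg)
  finally show ?thesis by (simp add: sum.swap[of _ M])
qed

lemma view_subset_factor:
  assumes "S' \<subseteq> S"
  shows "view S' x = map (\<lambda>i. if i \<in> S' then view S x ! i else None) [0..<length (view S x)]"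
  using assms by (auto simp: view_def)

text \<open>Data processing: the view of the smaller set is a function of the view of the larger
  one, and the log-sum inequality applies on each fibre. It is needed because the equivocation is a
  minimum over sets of one exact size, while random patterns may read fewer positions.\<close>

lemma HV_diff_antimono:
  assumes M: "finite M" and w: "\<And>m x. m \<in> M \<Longrightarrow> 0 \<le> w m x" and S: "S' \<subseteq> S"
  shows "(\<Sum>m\<in>M. HV n (w m) S) - HV n (\<lambda>x. \<Sum>m\<in>M. w m x) S
    \<le> (\<Sum>m\<in>M. HV n (w m) S') - HV n (\<lambda>x. \<Sum>m\<in>M. w m x) S'"
proof -
  define \<phi> where "\<phi> v = map (\<lambda>i. if i \<in> S' then v ! i else None) [0..<length v]" for v :: "bool option list"
  have \<phi>: "view S' x = \<phi> (view S x)" for x unfolding \<phi>_def using view_subset_factor[OF S] .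
  let ?V = "view S ` words n"
  have im: "\<phi> ` ?V = view S' ` words n" by (simp add: image_image \<phi>)
  have coarse: "view_mass n u S' v' = (\<Sum>v\<in>{v \<in> ?V. \<phi> v = v'}. view_mass n u S v)" for u v'
  proof -
    have "(\<Sum>v\<in>{v \<in> ?V. \<phi> v = v'}. view_mass n u S v) =
       (\<Sum>v\<in>view S ` {x \<in> words n. view S' x = v'}. \<Sum>x\<in>{x \<in> {x \<in> words n. view S' x = v'}. view S x = v}. u x)"
      unfolding view_mass_def by (intro sum.cong) (auto simp: \<phi>)
    also have "\<dots> = (\<Sum>x\<in>{x \<in> words n. view S' x = v'}. u x)"
      by (rule sum.image_gen[symmetric]) simp
    finally show ?thesis by (simp add: view_mass_def)
  qed
  have nn: "0 \<le> view_mass n (w m) S v" if "m \<in> M" for m v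
    unfolding view_mass_def using w that by (intro sum_nonneg) auto
  let ?W = "\<lambda>x. \<Sum>m\<in>M. w m x"
  have nW: "0 \<le> view_mass n ?W S v" for v
    unfolding view_mass_sum[symmetric] using nn by (intro sum_nonneg) auto
  have zero: "view_mass n (w m) S v = 0" if "m \<in> M" "view_mass n ?W S v = 0" for m v
    using that nn M unfolding view_mass_sum[symmetric] by (simp add: sum_nonneg_eq_0_iff)
  have "(\<Sum>v\<in>?V. view_mass n (w m) S v * log 2 (view_mass n ?W S v / view_mass n (w m) S v)) \<le>
    (\<Sum>v'\<in>view S' ` words n. view_mass n (w m) S' v' * log 2 (view_mass n ?W S' v' / view_mass n (w m) S' v'))"
    if m: "m \<in> M" for m
  proof -
    have "(\<Sum>v\<in>?V. view_mass n (w m) S v * log 2 (view_mass n ?W S v / view_mass n (w m) S v)) =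
      (\<Sum>v'\<in>view S' ` words n. \<Sum>v\<in>{v \<in> ?V. \<phi> v = v'}. view_mass n (w m) S v * log 2 (view_mass n ?W S v / view_mass n (w m) S v))"
      unfolding im[symmetric] by (rule sum.image_gen) simp
    also have "\<dots> \<le> (\<Sum>v'\<in>view S' ` words n. view_mass n (w m) S' v' * log 2 (view_mass n ?W S' v' / view_mass n (w m) S' v'))"
      unfolding coarse by (intro sum_mono log_sum_inequality) (auto simp: nn m nW intro: zero)
    finally show ?thesis .
  qed
  then have "(\<Sum>m\<in>M. \<Sum>v\<in>?V. view_mass n (w m) S v * log 2 (view_mass n ?W S v / view_mass n (w m) S v)) \<le>
    (\<Sum>m\<in>M. \<Sum>v'\<in>view S' ` words n. view_mass n (w m) S' v' * log 2 (view_mass n ?W S' v' / view_mass n (w m) S' v'))"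
    by (rule sum_mono)
  moreover have "(\<Sum>m\<in>M. HV n (w m) T) - HV n ?W T =
    (\<Sum>m\<in>M. \<Sum>v\<in>view T ` words n. view_mass n (w m) T v * log 2 (view_mass n ?W T v / view_mass n (w m) T v))" for T
    by (rule HV_diff[OF M]) (rule w)
  ultimately show ?thesis by simp
qed

lemma HV_diff_nonneg:
  assumes M: "finite M" and w: "\<And>m x. m \<in> M \<Longrightarrow> 0 \<le> w m x"
  shows "0 \<le> (\<Sum>m\<in>M. HV n (w m) S) - HV n (\<lambda>x. \<Sum>m\<in>M. w m x) S"
proof (subst HV_diff[OF M], rule w, assumption, intro sum_nonneg)
  fix m v assume m: "m \<in> M"
  have nn: "0 \<le> view_mass n (w m) S v" if "m \<in> M" for m
    unfolding view_mass_def using w that by (intro sum_nonneg) auto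
  have "view_mass n (w m) S v \<le> view_mass n (\<lambda>x. \<Sum>m\<in>M. w m x) S v"
    unfolding view_mass_sum[symmetric] using M m nn by (intro member_le_sum) auto
  then show "0 \<le> view_mass n (w m) S v * log 2 (view_mass n (\<lambda>x. \<Sum>m\<in>M. w m x) S v / view_mass n (w m) S v)"
    using nn[OF m] by (cases "view_mass n (w m) S v = 0") (auto intro!: mult_nonneg_nonneg)
qed

text \<open>One application of the log-sum inequality to all pairs of message and view, with total
  masses \<open>1\<close> and \<open>K\<close>.\<close>

lemma HV_diff_le:
  assumes w: "\<And>m x. m < K \<Longrightarrow> 0 \<le> w m x" and tot: "(\<Sum>m<K. \<Sum>x\<in>words n. w m x) = 1"
  shows "(\<Sum>m<K. HV n (w m) S) - HV n (\<lambda>x. \<Sum>m<K. w m x) S \<le> log 2 (real K)"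
proof -
  let ?W = "\<lambda>x. \<Sum>m<K. w m x" and ?V = "view S ` words n"
  have nn: "0 \<le> view_mass n (w m) S v" if "m < K" for m v
    unfolding view_mass_def using w that by (intro sum_nonneg) auto
  have nW: "0 \<le> view_mass n ?W S v" for v
    unfolding view_mass_sum[symmetric] using nn by (intro sum_nonneg) auto
  have zero: "view_mass n (w m) S v = 0" if "m < K" "view_mass n ?W S v = 0" for m v
    using sum_nonneg_eq_0_iff[of "{..<K}" "\<lambda>m. view_mass n (w m) S v"] that nn
    unfolding view_mass_sum[symmetric] by blast
  have "(\<Sum>m<K. HV n (w m) S) - HV n ?W S =
    (\<Sum>p\<in>{..<K} \<times> ?V. view_mass n (w (fst p)) S (snd p) * log 2 (view_mass n ?W S (snd p) / view_mass n (w (fst p)) S (snd p)))"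
    using w by (subst HV_diff) (auto simp: sum.cartesian_product case_prod_beta)
  also have "\<dots> \<le> (\<Sum>p\<in>{..<K} \<times> ?V. view_mass n (w (fst p)) S (snd p)) *
     log 2 ((\<Sum>p\<in>{..<K} \<times> ?V. view_mass n ?W S (snd p)) / (\<Sum>p\<in>{..<K} \<times> ?V. view_mass n (w (fst p)) S (snd p)))"
    by (intro log_sum_inequality) (auto simp: nn nW zero)
  also have "(\<Sum>p\<in>{..<K} \<times> ?V. view_mass n (w (fst p)) S (snd p)) = 1"
    using tot by (simp add: sum.cartesian_product' sum_view_mass)
  also have "(\<Sum>p\<in>{..<K} \<times> ?V. view_mass n ?W S (snd p)) = real K"
    using tot by (simp add: sum.cartesian_product' sum_view_mass) (subst (asm) sum.swap, simp)
  finally show ?thesis by simp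
qed

lemma cond_entropy_eq:
  assumes "\<And>m x. m < K \<Longrightarrow> 0 \<le> enc m x"
  shows "cond_entropy n K enc S =
    (\<Sum>m<K. HV n (\<lambda>x. enc m x / real K) S) - HV n (\<lambda>x. \<Sum>m<K. enc m x / real K) S"
proof -
  have j: "joint (unif K) n enc S m v = view_mass n (\<lambda>x. enc m x / real K) S v" if "m < K" for m v
    using that by (simp add: joint_def unif_def view_mass_def sum_divide_distrib)
  have p: "pview (unif K) n K enc S v = view_mass n (\<lambda>x. \<Sum>m<K. enc m x / real K) S v" for v
    unfolding pview_def view_mass_sum[symmetric] by (intro sum.cong refl j) simp
  have lg: "- (a * log 2 (a / b)) = a * log 2 (b / a)" for a b :: real
    by (auto simp: log_divide algebra_simps)
  show ?thesis
    unfolding cond_entropy_def sum_negf[symmetric] lg p using assms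
    by (subst HV_diff) (auto simp: j)
qed

section \<open>Decoding after i.i.d. noise and Fano's inequality\<close>

lemma xorw_cancel: "length x = length y \<Longrightarrow> xorw x (xorw x y) = y"
  by (induction x y rule: list_induct2) auto

lemma length_xorw [simp]: "length (xorw x y) = min (length x) (length y)"
  by (simp add: xorw_def)

lemma sum_words_xorw:
  assumes "x \<in> words n"
  shows "(\<Sum>y\<in>words n. g (xorw x y)) = (\<Sum>e\<in>words n. g e)"
  using assms
  by (intro sum.reindex_bij_witness[where i = "xorw x" and j = "xorw x"]) (auto simp: words_def xorw_cancel)

definition bsc_error :: "real \<Rightarrow> nat \<Rightarrow> nat \<Rightarrow> (nat \<Rightarrow> bool list \<Rightarrow> real) \<Rightarrow> (bool list \<Rightarrow> nat) \<Rightarrow> real" where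
  "bsc_error \<rho> n K w dec =
     (\<Sum>m<K. \<Sum>x\<in>words n. w m x * (\<Sum>e\<in>words n. noise \<rho> e * (if dec (xorw x e) \<noteq> m then 1 else 0)))"

lemma bsc_error_eq:
  "bsc_error \<rho> n K w dec =
     (\<Sum>m<K. \<Sum>y\<in>{y \<in> words n. dec y \<noteq> m}. \<Sum>x\<in>words n. noise \<rho> (xorw x y) * w m x)"
proof -
  have "w m x * (\<Sum>e\<in>words n. noise \<rho> e * (if dec (xorw x e) \<noteq> m then 1 else 0)) =
     (\<Sum>y\<in>{y \<in> words n. dec y \<noteq> m}. noise \<rho> (xorw x y) * w m x)" if "x \<in> words n" for m x
  proof -
    have "(\<Sum>e\<in>words n. noise \<rho> e * (if dec (xorw x e) \<noteq> m then 1 else 0)) =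
      (\<Sum>y\<in>words n. noise \<rho> (xorw x y) * (if dec (xorw x (xorw x y)) \<noteq> m then 1 else 0))"
      by (rule sum_words_xorw[OF that, symmetric])
    also have "\<dots> = (\<Sum>y\<in>words n. noise \<rho> (xorw x y) * (if dec y \<noteq> m then 1 else 0))"
      using that by (intro sum.cong refl) (simp add: xorw_cancel words_def)
    also have "\<dots> = (\<Sum>y\<in>{y \<in> words n. dec y \<noteq> m}. noise \<rho> (xorw x y))"
      by (simp add: sum.inter_filter) (intro sum.cong refl, simp)
    finally show ?thesis by (simp add: sum_distrib_left mult.commute)
  qed
  then have "bsc_error \<rho> n K w dec = (\<Sum>m<K. \<Sum>x\<in>words n. \<Sum>y\<in>{y \<in> words n. dec y \<noteq> m}. noise \<rho> (xorw x y) * w m x)"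
    unfolding bsc_error_def by (intro sum.cong refl) simp
  then show ?thesis by (simp add: sum.swap[of _ "words n" "{y \<in> words n. dec y \<noteq> _}"])
qed

text \<open>The pairs of message and output are split into correctly and wrongly decoded ones, and
  the log-sum inequality is applied to each class. The second part replaces the missing bound on
  \<open>K\<close>.\<close>

lemma fano:
  assumes \<rho>: "0 \<le> \<rho>" "\<rho> \<le> 1" and w: "\<And>m x. m < K \<Longrightarrow> 0 \<le> w m x"
    and tot: "\<And>m. m < K \<Longrightarrow> (\<Sum>x\<in>words n. w m x) = 1 / real K" and K: "0 < K"
    and dec: "\<And>y. y \<in> words n \<Longrightarrow> dec y < K"
  shows "(\<Sum>m<K. HY \<rho> n (w m)) - HY \<rho> n (\<lambda>x. \<Sum>m<K. w m x) \<le> 4 + bsc_error \<rho> n K w dec * log 2 (real K)"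
    and "(1 - bsc_error \<rho> n K w dec) * real K \<le> 2 ^ n"
proof -
  define q where "q m y = (\<Sum>x\<in>words n. noise \<rho> (xorw x y) * w m x)" for m y
  define Q where "Q y = (\<Sum>m<K. q m y)" for y
  have qn: "0 \<le> q m y" if "m < K" for m y
    unfolding q_def using w that \<rho> by (intro sum_nonneg mult_nonneg_nonneg noise_nonneg) auto
  have Qn: "0 \<le> Q y" for y unfolding Q_def using qn by (intro sum_nonneg) auto
  have Qz: "q m y = 0" if "m < K" "Q y = 0" for m y
    using sum_nonneg_eq_0_iff[of "{..<K}" "\<lambda>m. q m y"] that qn unfolding Q_def by blast
  have qy: "(\<Sum>y\<in>words n. q m y) = 1 / real K" if "m < K" for m
  proof -
    have "(\<Sum>y\<in>words n. q m y) = (\<Sum>x\<in>words n. (\<Sum>y\<in>words n. noise \<rho> (xorw x y)) * w m x)"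
      unfolding q_def sum_distrib_right by (rule sum.swap)
    also have "\<dots> = (\<Sum>x\<in>words n. w m x)"
      by (intro sum.cong refl) (simp add: sum_words_xorw[where g = "noise \<rho>"] sum_noise)
    finally show ?thesis using tot[OF that] by simp
  qed
  have Qy: "(\<Sum>y\<in>words n. Q y) = 1"
    unfolding Q_def by (subst sum.swap) (use K qy in simp)
  have err: "bsc_error \<rho> n K w dec = (\<Sum>m<K. \<Sum>y\<in>{y \<in> words n. dec y \<noteq> m}. q m y)"
    by (simp add: bsc_error_eq q_def)
  let ?P = "{..<K} \<times> words n"
  define C where "C = {p \<in> ?P. dec (snd p) = fst p}"
  define D where "D = {p \<in> ?P. dec (snd p) \<noteq> fst p}"
  have CD: "?P = C \<union> D" "C \<inter> D = {}" "finite C" "finite D" by (auto simp: C_def D_def)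
  define c where "c = (\<Sum>p\<in>C. q (fst p) (snd p))"
  define e where "e = (\<Sum>p\<in>D. q (fst p) (snd p))"
  have D: "D = (SIGMA m:{..<K}. {y \<in> words n. dec y \<noteq> m})" by (auto simp: D_def)
  have e: "e = bsc_error \<rho> n K w dec"
    unfolding e_def err D by (subst sum.Sigma) (auto simp: case_prod_beta)
  have Cim: "C = (\<lambda>y. (dec y, y)) ` words n" using dec by (auto simp: C_def)
  have cs: "(\<Sum>p\<in>C. g (fst p) (snd p)) = (\<Sum>y\<in>words n. g (dec y) y)" for g :: "nat \<Rightarrow> bool list \<Rightarrow> real"
    unfolding Cim by (subst sum.reindex) (auto simp: inj_on_def)
  have ce: "c + e = 1"
  proof -
    have "c + e = (\<Sum>p\<in>?P. q (fst p) (snd p))"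
      unfolding c_def e_def CD(1) using CD(2-4) by (simp add: sum.union_disjoint)
    also have "\<dots> = 1" using qy K by (simp add: sum.cartesian_product')
    finally show ?thesis .
  qed
  have c0: "0 \<le> c" unfolding c_def C_def using qn by (intro sum_nonneg) auto
  have e0: "0 \<le> e" unfolding e_def D_def using qn by (intro sum_nonneg) auto
  have "(\<Sum>m<K. HY \<rho> n (w m)) - HY \<rho> n (\<lambda>x. \<Sum>m<K. w m x) =
    (\<Sum>y\<in>words n. (\<Sum>m<K. eta (q m y)) - eta (\<Sum>m<K. q m y))"
  proof -
    have "(\<Sum>m<K. q m y) = (\<Sum>x\<in>words n. noise \<rho> (xorw x y) * (\<Sum>m<K. w m x))" for y
      unfolding q_def sum_distrib_left by (rule sum.swap)
    then show ?thesis unfolding HY_eq q_def sum_subtractf by (subst sum.swap) simp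
  qed
  also have "\<dots> = (\<Sum>y\<in>words n. \<Sum>m<K. q m y * log 2 (Q y / q m y))"
    unfolding Q_def using qn by (intro sum.cong refl sum_eta_diff) auto
  also have "\<dots> = (\<Sum>p\<in>?P. q (fst p) (snd p) * log 2 (Q (snd p) / q (fst p) (snd p)))"
    by (subst sum.swap) (simp add: sum.cartesian_product')
  also have "\<dots> = (\<Sum>p\<in>C. q (fst p) (snd p) * log 2 (Q (snd p) / q (fst p) (snd p)))
     + (\<Sum>p\<in>D. q (fst p) (snd p) * log 2 (Q (snd p) / q (fst p) (snd p)))"
    unfolding CD(1) by (rule sum.union_disjoint[OF CD(3,4,2)])
  \<comment> \<open>The weights \<open>Q\<close> sum to \<open>1\<close> over \<open>C\<close>,
    where each output occurs once, and to at most \<open>K\<close> over \<open>D\<close>. The two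
    pieces therefore give \<open>eta c\<close> and at most
    \<open>eta e + e * log 2 K\<close>.\<close>
  also have "\<dots> \<le> c * log 2 ((\<Sum>p\<in>C. Q (snd p)) / c) + e * log 2 ((\<Sum>p\<in>D. Q (snd p)) / e)"
    unfolding c_def e_def
    by (intro add_mono log_sum_inequality CD(3,4)) (auto simp: C_def D_def intro: qn Qn Qz)
  also have "(\<Sum>p\<in>C. Q (snd p)) = 1" using cs[of "\<lambda>_. Q"] Qy by simp
  also have "c * log 2 (1 / c) = eta c" by (simp add: eta_def log_divide)
  also have "eta c \<le> 2" using c0 by (rule eta_le)
  also have "e * log 2 ((\<Sum>p\<in>D. Q (snd p)) / e) \<le> 2 + e * log 2 (real K)"
  proof (cases "e = 0")
    case False
    then have ep: "e > 0" using e0 by simp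
    have "e \<le> (\<Sum>p\<in>D. Q (snd p))" unfolding e_def
      by (intro sum_mono) (auto simp: D_def Q_def qn intro: member_le_sum)
    moreover have "(\<Sum>p\<in>D. Q (snd p)) \<le> (\<Sum>p\<in>?P. Q (snd p))"
      by (intro sum_mono2) (auto simp: D_def Qn)
    moreover have "(\<Sum>p\<in>?P. Q (snd p)) = real K" by (simp add: sum.cartesian_product' Qy)
    ultimately have "log 2 ((\<Sum>p\<in>D. Q (snd p)) / e) \<le> log 2 (real K / e)"
      using ep by (subst log_le_cancel_iff) (auto simp: divide_right_mono K)
    then have "e * log 2 ((\<Sum>p\<in>D. Q (snd p)) / e) \<le> e * log 2 (real K / e)"
      using ep by (intro mult_left_mono) auto
    also have "\<dots> = eta e + e * log 2 (real K)" using ep K by (simp add: log_divide eta_def algebra_simps)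
    finally show ?thesis using eta_le[OF e0] by simp
  qed simp
  finally show "(\<Sum>m<K. HY \<rho> n (w m)) - HY \<rho> n (\<lambda>x. \<Sum>m<K. w m x) \<le> 4 + bsc_error \<rho> n K w dec * log 2 (real K)"
    by (simp add: e)
  \<comment> \<open>Each output is decoded correctly for a single message, which contributes at most
    its whole mass \<open>1 / K\<close>.\<close>
  have "c = (\<Sum>y\<in>words n. q (dec y) y)" unfolding c_def by (rule cs)
  also have "\<dots> \<le> (\<Sum>y\<in>words n. 1 / real K)"
  proof (intro sum_mono)
    fix y assume y: "y \<in> words n"
    have "q (dec y) y \<le> (\<Sum>y'\<in>words n. q (dec y) y')"
      using y dec qn by (intro member_le_sum) auto
    then show "q (dec y) y \<le> 1 / real K" using qy[OF dec[OF y]] by simp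
  qed
  also have "\<dots> = real (card (words n)) / real K" by simp
  also have "card (words n) = 2 ^ n"
    using card_lists_length_eq[of "UNIV :: bool set" n] by (simp add: words_def card_UNIV_bool)
  finally have "c * real K \<le> 2 ^ n" using K by (simp add: pos_le_divide_eq)
  moreover have "1 - bsc_error \<rho> n K w dec = c" using ce e by simp
  ultimately show "(1 - bsc_error \<rho> n K w dec) * real K \<le> 2 ^ n" by (simp only:)
qed

section \<open>The view-independent attack as an admissible adversary\<close>

definition truncated_noise :: "real \<Rightarrow> real \<Rightarrow> nat \<Rightarrow> bool list \<Rightarrow> real" where
  "truncated_noise \<rho> \<tau> n e = (if e \<in> words n \<and> real (weight e) \<le> \<tau> * real n
     then noise \<rho> e + (if e = replicate n False
       then (\<Sum>e\<in>{e \<in> words n. \<tau> * real n < real (weight e)}. noise \<rho> e) else 0)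
     else 0)"

lemma weight_replicate_False [simp]: "weight (replicate n False) = 0"
  by (simp add: weight_def)

text \<open>The mass of the error vectors that are too heavy is moved to the zero vector, which
  restores total mass 1 within the weight bound.\<close>

lemma truncated_noise_dist:
  assumes "0 \<le> \<rho>" "\<rho> \<le> 1" "0 \<le> \<tau>"
  shows "is_dist {e \<in> words n. real (weight e) \<le> \<tau> * real n} (truncated_noise \<rho> \<tau> n)"
proof -
  let ?G = "{e \<in> words n. real (weight e) \<le> \<tau> * real n}"
  let ?B = "{e \<in> words n. \<tau> * real n < real (weight e)}"
  have z: "replicate n False \<in> ?G" using assms by (simp add: words_def)
  have "sum (truncated_noise \<rho> \<tau> n) ?G = (\<Sum>e\<in>?G. noise \<rho> e + (if e = replicate n False then sum (noise \<rho>) ?B else 0))"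
    by (intro sum.cong refl) (simp add: truncated_noise_def)
  also have "\<dots> = sum (noise \<rho>) ?G + sum (noise \<rho>) ?B"
    using z by (simp add: sum.distrib)
  also have "\<dots> = sum (noise \<rho>) (?G \<union> ?B)"
    by (rule sum.union_disjoint[symmetric]) auto
  also have "?G \<union> ?B = words n" by auto
  finally have "sum (truncated_noise \<rho> \<tau> n) ?G = 1" by (simp add: sum_noise)
  then show ?thesis
    using assms by (auto simp: is_dist_def truncated_noise_def intro!: add_nonneg_nonneg sum_nonneg noise_nonneg)
qed

text \<open>The errors of this attack ignore the view, so any admissible reading set serves; the
  initial positions are taken. Secrecy is tested separately, over random patterns.\<close>

definition fixed_positions :: "nat \<Rightarrow> nat set \<Rightarrow> real" where
  "fixed_positions k S = (if S = {..<k} then 1 else 0)"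

lemma finite_rsets [simp]: "finite (rsets n k)"
  by (rule finite_subset[of _ "Pow {..<n}"]) (auto simp: rsets_def)

lemma nread_le: "0 \<le> r \<Longrightarrow> r \<le> 1 \<Longrightarrow> nread r n \<le> n"
  using mult_left_le_one_le[of "real n" r] unfolding nread_def by linarith

lemma initial_in_rsets: "k \<le> n \<Longrightarrow> {..<k} \<in> rsets n k"
  by (auto simp: rsets_def)

lemma oblivious_adversary_valid:
  assumes "0 \<le> r" "r \<le> 1" "0 \<le> \<rho>" "\<rho> \<le> 1" "0 \<le> \<tau>"
  shows "valid_adv r \<tau> n (fixed_positions (nread r n)) (\<lambda>_. truncated_noise \<rho> \<tau> n)"
  using truncated_noise_dist[OF assms(3-5), of n] initial_in_rsets[OF nread_le[OF assms(1,2)], of n]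
  by (auto simp: valid_adv_def is_dist_def fixed_positions_def)

text \<open>Pointwise the noise is at most the truncated noise plus the noise on the heavy vectors,
  and as the errors ignore the view, the sum over reading sets collapses to one term.\<close>

lemma bsc_error_le:
  assumes K: "0 < K" and enc: "\<And>m. m < K \<Longrightarrow> is_dist (words n) (enc m)"
    and r: "0 \<le> r" "r \<le> 1" and \<rho>: "0 \<le> \<rho>" "\<rho> \<le> 1"
  shows "bsc_error \<rho> n K (\<lambda>m x. enc m x / real K) dec
    \<le> err_prob r n K enc dec (fixed_positions (nread r n)) (\<lambda>_. truncated_noise \<rho> \<tau> n)
      + (\<Sum>e\<in>{e \<in> words n. \<tau> * real n < real (weight e)}. noise \<rho> e)"
proof -
  let ?B = "{e \<in> words n. \<tau> * real n < real (weight e)}"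
  let ?i = "\<lambda>m x e. if dec (xorw x e) \<noteq> m then 1 else 0 :: real"
  have pt: "(\<Sum>e\<in>words n. noise \<rho> e * ?i m x e) \<le> (\<Sum>e\<in>words n. truncated_noise \<rho> \<tau> n e * ?i m x e) + sum (noise \<rho>) ?B" for m x
  proof -
    have "(\<Sum>e\<in>words n. noise \<rho> e * ?i m x e) \<le> (\<Sum>e\<in>words n. truncated_noise \<rho> \<tau> n e * ?i m x e + (if \<tau> * real n < real (weight e) then noise \<rho> e else 0))"
      using \<rho> by (intro sum_mono) (auto simp: truncated_noise_def noise_nonneg intro!: sum_nonneg)
    also have "\<dots> = (\<Sum>e\<in>words n. truncated_noise \<rho> \<tau> n e * ?i m x e) + sum (noise \<rho>) ?B"
      by (simp add: sum.distrib sum.inter_filter)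
    finally show ?thesis .
  qed
  have "bsc_error \<rho> n K (\<lambda>m x. enc m x / real K) dec \<le>
    (\<Sum>m<K. \<Sum>x\<in>words n. enc m x / real K * ((\<Sum>e\<in>words n. truncated_noise \<rho> \<tau> n e * ?i m x e) + sum (noise \<rho>) ?B))"
    unfolding bsc_error_def using enc
    by (intro sum_mono mult_left_mono pt) (auto simp: is_dist_def)
  also have "\<dots> = (\<Sum>m<K. \<Sum>x\<in>words n. enc m x / real K * (\<Sum>e\<in>words n. truncated_noise \<rho> \<tau> n e * ?i m x e))
     + (\<Sum>m<K. \<Sum>x\<in>words n. enc m x / real K) * sum (noise \<rho>) ?B"
    by (simp only: distrib_left sum.distrib sum_distrib_right)
  also have "(\<Sum>m<K. \<Sum>x\<in>words n. enc m x / real K) = 1"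
    using enc K by (simp add: is_dist_def sum_divide_distrib[symmetric])
  also have "(\<Sum>m<K. \<Sum>x\<in>words n. enc m x / real K * (\<Sum>e\<in>words n. truncated_noise \<rho> \<tau> n e * ?i m x e)) =
    err_prob r n K enc dec (fixed_positions (nread r n)) (\<lambda>_. truncated_noise \<rho> \<tau> n)"
    unfolding err_prob_def
  proof (intro sum.cong refl)
    fix m
    let ?g = "\<lambda>S. \<Sum>x\<in>words n. \<Sum>e\<in>words n. (1 / real K) * fixed_positions (nread r n) S * enc m x * truncated_noise \<rho> \<tau> n e * ?i m x e"
    have "(\<Sum>S\<in>rsets n (nread r n). ?g S) = (\<Sum>S\<in>rsets n (nread r n). if S = {..<nread r n} then ?g {..<nread r n} else 0)"
      by (intro sum.cong refl) (simp add: fixed_positions_def)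
    also have "\<dots> = ?g {..<nread r n}"
      using initial_in_rsets[OF nread_le[OF r], of n] by simp
    finally show "(\<Sum>x\<in>words n. enc m x / real K * (\<Sum>e\<in>words n. truncated_noise \<rho> \<tau> n e * ?i m x e)) = (\<Sum>S\<in>rsets n (nread r n). ?g S)"
      by (simp add: fixed_positions_def sum_distrib_left mult.assoc)
  qed
  finally show ?thesis by simp
qed

lemma gap_half: "gap r \<rho> (1/2) = 1 - r"
proof -
  have "\<rho> + (1 - 2 * \<rho>) * (1/2) = 1/2" by (simp add: field_simps)
  then show ?thesis unfolding gap_def by (simp only: bin_entropy_half)
qed

text \<open>The equivocation is at most the conditional entropy for every set of at most
  \<open>nread r n\<close> positions, so it may be averaged over i.i.d. patterns of density
  \<open>r'\<close>. The average is \<open>H(M|V)\<close>, which exceeds \<open>H(M|Y)\<close> by at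
  most the single-letter gap per position.\<close>

lemma equivocation_le:
  fixes \<rho>' \<rho> r' r m :: real
  assumes code: "valid_code n K enc dec" and n: "0 < n"
    and r: "0 < r'" "r' < r" "r < 1" and \<rho>: "0 < \<rho>'" "\<rho>' < \<rho>" "\<rho> < 1/2"
    and m: "\<And>q. 0 \<le> q \<Longrightarrow> q \<le> 1 \<Longrightarrow> m \<le> gap r' \<rho>' q"
  defines "e \<equiv> err_prob r n K enc dec (fixed_positions (nread r n)) (\<lambda>_. truncated_noise \<rho>' \<rho> n)
     + 1 / (real n * (\<rho> - \<rho>')\<^sup>2)"
  shows "equivocation r n K enc \<le> real n * (1 - r' - m) + 4 + (e + 1 / (real n * (r - r')\<^sup>2)) * log 2 (real K)"
    and "(1 - e) * real K \<le> 2 ^ n"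
proof -
  interpret g: gap_params r' \<rho>' using r \<rho> by unfold_locales auto
  have K: "0 < K" and enc: "\<And>m. m < K \<Longrightarrow> is_dist (words n) (enc m)"
    and dec: "\<And>y. y \<in> words n \<Longrightarrow> dec y < K"
    using code by (auto simp: valid_code_def)
  have enc0: "0 \<le> enc m x" if "m < K" for m x using enc[OF that] by (simp add: is_dist_def)
  define w where "w = (\<lambda>m x. enc m x / real K)"
  have w0: "0 \<le> w m x" if "m < K" for m x using enc0[OF that] by (simp add: w_def)
  have wt: "(\<Sum>x\<in>words n. w m x) = 1 / real K" if "m < K" for m
    using enc[OF that] by (simp add: w_def is_dist_def sum_divide_distrib[symmetric])
  have tot: "(\<Sum>m<K. \<Sum>x\<in>words n. w m x) = 1" using wt K by simp
  let ?W = "\<lambda>x. \<Sum>m<K. w m x"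
  define H where "H S = (\<Sum>m<K. HV n (w m) S) - HV n ?W S" for S
  have ce: "cond_entropy n K enc S = H S" for S
    unfolding H_def w_def by (rule cond_entropy_eq) (rule enc0)
  define b where "b = bsc_error \<rho>' n K w dec"
  have b: "b \<le> e"
  proof -
    have "b \<le> err_prob r n K enc dec (fixed_positions (nread r n)) (\<lambda>_. truncated_noise \<rho>' \<rho> n)
      + (\<Sum>e\<in>{e \<in> words n. \<rho> * real n < real (weight e)}. noise \<rho>' e)"
      unfolding b_def w_def using enc r \<rho> by (intro bsc_error_le K) auto
    then show ?thesis using noise_tail[of \<rho>' \<rho> n] \<rho> n unfolding e_def by linarith
  qed
  have f: "(\<Sum>m<K. HY \<rho>' n (w m)) - HY \<rho>' n ?W \<le> 4 + b * log 2 (real K)"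
    unfolding b_def using \<rho> by (intro fano) (auto simp: w0 wt K dec)
  have lK: "0 \<le> log 2 (real K)" using K by simp
  \<comment> \<open>The sums over \<open>m\<close> are the joint entropies of message and output, so
    the left-hand side is \<open>H(M|V) - H(M|Y)\<close>.\<close>
  have g: "(HY \<rho>' n ?W - HZ r' n ?W) - (\<Sum>m<K. HY \<rho>' n (w m) - HZ r' n (w m)) \<le> real n * (1 - r' - m)"
    using g.entropy_gap_le[OF m, of "{..<K}" w n] w0 by (simp add: tot gap_half)
  define E where "E = equivocation r n K enc"
  have kn: "nread r n \<le> n" using nread_le r by simp
  have EH: "E \<le> H S" if "S \<subseteq> {..<n}" "card S \<le> nread r n" for S
  proof -
    have "\<exists>T. S \<subseteq> T \<and> T \<subseteq> {..<n} \<and> card T = nread r n"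
      using that kn by (intro exists_subset_between) auto
    then obtain T where T: "S \<subseteq> T" "T \<subseteq> {..<n}" "card T = nread r n" by blast
    have "E \<le> H T"
      unfolding E_def equivocation_def ce using T by (intro Min_le) (auto simp: rsets_def)
    also have "\<dots> \<le> H S"
      unfolding H_def using T w0 by (intro HV_diff_antimono) auto
    finally show ?thesis .
  qed
  have El: "E \<le> log 2 (real K)"
  proof -
    have "E \<le> H {}" by (rule EH) auto
    also have "\<dots> \<le> log 2 (real K)" unfolding H_def by (rule HV_diff_le) (auto simp: w0 tot)
    finally show ?thesis .
  qed
  have H0: "0 \<le> H S" for S unfolding H_def using w0 by (intro HV_diff_nonneg) auto
  let ?B = "{s \<in> words n. r * real n < real (weight s)}"
  \<comment> \<open>Patterns reading too many positions are left out of the average; the missing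
    share of \<open>E\<close> is paid for by \<open>E \<le> log 2 K\<close> times a Chebyshev
    tail.\<close>
  have "E * (1 - sum (noise r') ?B) = E * sum (noise r') (words n - ?B)"
    by (subst sum_diff) (auto simp: sum_noise)
  also have "\<dots> = (\<Sum>s\<in>words n - ?B. noise r' s * E)" by (simp add: sum_distrib_left mult.commute)
  also have "\<dots> \<le> (\<Sum>s\<in>words n - ?B. noise r' s * H (positions s))"
  proof (intro sum_mono mult_left_mono EH)
    fix s assume s: "s \<in> words n - ?B"
    then show "positions s \<subseteq> {..<n}" by (intro positions_subset) (simp add: words_def)
    from s have "real (weight s) \<le> r * real n" by auto
    then show "card (positions s) \<le> nread r n" unfolding card_positions nread_def by linarith
  qed (use r in \<open>auto intro: noise_nonneg\<close>)
  also have "\<dots> \<le> (\<Sum>s\<in>words n. noise r' s * H (positions s))"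
    using r by (intro sum_mono2 mult_nonneg_nonneg H0 noise_nonneg) auto
  also have "\<dots> = (\<Sum>m<K. HZ r' n (w m)) - HZ r' n ?W"
    unfolding HZ_eq H_def right_diff_distrib sum_subtractf sum_distrib_left
    by (subst sum.swap) simp
  also have "\<dots> \<le> real n * (1 - r' - m) + 4 + b * log 2 (real K)"
    using f g by (simp add: sum_subtractf)
  finally have "E \<le> real n * (1 - r' - m) + 4 + b * log 2 (real K) + sum (noise r') ?B * E"
    by (simp add: algebra_simps)
  also have "sum (noise r') ?B * E \<le> sum (noise r') ?B * log 2 (real K)"
    using r El by (intro mult_left_mono sum_nonneg noise_nonneg) auto
  also have "\<dots> \<le> 1 / (real n * (r - r')\<^sup>2) * log 2 (real K)"
    using r n lK by (intro mult_right_mono noise_tail) auto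
  also have "b * log 2 (real K) \<le> e * log 2 (real K)" using b lK by (rule mult_right_mono)
  finally show "equivocation r n K enc \<le> real n * (1 - r' - m) + 4 + (e + 1 / (real n * (r - r')\<^sup>2)) * log 2 (real K)"
    by (simp add: E_def algebra_simps)
  have "(1 - e) * real K \<le> (1 - b) * real K" using b by (intro mult_right_mono) auto
  also have "\<dots> \<le> 2 ^ n"
    unfolding b_def using \<rho> by (intro fano(2)) (auto simp: w0 wt K dec)
  finally show "(1 - e) * real K \<le> 2 ^ n" .
qed

lemma reliable_equivocation_le:
  fixes \<rho>' \<rho> r' r m :: real
  assumes fam: "valid_family K enc dec" and rel: "reliable r \<rho> K enc dec"
    and r: "0 < r'" "r' < r" "r < 1" and \<rho>: "0 < \<rho>'" "\<rho>' < \<rho>" "\<rho> < 1/2"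
    and m: "\<And>q. 0 \<le> q \<Longrightarrow> q \<le> 1 \<Longrightarrow> m \<le> gap r' \<rho>' q" and \<epsilon>: "0 < \<epsilon>"
  shows "\<forall>\<^sub>F n in sequentially. equivocation r n (K n) (enc n) / real n \<le> 1 - r' - m + \<epsilon>"
proof -
  define err where "err n = err_prob r n (K n) (enc n) (dec n) (fixed_positions (nread r n)) (\<lambda>_. truncated_noise \<rho>' \<rho> n)" for n
  have err: "err \<longlonglongrightarrow> 0"
  proof -
    have "\<forall>n. valid_adv r \<rho> n (fixed_positions (nread r n)) (\<lambda>_. truncated_noise \<rho>' \<rho> n)"
      using r \<rho> by (auto intro!: oblivious_adversary_valid)
    then show ?thesis
      using rel[unfolded reliable_def, THEN spec, of "\<lambda>n. fixed_positions (nread r n)", THEN spec, of "\<lambda>n _. truncated_noise \<rho>' \<rho> n"]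
      by (simp add: err_def[abs_def])
  qed
  define e where "e n = err n + 1 / (real n * (\<rho> - \<rho>')\<^sup>2)" for n
  define t where "t n = e n + 1 / (real n * (r - r')\<^sup>2)" for n
  have inv: "(\<lambda>n. c / (real n * d)) \<longlonglongrightarrow> 0" if "d > 0" for c d :: real using that by real_asymp
  have e: "e \<longlonglongrightarrow> 0"
    unfolding e_def[abs_def] using tendsto_add[OF err inv[of "(\<rho> - \<rho>')\<^sup>2" 1]] \<rho> by simp
  have t: "t \<longlonglongrightarrow> 0"
    unfolding t_def[abs_def] using tendsto_add[OF e inv[of "(r - r')\<^sup>2" 1]] r by simp
  have "(\<lambda>n. 4 / (real n * 1) + \<bar>t n\<bar> * 2) \<longlonglongrightarrow> 0 + \<bar>0\<bar> * 2"
    by (intro tendsto_intros t inv) simp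
  then have small: "\<forall>\<^sub>F n in sequentially. 4 / real n + \<bar>t n\<bar> * 2 < \<epsilon>"
    using order_tendstoD(2)[of _ 0 sequentially \<epsilon>] \<epsilon> by simp
  have "\<forall>\<^sub>F n in sequentially. e n < 1/2" using order_tendstoD(2)[OF e, of "1/2"] by simp
  then show ?thesis using small eventually_gt_at_top[of 0]
  proof eventually_elim
    case (elim n)
    have code: "valid_code n (K n) (enc n) (dec n)" using fam by (simp add: valid_family_def)
    have K: "1 \<le> real (K n)" using code by (simp add: valid_code_def)
    note b = equivocation_le[OF code elim(3) r \<rho> m, folded err_def, folded e_def, folded t_def]
    \<comment> \<open>Once the error term is below \<open>1/2\<close>, the code has at most
      \<open>2 ^ (n + 1)\<close> messages, so \<open>log 2 K\<close> is linear in \<open>n\<close>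
      and its product with the vanishing \<open>t n\<close> is negligible.\<close>
    have "1/2 * real (K n) \<le> (1 - e n) * real (K n)" using elim(1) by (intro mult_right_mono) auto
    then have "real (K n) \<le> 2 ^ (n + 1)" using b(2) by simp
    then have "log 2 (real (K n)) \<le> log 2 (2 ^ (n + 1))" using K by (subst log_le_cancel_iff) auto
    then have lK: "log 2 (real (K n)) \<le> 2 * real n" using elim(3) log_pow_cancel[of 2 "n + 1"] by simp
    have "t n * log 2 (real (K n)) \<le> \<bar>t n\<bar> * (2 * real n)"
      using K lK by (intro mult_mono) auto
    with b(1) have "equivocation r n (K n) (enc n) \<le> real n * (1 - r' - m) + 4 + \<bar>t n\<bar> * (2 * real n)" by linarith
    then have "equivocation r n (K n) (enc n) / real n \<le> (real n * (1 - r' - m) + 4 + \<bar>t n\<bar> * (2 * real n)) / real n"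
      using elim(3) by (intro divide_right_mono) auto
    also have "\<dots> = 1 - r' - m + (4 / real n + \<bar>t n\<bar> * 2)"
      using elim(3) by (simp add: field_simps)
    finally show ?case using elim(2) by linarith
  qed
qed

text \<open>The Chebyshev tails vanish only with strict slack in both parameters. Lowering
  \<open>r\<close> can only raise the gap, so continuity is used for the change of
  \<open>\<rho>\<close> alone; it has to be uniform in \<open>q\<close>.\<close>

lemma gap_perturb:
  fixes r \<rho> I :: real
  assumes r: "0 < r" "r < 1" and \<rho>: "0 < \<rho>" "\<rho> < 1/2"
    and I: "\<And>q. 0 \<le> q \<Longrightarrow> q \<le> 1 \<Longrightarrow> I \<le> gap r \<rho> q" and \<epsilon>: "0 < \<epsilon>"
  obtains r' \<rho>' where "0 < r'" "r' < r" "r - r' < \<epsilon>" "0 < \<rho>'" "\<rho>' < \<rho>"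
    "\<And>q. 0 \<le> q \<Longrightarrow> q \<le> 1 \<Longrightarrow> I - \<epsilon> \<le> gap r' \<rho>' q"
proof -
  have "uniformly_continuous_on {0..1} bin_entropy"
    by (rule compact_uniformly_continuous[OF continuous_on_bin_entropy]) simp
  then obtain d where d: "d > 0" "\<And>x y. x \<in> {0..1} \<Longrightarrow> y \<in> {0..1} \<Longrightarrow> dist y x < d \<Longrightarrow> dist (bin_entropy y) (bin_entropy x) < \<epsilon>"
    unfolding uniformly_continuous_on_def using \<epsilon> by metis
  \<comment> \<open>The first option keeps the value positive, the second keeps it within
    \<open>d\<close>: the argument of \<open>bin_entropy\<close> moves by at most
    \<open>\<rho> - \<rho>'\<close>.\<close>
  define \<rho>' where "\<rho>' = max (\<rho>/2) (\<rho> - d/2)"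
  define r' where "r' = max (r/2) (r - \<epsilon>/2)"
  have \<rho>': "0 < \<rho>'" "\<rho>' < \<rho>" "\<rho> - \<rho>' < d" using \<rho> d(1) by (auto simp: \<rho>'_def)
  have r': "0 < r'" "r' < r" "r - r' < \<epsilon>" using r \<epsilon> by (auto simp: r'_def)
  interpret a: gap_params r \<rho> using r \<rho> by unfold_locales
  interpret b: gap_params r' \<rho>' using r' \<rho>' r \<rho> by unfold_locales auto
  have "I - \<epsilon> \<le> gap r' \<rho>' q" if q: "0 \<le> q" "q \<le> 1" for q
  proof -
    have "\<bar>(\<rho>' + (1 - 2 * \<rho>') * q) - (\<rho> + (1 - 2 * \<rho>) * q)\<bar> = \<bar>(\<rho> - \<rho>') * (2 * q - 1)\<bar>"
      by (simp add: algebra_simps)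
    also have "\<dots> \<le> (\<rho> - \<rho>') * 1" unfolding abs_mult using \<rho>' q by (intro mult_mono) auto
    finally have "dist (\<rho>' + (1 - 2 * \<rho>') * q) (\<rho> + (1 - 2 * \<rho>) * q) < d"
      using \<rho>' by (simp add: dist_real_def)
    then have "dist (bin_entropy (\<rho>' + (1 - 2 * \<rho>') * q)) (bin_entropy (\<rho> + (1 - 2 * \<rho>) * q)) < \<epsilon>"
      using q by (intro d(2)) (auto intro!: a.noisy_bounds_le b.noisy_bounds_le)
    then have "bin_entropy (\<rho> + (1 - 2 * \<rho>) * q) - \<epsilon> \<le> bin_entropy (\<rho>' + (1 - 2 * \<rho>') * q)"
      by (simp add: dist_real_def)
    moreover have "r' * bin_entropy q \<le> r * bin_entropy q"
      using r' q by (intro mult_right_mono bin_entropy_nonneg) auto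
    ultimately show ?thesis using I[OF q] by (simp add: gap_def)
  qed
  with r' \<rho>' that show ?thesis by blast
qed

lemma reliable_equivocation_gap:
  assumes fam: "valid_family K enc dec" and rel: "reliable r \<rho> K enc dec"
    and r: "0 < r" "r < 1" and \<rho>: "0 < \<rho>" "\<rho> < 1/2"
    and I: "\<And>q. 0 \<le> q \<Longrightarrow> q \<le> 1 \<Longrightarrow> I \<le> gap r \<rho> q" and \<epsilon>: "0 < \<epsilon>"
  shows "\<forall>\<^sub>F n in sequentially. equivocation r n (K n) (enc n) / real n \<le> 1 - r - I + \<epsilon>"
proof -
  have "0 < \<epsilon> / 3" using \<epsilon> by simp
  then obtain r' \<rho>' where p: "0 < r'" "r' < r" "r - r' < \<epsilon>/3" "0 < \<rho>'" "\<rho>' < \<rho>"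
    "\<And>q. 0 \<le> q \<Longrightarrow> q \<le> 1 \<Longrightarrow> I - \<epsilon>/3 \<le> gap r' \<rho>' q"
    using gap_perturb[OF r \<rho> I] by blast
  have "\<forall>\<^sub>F n in sequentially. equivocation r n (K n) (enc n) / real n \<le> 1 - r' - (I - \<epsilon>/3) + \<epsilon>/3"
    using reliable_equivocation_le[OF fam rel p(1,2) r(2) p(4,5) \<rho>(2) p(6), of "\<epsilon>/3"] \<epsilon> by simp
  then show ?thesis by eventually_elim (use p(3) in linarith)
qed

section \<open>Upper bounds on the two capacities\<close>

lemma weak_capacity_le:
  assumes r: "0 < r" "r < 1" and \<rho>: "0 < \<rho>" "\<rho> < 1/2"
    and I: "\<And>q. 0 \<le> q \<Longrightarrow> q \<le> 1 \<Longrightarrow> I \<le> gap r \<rho> q"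
  shows "weak_capacity r \<rho> \<le> ereal (1 - r - I)"
  unfolding weak_capacity_def
proof (rule Sup_least)
  fix R assume R: "R \<in> insert 0 {R. R > 0 \<and> (\<exists>K enc dec. valid_family K enc dec \<and>
      reliable r \<rho> K enc dec \<and> weak_secret r K enc \<and> R = family_rate K)}"
  show "R \<le> ereal (1 - r - I)"
  proof (cases "R = 0")
    \<comment> \<open>The value \<open>0\<close> is inserted into the supremum by definition, so the
      bound itself must be nonnegative; this is
      \<open>I \<le> gap r \<rho> (1/2) = 1 - r\<close>.\<close>
    case True
    then show ?thesis using I[of "1/2"] by (simp add: gap_half)
  next
    case False
    with R obtain K enc dec where c: "valid_family K enc dec" "reliable r \<rho> K enc dec"
      "(\<lambda>n. ereal (equivocation r n (K n) (enc n) / real n)) \<longlonglongrightarrow> R"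
      by (auto simp: weak_secret_def)
    show ?thesis
    proof (rule ereal_le_epsilon2)
      fix \<epsilon> :: real assume "0 < \<epsilon>"
      from reliable_equivocation_gap[OF c(1,2) r \<rho> I this]
      have "\<forall>\<^sub>F n in sequentially. ereal (equivocation r n (K n) (enc n) / real n) \<le> ereal (1 - r - I) + ereal \<epsilon>"
        by simp
      with c(3) show "R \<le> ereal (1 - r - I) + ereal \<epsilon>" by (rule tendsto_upperbound) simp
    qed
  qed
qed

lemma mutual_info_unif:
  assumes K: "0 < K" and enc: "\<And>m. m < K \<Longrightarrow> is_dist (words n) (enc m)"
  shows "mutual_info (unif K) n K enc S = log 2 (real K) - cond_entropy n K enc S"
proof -
  let ?j = "joint (unif K) n enc S" and ?p = "pview (unif K) n K enc S"
  have j0: "0 \<le> ?j m v" if "m < K" for m v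
    using enc[OF that] by (auto simp: joint_def unif_def is_dist_def intro!: sum_nonneg divide_nonneg_nonneg)
  have jp: "?j m v \<le> ?p v" if "m < K" for m v
    unfolding pview_def using that j0 by (intro member_le_sum) auto
  have pt: "?j m v * log 2 (?j m v / (unif K m * ?p v)) = ?j m v * log 2 (real K) + ?j m v * log 2 (?j m v / ?p v)"
    if "m < K" for m v
  proof (cases "?j m v = 0")
    case False
    then have "0 < ?j m v" "0 < ?p v" using j0[OF that, of v] jp[OF that, of v] by linarith+
    then show ?thesis using that K by (simp add: unif_def log_mult log_divide algebra_simps)
  qed simp
  have "(\<Sum>m<K. \<Sum>v\<in>view S ` words n. ?j m v) = 1"
  proof -
    have "(\<Sum>v\<in>view S ` words n. ?j m v) = 1 / real K" if "m < K" for m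
    proof -
      have "(\<Sum>v\<in>view S ` words n. ?j m v) = 1 / real K * (\<Sum>v\<in>view S ` words n. view_mass n (enc m) S v)"
        using that by (simp add: joint_def unif_def view_mass_def sum_divide_distrib)
      also have "\<dots> = 1 / real K" unfolding sum_view_mass using enc[OF that] by (simp add: is_dist_def)
      finally show ?thesis .
    qed
    then show ?thesis using K by simp
  qed
  then have "(\<Sum>m<K. \<Sum>v\<in>view S ` words n. ?j m v * log 2 (real K)) = log 2 (real K)"
    by (simp add: sum_distrib_right[symmetric])
  then show ?thesis
    unfolding mutual_info_def cond_entropy_def using pt by (simp add: sum.distrib)
qed

text \<open>This does not go through \<open>weak_secret\<close>, which would force the normalised
  equivocation to converge. For uniform messages a bounded leak already puts \<open>log 2 K\<close>
  within a constant of the equivocation, and this bounds even the upper limit of the rates.\<close>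

lemma sem_capacity_le:
  assumes r: "0 < r" "r < 1" and \<rho>: "0 < \<rho>" "\<rho> < 1/2"
    and I: "\<And>q. 0 \<le> q \<Longrightarrow> q \<le> 1 \<Longrightarrow> I \<le> gap r \<rho> q"
  shows "sem_capacity r \<rho> \<le> ereal (1 - r - I)"
  unfolding sem_capacity_def
proof (rule Sup_least)
  fix R assume R: "R \<in> insert 0 {R. R > 0 \<and> (\<exists>K enc dec. valid_family K enc dec \<and>
      reliable r \<rho> K enc dec \<and> semantic_secret r K enc \<and> R = family_rate K)}"
  show "R \<le> ereal (1 - r - I)"
  proof (cases "R = 0")
    case True
    then show ?thesis using I[of "1/2"] by (simp add: gap_half)
  next
    case False
    with R obtain K enc dec c where fam: "valid_family K enc dec" and rel: "reliable r \<rho> K enc dec"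
      and c: "c > 0" and sec: "\<forall>\<^sub>F n in sequentially. \<forall>PS S. is_dist {..<K n} PS \<and> S \<in> rsets n (nread r n) \<longrightarrow>
        mutual_info PS n (K n) (enc n) S \<le> exp (- c * real n)" and R: "R = family_rate K"
      by (auto simp: semantic_secret_def)
    show ?thesis
    proof (rule ereal_le_epsilon2)
      fix \<epsilon> :: real assume \<epsilon>: "0 < \<epsilon>"
      then have "0 < \<epsilon> / 2" by simp
      from reliable_equivocation_gap[OF fam rel r \<rho> I this]
      have ev: "\<forall>\<^sub>F n in sequentially. equivocation r n (K n) (enc n) / real n \<le> 1 - r - I + \<epsilon> / 2" .
      have "(\<lambda>n. 1 / real n) \<longlonglongrightarrow> 0" by real_asymp
      then have sm: "\<forall>\<^sub>F n in sequentially. 1 / real n < \<epsilon> / 2" using order_tendstoD(2) \<open>0 < \<epsilon> / 2\<close> by blast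
      have "\<forall>\<^sub>F n in sequentially. ereal (log 2 (real (K n)) / real n) \<le> ereal (1 - r - I + \<epsilon>)"
        using ev sm sec eventually_gt_at_top[of 0]
      proof eventually_elim
        case (elim n)
        have code: "valid_code n (K n) (enc n) (dec n)" using fam by (simp add: valid_family_def)
        then have K: "0 < K n" and enc: "\<And>m. m < K n \<Longrightarrow> is_dist (words n) (enc n m)"
          by (auto simp: valid_code_def)
        have u: "is_dist {..<K n} (unif (K n))" using K by (auto simp: is_dist_def unif_def)
        have cl: "log 2 (real (K n)) - 1 \<le> cond_entropy n (K n) (enc n) S" if "S \<in> rsets n (nread r n)" for S
        proof -
          have "exp (- c * real n) \<le> 1" using c by simp
          moreover have "mutual_info (unif (K n)) n (K n) (enc n) S = log 2 (real (K n)) - cond_entropy n (K n) (enc n) S"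
            by (rule mutual_info_unif[OF K enc])
          moreover have "mutual_info (unif (K n)) n (K n) (enc n) S \<le> exp (- c * real n)"
            using elim(3) u that by blast
          ultimately show ?thesis by linarith
        qed
        have "{..<nread r n} \<in> rsets n (nread r n)"
          using initial_in_rsets nread_le r by simp
        with cl have "log 2 (real (K n)) - 1 \<le> equivocation r n (K n) (enc n)"
          unfolding equivocation_def by (subst Min_ge_iff) auto
        then have "(log 2 (real (K n)) - 1) / real n \<le> equivocation r n (K n) (enc n) / real n"
          by (intro divide_right_mono) auto
        then show ?case using elim(1,2) by (simp add: diff_divide_distrib)
      qed
      then have "limsup (\<lambda>n. ereal (log 2 (real (K n)) / real n)) \<le> ereal (1 - r - I + \<epsilon>)"
        by (rule Limsup_bounded)
      moreover have "family_rate K \<le> limsup (\<lambda>n. ereal (log 2 (real (K n)) / real n))"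
        unfolding family_rate_def by (rule Liminf_le_Limsup) simp
      ultimately show "R \<le> ereal (1 - r - I) + ereal \<epsilon>" using R by (metis order_trans plus_ereal.simps(1))
    qed
  qed
qed

section \<open>Codebooks with small deviations\<close>

text \<open>Derandomised Chernoff bound: the sequence is chosen greedily so that the exponential potential
  \<open>\<Sum>c\<in>C. exp (lam c * (\<Sum>a. y c a - (1 + lam c) * B c a))\<close> never increases. The bounds \<open>B\<close> may
  depend on the elements chosen before.\<close>

lemma greedy_sequence:
  fixes y :: "'c \<Rightarrow> 'a list \<Rightarrow> 'a \<Rightarrow> real" and B :: "'c \<Rightarrow> 'a list \<Rightarrow> real" and lam :: "'c \<Rightarrow> real"
  assumes X: "finite X" "X \<noteq> {}" and C: "finite C" "C \<noteq> {}"
    and lam: "\<And>c. c \<in> C \<Longrightarrow> 0 < lam c \<and> lam c \<le> 1"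
    and y: "\<And>c h x. c \<in> C \<Longrightarrow> set h \<subseteq> X \<Longrightarrow> x \<in> X \<Longrightarrow> 0 \<le> y c h x \<and> y c h x \<le> 1"
    and B: "\<And>c h. c \<in> C \<Longrightarrow> set h \<subseteq> X \<Longrightarrow> (\<Sum>x\<in>X. y c h x) \<le> real (card X) * B c h"
  obtains xs where "length xs = N" "set xs \<subseteq> X"
    "\<And>c. c \<in> C \<Longrightarrow> (\<Sum>a<N. y c (take a xs) (xs ! a)) \<le>
       ln (real (card C)) / lam c + (1 + lam c) * (\<Sum>a<N. B c (take a xs))"
proof -
  define T where "T c xs = (\<Sum>a<length xs. y c (take a xs) (xs ! a) - (1 + lam c) * B c (take a xs))" for c xs
  have T_snoc: "T c (xs @ [x]) = T c xs + (y c xs x - (1 + lam c) * B c xs)" for c xs x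
    by (simp add: T_def nth_append)
  have "\<exists>xs. length xs = N \<and> set xs \<subseteq> X \<and> (\<Sum>c\<in>C. exp (lam c * T c xs)) \<le> real (card C)"
  proof (induction N)
    case 0
    show ?case by (intro exI[of _ "[]"]) (simp add: T_def)
  next
    case (Suc N)
    then obtain xs where xs: "length xs = N" "set xs \<subseteq> X" "(\<Sum>c\<in>C. exp (lam c * T c xs)) \<le> real (card C)" by blast
    have step: "(\<Sum>x\<in>X. exp (lam c * T c (xs @ [x]))) \<le> real (card X) * exp (lam c * T c xs)" if c: "c \<in> C" for c
    proof -
      let ?l = "lam c"
      have l: "0 < ?l" "?l \<le> 1" using lam[OF c] by auto
      have e: "exp (?l * y c xs x) \<le> 1 + ?l * (1 + ?l) * y c xs x" if x: "x \<in> X" for x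
      proof -
        have yy: "0 \<le> y c xs x" "y c xs x \<le> 1" using y[OF c xs(2) x] by auto
        \<comment> \<open>The quadratic bound is valid because the exponent lies between 0 and 1; as
          the score is at most 1, its square is then replaced by the score itself.\<close>
        have "exp (?l * y c xs x) \<le> 1 + ?l * y c xs x + (?l * y c xs x)\<^sup>2"
          using l yy by (intro exp_bound) (auto intro: mult_le_one)
        also have "(?l * y c xs x)\<^sup>2 = ?l\<^sup>2 * (y c xs x * y c xs x)" by (simp add: power2_eq_square)
        also have "\<dots> \<le> ?l\<^sup>2 * (y c xs x * 1)" using yy by (intro mult_left_mono) auto
        finally show ?thesis by (simp add: algebra_simps power2_eq_square)
      qed
      have "(\<Sum>x\<in>X. exp (?l * y c xs x)) \<le> (\<Sum>x\<in>X. 1 + ?l * (1 + ?l) * y c xs x)"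
        by (intro sum_mono e)
      also have "\<dots> = real (card X) + ?l * (1 + ?l) * (\<Sum>x\<in>X. y c xs x)"
        by (simp add: sum.distrib sum_distrib_left)
      also have "\<dots> \<le> real (card X) + ?l * (1 + ?l) * (real (card X) * B c xs)"
        using l by (intro add_left_mono mult_left_mono B[OF c xs(2)]) auto
      also have "\<dots> = real (card X) * (1 + ?l * (1 + ?l) * B c xs)" by (simp add: algebra_simps)
      also have "\<dots> \<le> real (card X) * exp (?l * (1 + ?l) * B c xs)"
        by (intro mult_left_mono exp_ge_add_one_self) auto
      finally have s: "(\<Sum>x\<in>X. exp (?l * y c xs x)) \<le> real (card X) * exp (?l * (1 + ?l) * B c xs)" .
      have "(\<Sum>x\<in>X. exp (?l * T c (xs @ [x]))) = exp (?l * T c xs - ?l * (1 + ?l) * B c xs) * (\<Sum>x\<in>X. exp (?l * y c xs x))"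
        unfolding sum_distrib_left exp_add[symmetric] T_snoc by (simp add: algebra_simps)
      also have "\<dots> \<le> exp (?l * T c xs - ?l * (1 + ?l) * B c xs) * (real (card X) * exp (?l * (1 + ?l) * B c xs))"
        using s by (intro mult_left_mono) auto
      also have "\<dots> = real (card X) * exp (?l * T c xs)"
        by (simp add: mult_exp_exp)
      finally show ?thesis .
    qed
    \<comment> \<open>On average over \<open>x\<close> the potential does not increase, so some
      \<open>x\<close> does not increase it.\<close>
    have "\<exists>x\<in>X. (\<Sum>c\<in>C. exp (lam c * T c (xs @ [x]))) \<le> (\<Sum>c\<in>C. exp (lam c * T c xs))"
    proof (rule ccontr)
      assume "\<not> ?thesis"
      then have less: "(\<Sum>c\<in>C. exp (lam c * T c xs)) < (\<Sum>c\<in>C. exp (lam c * T c (xs @ [x])))" if "x \<in> X" for x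
        using that by (meson not_le)
      have "(\<Sum>x\<in>X. \<Sum>c\<in>C. exp (lam c * T c xs)) < (\<Sum>x\<in>X. \<Sum>c\<in>C. exp (lam c * T c (xs @ [x])))"
        using X less by (rule sum_strict_mono)
      also have "\<dots> = (\<Sum>c\<in>C. \<Sum>x\<in>X. exp (lam c * T c (xs @ [x])))" by (rule sum.swap)
      also have "\<dots> \<le> (\<Sum>c\<in>C. real (card X) * exp (lam c * T c xs))" by (intro sum_mono step)
      finally show False by (simp add: sum_distrib_left)
    qed
    then obtain x where "x \<in> X" "(\<Sum>c\<in>C. exp (lam c * T c (xs @ [x]))) \<le> (\<Sum>c\<in>C. exp (lam c * T c xs))" by blast
    then show ?case using xs by (intro exI[of _ "xs @ [x]"]) auto
  qed
  then obtain xs where xs: "length xs = N" "set xs \<subseteq> X" "(\<Sum>c\<in>C. exp (lam c * T c xs)) \<le> real (card C)" by blast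
  have "(\<Sum>a<N. y c (take a xs) (xs ! a)) \<le> ln (real (card C)) / lam c + (1 + lam c) * (\<Sum>a<N. B c (take a xs))"
    if c: "c \<in> C" for c
  proof -
    have "exp (lam c * T c xs) \<le> (\<Sum>c\<in>C. exp (lam c * T c xs))"
      using C c by (intro member_le_sum) auto
    also note xs(3)
    finally have "lam c * T c xs \<le> ln (real (card C))" using C by (subst ln_ge_iff) (auto simp: card_gt_0_iff)
    then have "T c xs \<le> ln (real (card C)) / lam c" using lam[OF c] by (simp add: field_simps)
    then show ?thesis by (simp add: T_def xs(1) sum_subtractf sum_distrib_left)
  qed
  with xs that show ?thesis by blast
qed

section \<open>Counting words with a given view and words in a Hamming ball\<close>

lemma card_words: "card (words n) = 2 ^ n"
  using card_lists_length_eq[of "UNIV :: bool set" n] by (simp add: words_def card_UNIV_bool)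

lemma view_eq_iff:
  assumes "S \<subseteq> {..<n}" "x \<in> words n" "y \<in> words n"
  shows "view S x = view S y \<longleftrightarrow> (\<forall>i\<in>S. x ! i = y ! i)"
proof -
  have "view S x = view S y \<longleftrightarrow> (\<forall>i<n. (if i \<in> S then Some (x ! i) else None) = (if i \<in> S then Some (y ! i) else None))"
    using assms by (auto simp: view_def words_def list_eq_iff_nth_eq)
  then show ?thesis using assms(1) by auto
qed

lemma card_view_fiber:
  assumes S: "S \<in> rsets n k" and u: "u \<in> words n"
  shows "card {z \<in> words n. view S z = view S u} = 2 ^ (n - k)"
proof -
  let ?F = "{z \<in> words n. view S z = view S u}" and ?R = "{..<n} - S"
  have Sn: "S \<subseteq> {..<n}" "card S = k" using S by (auto simp: rsets_def)
  have "bij_betw (\<lambda>z. {i \<in> ?R. z ! i}) ?F (Pow ?R)"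
  proof (rule bij_betw_byWitness[where f' = "\<lambda>A. map (\<lambda>i. if i \<in> S then u ! i else i \<in> A) [0..<n]"])
    show "\<forall>z\<in>?F. map (\<lambda>i. if i \<in> S then u ! i else i \<in> {i \<in> ?R. z ! i}) [0..<n] = z"
    proof
      fix z assume "z \<in> ?F"
      then have z: "z \<in> words n" "\<forall>i\<in>S. z ! i = u ! i" using view_eq_iff[OF Sn(1) _ u] by auto
      then show "map (\<lambda>i. if i \<in> S then u ! i else i \<in> {i \<in> ?R. z ! i}) [0..<n] = z"
        by (auto simp: list_eq_iff_nth_eq words_def)
    qed
    show "(\<lambda>A. map (\<lambda>i. if i \<in> S then u ! i else i \<in> A) [0..<n]) ` Pow ?R \<subseteq> ?F"
    proof safe
      fix A
      show w: "map (\<lambda>i. if i \<in> S then u ! i else i \<in> A) [0..<n] \<in> words n" by (simp add: words_def)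
      show "view S (map (\<lambda>i. if i \<in> S then u ! i else i \<in> A) [0..<n]) = view S u"
        using Sn(1) by (subst view_eq_iff[OF Sn(1) w u]) auto
    qed
  qed auto
  then have "card ?F = card (Pow ?R)" by (rule bij_betw_same_card)
  also have "\<dots> = 2 ^ (n - k)" using Sn by (simp add: card_Pow card_Diff_subset finite_subset)
  finally show ?thesis .
qed

lemma rsets_le: "S \<in> rsets n k \<Longrightarrow> k \<le> n"
  using card_mono[of "{..<n}" S] by (auto simp: rsets_def)

lemma card_views:
  assumes S: "S \<in> rsets n k"
  shows "card (view S ` words n) = 2 ^ k"
proof -
  have "card (words n) = (\<Sum>v\<in>view S ` words n. card {z \<in> words n. view S z = v})"
    using sum.image_gen[OF finite_words, of "\<lambda>_. 1 :: nat" n "view S"] by simp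
  also have "\<dots> = (\<Sum>v\<in>view S ` words n. 2 ^ (n - k))"
    by (intro sum.cong refl) (auto simp: card_view_fiber[OF S])
  finally have "2 ^ n = card (view S ` words n) * 2 ^ (n - k)" by (simp add: card_words)
  moreover have "(2::nat) ^ n = 2 ^ k * 2 ^ (n - k)" using rsets_le[OF S] by (simp add: power_add[symmetric])
  ultimately show ?thesis by simp
qed

definition ball_volume :: "nat \<Rightarrow> nat \<Rightarrow> nat" where
  "ball_volume n t = card {e \<in> words n. weight e \<le> t}"

lemma ball_volume_pos: "0 < ball_volume n t"
proof -
  have "replicate n False \<in> {e \<in> words n. weight e \<le> t}" by (simp add: words_def)
  then show ?thesis unfolding ball_volume_def by (subst card_gt_0_iff) auto
qed

lemma card_ball:
  assumes "y \<in> words n"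
  shows "card {x \<in> words n. hdist y x \<le> t} = ball_volume n t"
proof -
  have "card {x \<in> words n. hdist y x \<le> t} = (\<Sum>x\<in>words n. if weight (xorw y x) \<le> t then 1 else 0)"
    by (simp add: hdist_def sum.inter_filter[symmetric])
  also have "\<dots> = (\<Sum>e\<in>words n. if weight e \<le> t then 1 else 0)"
    using sum.reindex_bij_witness[of "words n" "xorw y" "xorw y" "words n" "\<lambda>e. if weight e \<le> t then 1 else 0" "\<lambda>x. if weight (xorw y x) \<le> t then 1 else (0::nat)"]
      assms by (simp add: words_def xorw_cancel)
  also have "\<dots> = ball_volume n t"
    by (simp add: ball_volume_def sum.inter_filter[symmetric])
  finally show ?thesis .
qed

lemma xorw_commute: "xorw x y = xorw y x"
proof (induction x arbitrary: y)
  case (Cons a x)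
  then show ?case by (cases y) (auto simp: xorw_def)
qed (simp add: xorw_def)

lemma xorw_assoc: "xorw (xorw x y) z = xorw x (xorw y z)"
proof (induction x arbitrary: y z)
  case (Cons a x)
  then show ?case by (cases y; cases z) (auto simp: xorw_def)
qed (simp add: xorw_def)

lemma hdist_commute: "hdist x y = hdist y x"
  by (simp add: hdist_def xorw_commute)

lemma hdist_xorw: "hdist (xorw z e) x = hdist (xorw x e) z"
  unfolding hdist_def by (metis xorw_assoc xorw_commute)

lemma xorw_words: "x \<in> words n \<Longrightarrow> e \<in> words n \<Longrightarrow> xorw x e \<in> words n"
  by (simp add: words_def)

lemma sum_indicator: "finite A \<Longrightarrow> (\<Sum>a\<in>A. if P a then 1 else 0) = real (card {a \<in> A. P a})"
  by (simp add: sum.inter_filter[symmetric])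

lemma card_block: "m < K \<Longrightarrow> 0 < L \<Longrightarrow> card {a. a < K * L \<and> a div L = m} = (L :: nat)"
proof -
  assume m: "m < K" and L: "0 < L"
  have "{a. a < K * L \<and> a div L = m} = {m * L..<m * L + L}"
  proof (intro set_eqI iffI)
    fix a assume "a \<in> {m * L..<m * L + L}"
    then have "a div L = m" using L by (auto simp: div_nat_eqI mult.commute)
    moreover from this have "a < K * L" using m L by (simp add: div_less_iff_less_mult[symmetric])
    ultimately show "a \<in> {a. a < K * L \<and> a div L = m}" by simp
  next
    fix a assume "a \<in> {a. a < K * L \<and> a div L = m}"
    then have "a div L = m" by simp
    then have "a = m * L + a mod L" by (metis div_mult_mod_eq)
    moreover have "a mod L < L" using L by simp
    ultimately show "a \<in> {m * L..<m * L + L}" by (metis atLeastLessThan_iff le_add1 nat_add_left_cancel_less)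
  qed
  then show ?thesis by simp
qed

text \<open>The requirements on the codebook \<open>xs\<close>, each a count which has to stay near its mean.
  \<open>Sec\<close>: the codewords of a message spread evenly over the views. \<open>Near\<close>: few codewords lie in a
  Hamming ball. \<open>Past\<close> and \<open>Fut\<close>: few codewords with a given view have, after adding \<open>e\<close>, an earlier
  respectively a later codeword within distance \<open>t\<close>. \<open>Cover\<close> only controls the mean of \<open>Past\<close>.\<close>

datatype requirement =
    Sec nat "nat set" "bool list"
  | Cover "nat set" "bool list" "bool list"
  | Past "nat set" "bool list" "bool list"
  | Fut "nat set" "bool list" "bool list"
  | Near "bool list"

text \<open>The number of words with the view of \<open>u\<close> that would be spoiled by a
  codeword at \<open>x\<close> under the error \<open>e\<close>.\<close>

definition cover :: "nat \<Rightarrow> nat \<Rightarrow> nat set \<Rightarrow> bool list \<Rightarrow> bool list \<Rightarrow> bool list \<Rightarrow> nat" where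
  "cover n t S u e x = card {z \<in> words n. view S z = view S u \<and> hdist (xorw z e) x \<le> t}"

text \<open>\<open>h\<close> lists the codewords chosen so far, so \<open>length h\<close> is the
  index of the next one. The greedy choice needs scores in the unit interval: \<open>Cover\<close>
  is divided by the largest possible value of \<open>cover\<close>, and \<open>Fut\<close>, whose
  raw count can be large, is scaled by \<open>\<Lambda>\<close> and cut off at 1.\<close>

fun score :: "nat \<Rightarrow> nat \<Rightarrow> nat \<Rightarrow> real \<Rightarrow> requirement \<Rightarrow> bool list list \<Rightarrow> bool list \<Rightarrow> real" where
  "score n t L \<Lambda> (Sec m S u) h x = (if length h div L = m \<and> view S x = view S u then 1 else 0)"
| "score n t L \<Lambda> (Cover S u e) h x = real (cover n t S u e x) / real (ball_volume n t)"
| "score n t L \<Lambda> (Past S u e) h x =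
     (if view S x = view S u \<and> (\<exists>b\<in>set h. hdist (xorw x e) b \<le> t) then 1 else 0)"
| "score n t L \<Lambda> (Fut S u e) h x =
     min 1 (real (card {i \<in> {..<length h}. view S (h ! i) = view S u \<and> hdist (xorw (h ! i) e) x \<le> t}) / \<Lambda>)"
| "score n t L \<Lambda> (Near c) h x = (if hdist c x \<le> t then 1 else 0)"

text \<open>Upper bounds for the average score over all choices of the next codeword, given the
  history. For \<open>Past\<close> the bound involves the covers of earlier codewords; this is why
  \<open>Cover\<close> is a requirement of its own.\<close>

fun mean :: "nat \<Rightarrow> nat \<Rightarrow> nat \<Rightarrow> nat \<Rightarrow> real \<Rightarrow> requirement \<Rightarrow> bool list list \<Rightarrow> real" where
  "mean n k t L \<Lambda> (Sec m S u) h = (if length h div L = m then 1 / 2 ^ k else 0)"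
| "mean n k t L \<Lambda> (Cover S u e) h = 1 / 2 ^ k"
| "mean n k t L \<Lambda> (Past S u e) h = (\<Sum>i<length h. real (cover n t S u e (h ! i))) / 2 ^ n"
| "mean n k t L \<Lambda> (Fut S u e) h =
     real (card {i \<in> {..<length h}. view S (h ! i) = view S u}) * real (ball_volume n t) / (2 ^ n * \<Lambda>)"
| "mean n k t L \<Lambda> (Near c) h = real (ball_volume n t) / 2 ^ n"

definition requirements :: "nat \<Rightarrow> nat \<Rightarrow> nat \<Rightarrow> requirement set" where
  "requirements n k K =
     (\<lambda>(m, S, u). Sec m S u) ` ({..<K} \<times> rsets n k \<times> words n) \<union>
     (\<lambda>(S, u, e). Cover S u e) ` (rsets n k \<times> words n \<times> words n) \<union>
     (\<lambda>(S, u, e). Past S u e) ` (rsets n k \<times> words n \<times> words n) \<union>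
     (\<lambda>(S, u, e). Fut S u e) ` (rsets n k \<times> words n \<times> words n) \<union>
     Near ` words n"

lemma requirements_simps [simp]:
  "Sec m S u \<in> requirements n k K \<longleftrightarrow> m < K \<and> S \<in> rsets n k \<and> u \<in> words n"
  "Cover S u e \<in> requirements n k K \<longleftrightarrow> S \<in> rsets n k \<and> u \<in> words n \<and> e \<in> words n"
  "Past S u e \<in> requirements n k K \<longleftrightarrow> S \<in> rsets n k \<and> u \<in> words n \<and> e \<in> words n"
  "Fut S u e \<in> requirements n k K \<longleftrightarrow> S \<in> rsets n k \<and> u \<in> words n \<and> e \<in> words n"
  "Near a \<in> requirements n k K \<longleftrightarrow> a \<in> words n"
  by (auto simp: requirements_def image_iff)

lemma finite_requirements: "finite (requirements n k K)"
  by (simp add: requirements_def)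

lemma card_rsets_le: "card (rsets n k) \<le> 2 ^ n"
  using card_mono[of "Pow {..<n}" "rsets n k"] by (auto simp: rsets_def card_Pow)

lemma card_requirements_le:
  assumes "K \<le> 2 ^ n"
  shows "card (requirements n k K) \<le> 8 ^ (n + 1)"
proof -
  have e: "(8::nat) ^ n = 2 ^ n * (2 ^ n * 2 ^ n)" by (simp add: power_mult_distrib[symmetric])
  have t: "card (rsets n k \<times> words n \<times> words n) \<le> 8 ^ n"
    unfolding card_cartesian_product card_words e using card_rsets_le by (rule mult_right_mono) simp
  have s: "card ({..<K} \<times> rsets n k \<times> words n) \<le> 8 ^ n"
    unfolding card_cartesian_product card_words e using assms card_rsets_le[of n k]
    by (intro mult_mono) auto
  have w: "card (words n) \<le> 8 ^ n" unfolding card_words by (rule power_mono) auto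
  have c: "card (f ` A) \<le> 8 ^ n" if "card A \<le> 8 ^ n" "finite A" for f :: "'b \<Rightarrow> requirement" and A
    using card_image_le[OF that(2), of f] that(1) by (rule order_trans)
  have "card (requirements n k K) \<le> 8 ^ n + 8 ^ n + 8 ^ n + 8 ^ n + 8 ^ n"
    unfolding requirements_def
    by (intro order_trans[OF card_Un_le] add_mono c s t w) auto
  then show ?thesis by simp
qed

lemma requirements_nonempty: "requirements n k K \<noteq> {}"
proof -
  have "replicate n False \<in> words n" by (simp add: words_def)
  then show ?thesis by (auto simp: requirements_def)
qed

lemma cover_le:
  assumes "x \<in> words n" "e \<in> words n"
  shows "cover n t S u e x \<le> ball_volume n t"
proof -
  have "cover n t S u e x \<le> card {z \<in> words n. hdist (xorw x e) z \<le> t}"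
    unfolding cover_def by (intro card_mono) (auto simp: hdist_xorw[of _ e x])
  also have "\<dots> = ball_volume n t" using assms by (intro card_ball xorw_words)
  finally show ?thesis .
qed

lemma score_bounds:
  assumes "0 < \<Lambda>" "c \<in> requirements n k K" "x \<in> words n"
  shows "0 \<le> score n t L \<Lambda> c h x \<and> score n t L \<Lambda> c h x \<le> 1"
  using assms cover_le[OF assms(3)] ball_volume_pos[of n t]
  by (auto simp: requirements_def)

lemma sum_cover:
  assumes S: "S \<in> rsets n k" and u: "u \<in> words n" and e: "e \<in> words n"
  shows "(\<Sum>x\<in>words n. real (cover n t S u e x)) = 2 ^ (n - k) * real (ball_volume n t)"
proof -
  let ?F = "{z \<in> words n. view S z = view S u}"
  have "(\<Sum>x\<in>words n. real (cover n t S u e x)) = (\<Sum>x\<in>words n. \<Sum>z\<in>?F. if hdist (xorw z e) x \<le> t then 1 else 0)"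
    unfolding cover_def by (intro sum.cong refl) (subst sum_indicator, auto intro!: arg_cong[where f = card])
  also have "\<dots> = (\<Sum>z\<in>?F. \<Sum>x\<in>words n. if hdist (xorw z e) x \<le> t then 1 else 0)" by (rule sum.swap)
  also have "\<dots> = (\<Sum>z\<in>?F. real (ball_volume n t))"
    using e by (intro sum.cong refl) (simp add: sum_indicator card_ball xorw_words)
  also have "\<dots> = 2 ^ (n - k) * real (ball_volume n t)" by (simp add: card_view_fiber[OF S u])
  finally show ?thesis .
qed

lemma two_power_diff: "k \<le> n \<Longrightarrow> (2::real) ^ (n - k) = 2 ^ n / 2 ^ k"
  by (simp add: power_diff)

text \<open>Equality for \<open>Sec\<close>, \<open>Cover\<close> and \<open>Near\<close>, by
  counting fibres and balls; a union bound over earlier codewords for \<open>Past\<close>; dropping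
  the cut-off for \<open>Fut\<close>.\<close>

lemma sum_score_le:
  assumes \<Lambda>: "0 < \<Lambda>" and c: "c \<in> requirements n k K" and h: "set h \<subseteq> words n"
  shows "(\<Sum>x\<in>words n. score n t L \<Lambda> c h x) \<le> real (card (words n)) * mean n k t L \<Lambda> c h"
proof (cases c)
  case (Sec m S u)
  then have S: "S \<in> rsets n k" and u: "u \<in> words n" using c by (auto simp: requirements_def)
  show ?thesis
    using sum_indicator[of "words n" "\<lambda>x. view S x = view S u"]
    by (simp add: Sec card_view_fiber[OF S u] card_words two_power_diff[OF rsets_le[OF S]])
next
  case (Cover S u e)
  then have S: "S \<in> rsets n k" and u: "u \<in> words n" "e \<in> words n" using c by (auto simp: requirements_def)
  show ?thesis
    using ball_volume_pos[of n t]
    by (simp add: Cover sum_divide_distrib[symmetric] sum_cover[OF S u] card_words two_power_diff[OF rsets_le[OF S]])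
next
  case (Past S u e)
  let ?P = "\<lambda>b x. view S x = view S u \<and> hdist (xorw x e) b \<le> t"
  have "(\<Sum>x\<in>words n. score n t L \<Lambda> c h x) \<le> (\<Sum>x\<in>words n. \<Sum>i<length h. if ?P (h ! i) x then 1 else 0)"
  proof (rule sum_mono)
    fix x
    show "score n t L \<Lambda> c h x \<le> (\<Sum>i<length h. if ?P (h ! i) x then 1 else 0)"
    proof (cases "view S x = view S u \<and> (\<exists>b\<in>set h. hdist (xorw x e) b \<le> t)")
      case True
      then obtain i where "i < length h" "?P (h ! i) x" by (auto simp: in_set_conv_nth)
      then have "(if ?P (h ! i) x then 1 else 0 :: real) \<le> (\<Sum>i<length h. if ?P (h ! i) x then 1 else 0)"
        by (intro member_le_sum) auto
      then show ?thesis using \<open>?P (h ! i) x\<close> by (auto simp: Past)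
    next
      case False
      then show ?thesis by (auto simp: Past intro!: sum_nonneg)
    qed
  qed
  also have "\<dots> = (\<Sum>i<length h. \<Sum>x\<in>words n. if ?P (h ! i) x then 1 else 0)" by (rule sum.swap)
  also have "\<dots> = (\<Sum>i<length h. real (cover n t S u e (h ! i)))"
    by (simp add: sum_indicator cover_def)
  finally show ?thesis by (simp add: Past card_words)
next
  case (Fut S u e)
  then have e: "e \<in> words n" using c by (auto simp: requirements_def)
  let ?I = "{i \<in> {..<length h}. view S (h ! i) = view S u}"
  have "(\<Sum>x\<in>words n. score n t L \<Lambda> c h x) \<le>
    (\<Sum>x\<in>words n. real (card {i \<in> {..<length h}. view S (h ! i) = view S u \<and> hdist (xorw (h ! i) e) x \<le> t}) / \<Lambda>)"
    by (intro sum_mono) (simp add: Fut)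
  also have "\<dots> = (\<Sum>x\<in>words n. \<Sum>i\<in>?I. if hdist (xorw (h ! i) e) x \<le> t then 1 else 0) / \<Lambda>"
    unfolding sum_divide_distrib[symmetric]
    by (intro arg_cong2[where f = "(/)"] sum.cong refl) (subst sum_indicator, auto intro!: arg_cong[where f = card])
  also have "(\<Sum>x\<in>words n. \<Sum>i\<in>?I. if hdist (xorw (h ! i) e) x \<le> t then 1 else 0) =
    (\<Sum>i\<in>?I. \<Sum>x\<in>words n. if hdist (xorw (h ! i) e) x \<le> t then 1 else 0 :: real)" by (rule sum.swap)
  also have "\<dots> = (\<Sum>i\<in>?I. real (ball_volume n t))"
  proof (intro sum.cong refl)
    fix i assume "i \<in> ?I"
    then have "h ! i \<in> words n" using h by (auto dest: nth_mem)
    then show "(\<Sum>x\<in>words n. if hdist (xorw (h ! i) e) x \<le> t then 1 else 0) = real (ball_volume n t)"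
      using e by (simp add: sum_indicator card_ball xorw_words)
  qed
  finally show ?thesis using \<Lambda> by (simp add: Fut card_words)
next
  case (Near a)
  then have "a \<in> words n" using c by (auto simp: requirements_def)
  then show ?thesis by (simp add: Near sum_indicator card_ball card_words)
qed

text \<open>\<open>\<kappa>\<close> dominates the logarithm of the number of requirements, and
  \<open>\<epsilon>\<close> is the mean number of codewords in a ball. In the last bound the first
  two terms come from earlier neighbours. The other two come from later ones, rescaled by
  \<open>\<kappa> + 2 * \<epsilon>\<close>, the bound that \<open>Near\<close> gives for any
  ball.\<close>

lemma good_codebook:
  fixes n k t K L :: nat and \<mu> :: real
  assumes K: "0 < K" "K \<le> 2 ^ n" and L: "0 < L" and \<mu>: "0 < \<mu>" "\<mu> \<le> 1"
  defines "\<kappa> \<equiv> real (n + 1) * ln 8"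
    and "\<epsilon> \<equiv> real (K * L) * real (ball_volume n t) / 2 ^ n"
    and "\<Delta> \<equiv> (real (n + 1) * ln 8) / \<mu> + (1 + \<mu>) * (real L / 2 ^ k)"
  obtains xs where "length xs = K * L" "set xs \<subseteq> words n"
    "\<And>m S u. m < K \<Longrightarrow> S \<in> rsets n k \<Longrightarrow> u \<in> words n \<Longrightarrow>
       real (card {a \<in> {..<K * L}. a div L = m \<and> view S (xs ! a) = view S u}) \<le> \<Delta>"
    "\<And>S u e. S \<in> rsets n k \<Longrightarrow> u \<in> words n \<Longrightarrow> e \<in> words n \<Longrightarrow>
       real (card {a \<in> {..<K * L}. view S (xs ! a) = view S u \<and>
         (\<exists>b<K * L. b \<noteq> a \<and> hdist (xorw (xs ! a) e) (xs ! b) \<le> t)})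
       \<le> \<kappa> + 2 * \<epsilon> * (\<kappa> + 2 * (real (K * L) / 2 ^ k)) + (\<kappa> + 2 * \<epsilon>) * \<kappa> + 2 * \<epsilon> * (real K * \<Delta>)"
proof -
  define N where "N = K * L"
  define V where "V = real (ball_volume n t)"
  define \<Lambda> where "\<Lambda> = \<kappa> + 2 * \<epsilon>"
  have V: "V > 0" using ball_volume_pos[of n t] by (simp add: V_def)
  have \<kappa>: "\<kappa> > 0" by (simp add: \<kappa>_def)
  have \<epsilon>: "0 \<le> \<epsilon>" by (simp add: \<epsilon>_def)
  have \<Lambda>: "\<Lambda> > 0" using \<kappa> \<epsilon> by (simp add: \<Lambda>_def)
  \<comment> \<open>Secrecy needs counts within a factor tending to 1 of their means, hence the
    precision \<open>\<mu>\<close>; elsewhere a factor 2 is harmless.\<close>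
  define lam where "lam c = (case c of Sec _ _ _ \<Rightarrow> \<mu> | _ \<Rightarrow> 1)" for c
  have lam: "0 < lam c \<and> lam c \<le> 1" for c using \<mu> by (auto simp: lam_def split: requirement.splits)
  have wn: "words n \<noteq> {}" using card_words[of n] by force
  obtain xs where xs: "length xs = N" "set xs \<subseteq> words n"
    and x: "\<And>c. c \<in> requirements n k K \<Longrightarrow> (\<Sum>a<N. score n t L \<Lambda> c (take a xs) (xs ! a)) \<le>
       ln (real (card (requirements n k K))) / lam c + (1 + lam c) * (\<Sum>a<N. mean n k t L \<Lambda> c (take a xs))"
  proof (rule greedy_sequence[of "words n" "requirements n k K" lam "score n t L \<Lambda>" "mean n k t L \<Lambda>" N])
    show "finite (words n)" "words n \<noteq> {}" by (simp_all add: wn)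
    show "finite (requirements n k K)" "requirements n k K \<noteq> {}"
      by (rule finite_requirements, rule requirements_nonempty)
    show "0 < lam c \<and> lam c \<le> 1" for c by (rule lam)
    show "0 \<le> score n t L \<Lambda> c h x \<and> score n t L \<Lambda> c h x \<le> 1"
      if "c \<in> requirements n k K" "x \<in> words n" for c h x using score_bounds[OF \<Lambda> that] .
    show "(\<Sum>x\<in>words n. score n t L \<Lambda> c h x) \<le> real (card (words n)) * mean n k t L \<Lambda> c h"
      if "c \<in> requirements n k K" "set h \<subseteq> words n" for c h using sum_score_le[OF \<Lambda> that] .
  qed (rule that)
  have lnC: "ln (real (card (requirements n k K))) \<le> \<kappa>"
  proof -
    have "0 < card (requirements n k K)"
      using finite_requirements requirements_nonempty by (simp add: card_gt_0_iff)
    then have "ln (real (card (requirements n k K))) \<le> ln (real (8 ^ (n + 1)))"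
      using card_requirements_le[OF K(2), of k] by (subst ln_le_cancel_iff) (auto simp del: power_Suc of_nat_power)
    also have "\<dots> = \<kappa>" unfolding \<kappa>_def of_nat_power by (subst ln_realpow) auto
    finally show ?thesis .
  qed
  have x': "(\<Sum>a<N. score n t L \<Lambda> c (take a xs) (xs ! a)) \<le> \<kappa> / lam c + (1 + lam c) * (\<Sum>a<N. mean n k t L \<Lambda> c (take a xs))"
    if "c \<in> requirements n k K" for c
    using x[OF that] divide_right_mono[OF lnC, of "lam c"] lam[of c] by linarith
  have len: "length (take a xs) = a" if "a < N" for a using that xs(1) by simp
  have xw: "xs ! a \<in> words n" if "a < N" for a using that xs by (auto dest: nth_mem)
  have sec: "real (card {a \<in> {..<N}. a div L = m \<and> view S (xs ! a) = view S u}) \<le> \<Delta>"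
    if "m < K" "S \<in> rsets n k" "u \<in> words n" for m S u
  proof -
    have c: "Sec m S u \<in> requirements n k K" using that by simp
    have "(\<Sum>a<N. score n t L \<Lambda> (Sec m S u) (take a xs) (xs ! a)) =
      (\<Sum>a<N. if a div L = m \<and> view S (xs ! a) = view S u then 1 else 0)"
      by (intro sum.cong refl) (simp add: len del: length_take)
    also have "\<dots> = real (card {a \<in> {..<N}. a div L = m \<and> view S (xs ! a) = view S u})"
      by (simp add: sum_indicator)
    finally have 1: "(\<Sum>a<N. score n t L \<Lambda> (Sec m S u) (take a xs) (xs ! a)) =
      real (card {a \<in> {..<N}. a div L = m \<and> view S (xs ! a) = view S u})" .
    have "(\<Sum>a<N. mean n k t L \<Lambda> (Sec m S u) (take a xs)) = (\<Sum>a<N. (if a div L = m then 1 else 0)) / 2 ^ k"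
      unfolding sum_divide_distrib by (intro sum.cong refl) (simp add: len del: length_take)
    also have "(\<Sum>a<N. (if a div L = m then 1 else 0)) = real L"
      using card_block[OF that(1) L] by (simp add: sum_indicator N_def)
    finally show ?thesis using x'[OF c] 1 by (simp add: \<Delta>_def \<kappa>_def lam_def)
  qed
  \<comment> \<open>Summed over all messages, \<open>Sec\<close> bounds the codewords with a given
    view, and this is the history-dependent part of the mean of \<open>Fut\<close>.\<close>
  have all: "real (card {a \<in> {..<N}. view S (xs ! a) = view S u}) \<le> real K * \<Delta>"
    if "S \<in> rsets n k" "u \<in> words n" for S u
  proof -
    have "real (card {a \<in> {..<N}. view S (xs ! a) = view S u}) = (\<Sum>a<N. if view S (xs ! a) = view S u then 1 else 0)"
      by (simp add: sum_indicator)
    also have "\<dots> = (\<Sum>a<N. \<Sum>m<K. if a div L = m \<and> view S (xs ! a) = view S u then 1 else 0)"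
    proof (intro sum.cong refl)
      fix a assume "a \<in> {..<N}"
      then have "a div L < K" by (simp add: N_def less_mult_imp_div_less)
      then show "(if view S (xs ! a) = view S u then 1 else 0 :: real) = (\<Sum>m<K. if a div L = m \<and> view S (xs ! a) = view S u then 1 else 0)"
        by (cases "view S (xs ! a) = view S u") simp_all
    qed
    also have "\<dots> = (\<Sum>m<K. \<Sum>a<N. if a div L = m \<and> view S (xs ! a) = view S u then 1 else 0)" by (rule sum.swap)
    also have "\<dots> = (\<Sum>m<K. real (card {a \<in> {..<N}. a div L = m \<and> view S (xs ! a) = view S u}))"
      by (simp add: sum_indicator)
    also have "\<dots> \<le> (\<Sum>m<K. \<Delta>)" using that by (intro sum_mono sec) auto
    finally show ?thesis by simp
  qed
  have ball: "real (card {a \<in> {..<N}. hdist c (xs ! a) \<le> t}) \<le> \<Lambda>" if "c \<in> words n" for c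
  proof -
    have "Near c \<in> requirements n k K" using that by simp
    from x'[OF this] show ?thesis by (simp add: lam_def sum_indicator \<Lambda>_def \<epsilon>_def N_def)
  qed
  have bad: "real (card {a \<in> {..<N}. view S (xs ! a) = view S u \<and> (\<exists>b<N. b \<noteq> a \<and> hdist (xorw (xs ! a) e) (xs ! b) \<le> t)})
     \<le> \<kappa> + 2 * \<epsilon> * (\<kappa> + 2 * (real N / 2 ^ k)) + \<Lambda> * \<kappa> + 2 * \<epsilon> * (real K * \<Delta>)"
    if S: "S \<in> rsets n k" and u: "u \<in> words n" and e: "e \<in> words n" for S u e
  proof -
    have c: "Cover S u e \<in> requirements n k K" "Past S u e \<in> requirements n k K" "Fut S u e \<in> requirements n k K"
      using that by simp_all
    define q where "q a = real (cover n t S u e (xs ! a))" for a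
    have "(\<Sum>a<N. q a) / V \<le> \<kappa> + 2 * (real N / 2 ^ k)"
      using x'[OF c(1)] by (simp add: lam_def q_def V_def sum_divide_distrib)
    then have q: "(\<Sum>a<N. q a) \<le> V * (\<kappa> + 2 * (real N / 2 ^ k))"
      using V by (simp add: divide_le_eq mult.commute)
    let ?p = "\<lambda>a. view S (xs ! a) = view S u \<and> (\<exists>b<a. hdist (xorw (xs ! a) e) (xs ! b) \<le> t)"
    have st: "set (take a xs) = (\<lambda>b. xs ! b) ` {..<a}" if "a < N" for a
      using nth_image[of a xs] that xs(1) by (simp add: lessThan_atLeast0)
    have "real (card {a \<in> {..<N}. ?p a}) = (\<Sum>a<N. score n t L \<Lambda> (Past S u e) (take a xs) (xs ! a))"
      unfolding sum_indicator[OF finite_lessThan, symmetric] by (intro sum.cong refl) (auto simp: st)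
    also have "\<dots> \<le> \<kappa> + 2 * (\<Sum>a<N. mean n k t L \<Lambda> (Past S u e) (take a xs))"
      using x'[OF c(2)] by (simp add: lam_def)
    also have "(\<Sum>a<N. mean n k t L \<Lambda> (Past S u e) (take a xs)) \<le> (\<Sum>a<N. (\<Sum>i<N. q i) / 2 ^ n)"
    proof (intro sum_mono)
      fix a assume a: "a \<in> {..<N}"
      have "(\<Sum>i<a. real (cover n t S u e (take a xs ! i))) = (\<Sum>i<a. q i)"
        by (intro sum.cong refl) (simp add: q_def)
      also have "\<dots> \<le> (\<Sum>i<N. q i)" using a by (intro sum_mono2) (auto simp: q_def)
      finally show "mean n k t L \<Lambda> (Past S u e) (take a xs) \<le> (\<Sum>i<N. q i) / 2 ^ n"
        using a by (simp add: len divide_right_mono del: length_take)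
    qed
    also have "\<dots> = real N / 2 ^ n * (\<Sum>i<N. q i)" by simp
    also have "\<dots> \<le> real N / 2 ^ n * (V * (\<kappa> + 2 * (real N / 2 ^ k)))" using q by (intro mult_left_mono) auto
    also have "\<dots> = \<epsilon> * (\<kappa> + 2 * (real N / 2 ^ k))" by (simp add: \<epsilon>_def N_def V_def)
    finally have past: "real (card {a \<in> {..<N}. ?p a}) \<le> \<kappa> + 2 * \<epsilon> * (\<kappa> + 2 * (real N / 2 ^ k))" by simp
    define f where "f a = real (card {i \<in> {..<a}. view S (xs ! i) = view S u \<and> hdist (xorw (xs ! i) e) (xs ! a) \<le> t})" for a
    \<comment> \<open>By symmetry these codewords lie in the ball around
      \<open>xorw (xs ! a) e\<close>, so \<open>Near\<close> applies and the cut-off in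
      \<open>Fut\<close> never acts along \<open>xs\<close>.\<close>
    have f\<Lambda>: "f a \<le> \<Lambda>" if "a < N" for a
    proof -
      have "f a \<le> real (card {i \<in> {..<N}. hdist (xorw (xs ! a) e) (xs ! i) \<le> t})"
        unfolding f_def using that by (intro of_nat_mono card_mono) (auto simp: hdist_xorw[of _ e "xs ! a"])
      also have "\<dots> \<le> \<Lambda>" using that e by (intro ball xorw_words xw)
      finally show ?thesis .
    qed
    have tk: "{i \<in> {..<a}. view S (take a xs ! i) = view S u \<and> hdist (xorw (take a xs ! i) e) y \<le> t} =
       {i \<in> {..<a}. view S (xs ! i) = view S u \<and> hdist (xorw (xs ! i) e) y \<le> t}"
       "{i \<in> {..<a}. view S (take a xs ! i) = view S u} = {i \<in> {..<a}. view S (xs ! i) = view S u}" for a y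
      by auto
    have "(\<Sum>a<N. f a) / \<Lambda> = (\<Sum>a<N. score n t L \<Lambda> (Fut S u e) (take a xs) (xs ! a))"
      unfolding sum_divide_distrib
    proof (intro sum.cong refl)
      fix a assume a: "a \<in> {..<N}"
      then have aN: "a < N" by simp
      have "score n t L \<Lambda> (Fut S u e) (take a xs) (xs ! a) = min 1 (f a / \<Lambda>)"
        unfolding score.simps len[OF aN] tk f_def ..
      then show "f a / \<Lambda> = score n t L \<Lambda> (Fut S u e) (take a xs) (xs ! a)"
        using f\<Lambda>[OF aN] \<Lambda> by (simp add: min_def)
    qed
    also have "\<dots> \<le> \<kappa> + 2 * (\<Sum>a<N. mean n k t L \<Lambda> (Fut S u e) (take a xs))"
      using x'[OF c(3)] by (simp add: lam_def)
    also have "(\<Sum>a<N. mean n k t L \<Lambda> (Fut S u e) (take a xs)) \<le> (\<Sum>a<N. real K * \<Delta> * V / (2 ^ n * \<Lambda>))"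
    proof (intro sum_mono)
      fix a assume a: "a \<in> {..<N}"
      have "real (card {i \<in> {..<a}. view S (xs ! i) = view S u}) \<le> real (card {i \<in> {..<N}. view S (xs ! i) = view S u})"
        using a by (intro of_nat_mono card_mono) auto
      also have "\<dots> \<le> real K * \<Delta>" by (rule all[OF S u])
      finally show "mean n k t L \<Lambda> (Fut S u e) (take a xs) \<le> real K * \<Delta> * V / (2 ^ n * \<Lambda>)"
        unfolding mean.simps len[OF a[unfolded lessThan_iff]] tk V_def[symmetric] using V \<Lambda>
        by (intro divide_right_mono mult_right_mono) auto
    qed
    also have "\<dots> = \<epsilon> * (real K * \<Delta>) / \<Lambda>" by (simp add: \<epsilon>_def N_def V_def)
    finally have "(\<Sum>a<N. f a) / \<Lambda> \<le> \<kappa> + 2 * (\<epsilon> * (real K * \<Delta>) / \<Lambda>)" by simp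
    then have "(\<Sum>a<N. f a) / \<Lambda> * \<Lambda> \<le> (\<kappa> + 2 * (\<epsilon> * (real K * \<Delta>) / \<Lambda>)) * \<Lambda>"
      using \<Lambda> by (intro mult_right_mono) auto
    then have sf: "(\<Sum>a<N. f a) \<le> \<Lambda> * \<kappa> + 2 * \<epsilon> * (real K * \<Delta>)" using \<Lambda> by (simp add: algebra_simps)
    let ?r = "\<lambda>a. view S (xs ! a) = view S u \<and> (\<exists>b<N. a < b \<and> hdist (xorw (xs ! a) e) (xs ! b) \<le> t)"
    \<comment> \<open>A codeword with a later neighbour \<open>b\<close> is counted in
      \<open>f b\<close> for at least one \<open>b\<close>.\<close>
    have "real (card {a \<in> {..<N}. ?r a}) \<le> (\<Sum>b<N. f b)"
    proof -
      have "{a \<in> {..<N}. ?r a} \<subseteq> (\<Union>b\<in>{..<N}. {i \<in> {..<b}. view S (xs ! i) = view S u \<and> hdist (xorw (xs ! i) e) (xs ! b) \<le> t})"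
        by auto
      then have "card {a \<in> {..<N}. ?r a} \<le> (\<Sum>b<N. card {i \<in> {..<b}. view S (xs ! i) = view S u \<and> hdist (xorw (xs ! i) e) (xs ! b) \<le> t})"
        by (intro order_trans[OF card_mono card_UN_le]) auto
      then show ?thesis unfolding f_def of_nat_sum[symmetric] by (rule of_nat_mono)
    qed
    moreover have "real (card {a \<in> {..<N}. view S (xs ! a) = view S u \<and> (\<exists>b<N. b \<noteq> a \<and> hdist (xorw (xs ! a) e) (xs ! b) \<le> t)})
       \<le> real (card {a \<in> {..<N}. ?p a}) + real (card {a \<in> {..<N}. ?r a})"
    proof -
      have "{a \<in> {..<N}. view S (xs ! a) = view S u \<and> (\<exists>b<N. b \<noteq> a \<and> hdist (xorw (xs ! a) e) (xs ! b) \<le> t)}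
        \<subseteq> {a \<in> {..<N}. ?p a} \<union> {a \<in> {..<N}. ?r a}" by (auto simp: neq_iff)
      then show ?thesis
        unfolding of_nat_add[symmetric]
        by (intro of_nat_mono order_trans[OF card_mono card_Un_le]) auto
    qed
    ultimately show ?thesis using past sf by linarith
  qed
  show ?thesis
    by (rule that[of xs]) (use xs sec bad in \<open>simp_all add: N_def \<Lambda>_def\<close>)
qed

section \<open>The code of a codebook\<close>

text \<open>Codeword number \<open>a\<close> belongs to message \<open>a div L\<close>, and a message is encoded by one of its \<open>L\<close>
  codewords chosen uniformly.\<close>

definition book_enc :: "nat \<Rightarrow> bool list list \<Rightarrow> nat \<Rightarrow> bool list \<Rightarrow> real" where
  "book_enc L xs m x = real (card {a \<in> {..<length xs}. a div L = m \<and> xs ! a = x}) / real L"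

lemma exists_decoder:
  assumes K: "0 < K" and enc: "\<And>m. m < K \<Longrightarrow> is_dist (words n) (enc m)"
  shows "\<exists>dec. valid_code n K enc dec"
proof -
  let ?B = "codebook K enc"
  have "?B \<subseteq> words n"
    using enc unfolding codebook_def is_dist_def by (smt (verit) mem_Collect_eq subsetI)
  then have fin: "finite ?B" by (rule finite_subset) simp
  have ne: "?B \<noteq> {}"
  proof
    assume "?B = {}"
    then have "enc 0 x \<le> 0" for x using K by (auto simp: codebook_def not_less)
    then have "sum (enc 0) (words n) \<le> 0" by (intro sum_nonpos)
    then show False using enc[OF K] by (simp add: is_dist_def)
  qed
  have "\<exists>m. m < K \<and> (\<exists>x. enc m x > 0 \<and> (\<forall>x'\<in>?B. hdist x y \<le> hdist x' y))" for y
  proof -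
    obtain x where x: "x \<in> ?B" "\<forall>x'\<in>?B. hdist x y \<le> hdist x' y"
      using ex_min_if_finite[of "(\<lambda>x. hdist x y) ` ?B"] fin ne by (auto simp: not_less)
    then show ?thesis by (auto simp: codebook_def)
  qed
  then obtain dec where "\<And>y. dec y < K \<and> (\<exists>x. enc (dec y) x > 0 \<and> (\<forall>x'\<in>?B. hdist x y \<le> hdist x' y))"
    by metis
  then show ?thesis using K enc by (auto simp: valid_code_def intro!: exI[of _ dec])
qed

locale code_from_book =
  fixes n k t K L :: nat and xs :: "bool list list"
  assumes K: "0 < K" and L: "0 < L" and len: "length xs = K * L" and xs: "set xs \<subseteq> words n"
begin

abbreviation enc where "enc \<equiv> book_enc L xs"

lemma xs_words: "a < K * L \<Longrightarrow> xs ! a \<in> words n"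
  using xs len by (auto dest: nth_mem)

lemma enc_nonneg: "0 \<le> enc m x"
  by (simp add: book_enc_def)

lemma enc_outside: "x \<notin> words n \<Longrightarrow> enc m x = 0"
proof -
  assume x: "x \<notin> words n"
  have "{a \<in> {..<length xs}. a div L = m \<and> xs ! a = x} = {}" using x xs_words len by auto
  then show ?thesis unfolding book_enc_def by (simp only: card.empty)
qed

lemma sum_enc: "(\<Sum>x\<in>words n. enc m x * F x) = (\<Sum>a\<in>{a \<in> {..<K * L}. a div L = m}. F (xs ! a)) / real L"
proof -
  let ?A = "{a \<in> {..<K * L}. a div L = m}"
  have "(\<Sum>a\<in>?A. F (xs ! a)) = (\<Sum>x\<in>words n. \<Sum>a\<in>{a \<in> ?A. xs ! a = x}. F (xs ! a))"
    by (rule sum.group[symmetric]) (auto simp: xs_words)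
  also have "\<dots> = (\<Sum>x\<in>words n. real (card {a \<in> {..<length xs}. a div L = m \<and> xs ! a = x}) * F x)"
  proof (intro sum.cong refl)
    fix x
    have "{a \<in> {..<length xs}. a div L = m \<and> xs ! a = x} = {a \<in> ?A. xs ! a = x}" using len by auto
    then show "(\<Sum>a\<in>{a \<in> ?A. xs ! a = x}. F (xs ! a)) = real (card {a \<in> {..<length xs}. a div L = m \<and> xs ! a = x}) * F x"
      by simp
  qed
  finally show ?thesis by (simp add: book_enc_def sum_divide_distrib)
qed

lemma enc_dist: "m < K \<Longrightarrow> is_dist (words n) (enc m)"
  using sum_enc[of m "\<lambda>_. 1"] card_block[of m K L] L by (simp add: is_dist_def enc_nonneg enc_outside)

lemma sum_blocks: "(\<Sum>m<K. \<Sum>a\<in>{a \<in> {..<K * L}. a div L = m}. g m a) = (\<Sum>a<K * L. g (a div L) a)"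
proof -
  have "(\<Sum>a<K * L. g (a div L) a) = (\<Sum>m<K. \<Sum>a\<in>{a \<in> {..<K * L}. a div L = m}. g (a div L) a)"
    by (rule sum.group[symmetric]) (auto simp: less_mult_imp_div_less)
  also have "\<dots> = (\<Sum>m<K. \<Sum>a\<in>{a \<in> {..<K * L}. a div L = m}. g m a)"
    by (intro sum.cong refl) auto
  finally show ?thesis by simp
qed

text \<open>The nearest codeword is no farther from the received word than the sent one, so within
  \<open>t\<close>, and it carries a different message. Indices rather than words are compared, so a
  repeated word counts as its own neighbour.\<close>

lemma decoding_error_close:
  assumes code: "valid_code n K enc dec" and a: "a < K * L" and e: "e \<in> words n" "weight e \<le> t"
    and err: "dec (xorw (xs ! a) e) \<noteq> a div L"
  shows "\<exists>b<K * L. b \<noteq> a \<and> hdist (xorw (xs ! a) e) (xs ! b) \<le> t"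
proof -
  let ?y = "xorw (xs ! a) e"
  have y: "?y \<in> words n" using xs_words[OF a] e by (intro xorw_words)
  then obtain x where x: "enc (dec ?y) x > 0" "\<And>x'. x' \<in> codebook K enc \<Longrightarrow> hdist x ?y \<le> hdist x' ?y"
    using code by (auto simp: valid_code_def)
  have "{b \<in> {..<length xs}. b div L = dec ?y \<and> xs ! b = x} \<noteq> {}"
  proof
    assume "{b \<in> {..<length xs}. b div L = dec ?y \<and> xs ! b = x} = {}"
    then have "enc (dec ?y) x = 0" unfolding book_enc_def by (simp only: card.empty)
    then show False using x(1) by simp
  qed
  then obtain b where b: "b < K * L" "b div L = dec ?y" "xs ! b = x" using len by auto
  have "card {c \<in> {..<length xs}. c div L = a div L \<and> xs ! c = xs ! a} > 0"
    using a len by (subst card_gt_0_iff) auto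
  then have "xs ! a \<in> codebook K enc"
    using L a by (auto simp: codebook_def book_enc_def less_mult_imp_div_less intro!: exI[of _ "a div L"])
  then have "hdist x ?y \<le> hdist (xs ! a) ?y" by (rule x(2))
  also have "\<dots> = weight e" using xs_words[OF a] e by (simp add: hdist_def xorw_cancel words_def)
  also have "\<dots> \<le> t" by (rule e(2))
  finally have "hdist ?y (xs ! b) \<le> t" using b by (simp add: hdist_commute)
  moreover have "b \<noteq> a" using b err by auto
  ultimately show ?thesis using b by blast
qed

text \<open>Within the class of codewords sharing a view, the law of the error is fixed, so the
  expected number of spoiled codewords is at most \<open>\<beta>\<close>. Summing over the
  \<open>2 ^ k\<close> views and dividing by the number of codewords gives the bound.\<close>

lemma err_prob_le:
  assumes code: "valid_code n K enc dec" and adv: "valid_adv r \<rho> n q E"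
    and k: "k = nread r n" and t: "t = nat \<lfloor>\<rho> * real n\<rfloor>"
    and bad: "\<And>S u e. S \<in> rsets n k \<Longrightarrow> u \<in> words n \<Longrightarrow> e \<in> words n \<Longrightarrow>
       real (card {a \<in> {..<K * L}. view S (xs ! a) = view S u \<and>
         (\<exists>b<K * L. b \<noteq> a \<and> hdist (xorw (xs ! a) e) (xs ! b) \<le> t)}) \<le> \<beta>"
  shows "err_prob r n K enc dec q E \<le> \<beta> / (real (K * L) / 2 ^ k)"
proof -
  let ?N = "K * L"
  let ?bad = "\<lambda>a e. \<exists>b<?N. b \<noteq> a \<and> hdist (xorw (xs ! a) e) (xs ! b) \<le> t"
  let ?i = "\<lambda>m x e. if dec (xorw x e) \<noteq> m then 1 else 0 :: real"
  let ?R = "rsets n k"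
  have q: "is_dist ?R q" using adv by (simp add: valid_adv_def k)
  have E: "is_dist {e \<in> words n. real (weight e) \<le> \<rho> * real n} (E v)" for v
    using adv by (simp add: valid_adv_def)
  have E0: "0 \<le> E v e" for v e using E[of v] by (simp add: is_dist_def)
  have Esum: "(\<Sum>e\<in>words n. E v e) = 1" for v
  proof -
    have "(\<Sum>e\<in>words n. E v e) = sum (E v) {e \<in> words n. real (weight e) \<le> \<rho> * real n}"
      using E[of v] by (intro sum.mono_neutral_right) (auto simp: is_dist_def)
    then show ?thesis using E[of v] by (simp add: is_dist_def)
  qed
  define G where "G S m x = (\<Sum>e\<in>words n. E (view S x) e * ?i m x e)" for S m x
  have le: "G S (a div L) (xs ! a) \<le> (\<Sum>e\<in>words n. E (view S (xs ! a)) e * (if ?bad a e then 1 else 0))"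
    if a: "a < ?N" for S a
    unfolding G_def
  proof (rule sum_mono)
    fix e assume e: "e \<in> words n"
    show "E (view S (xs ! a)) e * ?i (a div L) (xs ! a) e \<le> E (view S (xs ! a)) e * (if ?bad a e then 1 else 0)"
    proof (cases "E (view S (xs ! a)) e = 0")
      case False
      then have "real (weight e) \<le> \<rho> * real n" using E[of "view S (xs ! a)"] by (auto simp: is_dist_def)
      then have "weight e \<le> t" unfolding t by linarith
      from decoding_error_close[OF code a e this]
      show ?thesis using E0 by (intro mult_left_mono) auto
    qed simp
  qed
  have cnt: "(\<Sum>a<?N. \<Sum>e\<in>words n. E (view S (xs ! a)) e * (if ?bad a e then 1 else 0)) \<le> 2 ^ k * \<beta>"
    if S: "S \<in> ?R" for S
  proof -
    let ?A = "\<lambda>v. {a \<in> {..<?N}. view S (xs ! a) = v}"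
    have "(\<Sum>a<?N. \<Sum>e\<in>words n. E (view S (xs ! a)) e * (if ?bad a e then 1 else 0)) =
      (\<Sum>v\<in>view S ` words n. \<Sum>a\<in>?A v. \<Sum>e\<in>words n. E (view S (xs ! a)) e * (if ?bad a e then 1 else 0))"
      by (rule sum.group[symmetric]) (auto simp: xs_words)
    also have "\<dots> \<le> (\<Sum>v\<in>view S ` words n. \<beta>)"
    proof (rule sum_mono)
      fix v assume "v \<in> view S ` words n"
      then obtain u where u: "u \<in> words n" "v = view S u" by blast
      have "(\<Sum>a\<in>?A v. \<Sum>e\<in>words n. E (view S (xs ! a)) e * (if ?bad a e then 1 else 0)) =
        (\<Sum>a\<in>?A v. \<Sum>e\<in>words n. E v e * (if ?bad a e then 1 else 0))"
        by (intro sum.cong refl) simp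
      also have "\<dots> = (\<Sum>e\<in>words n. E v e * (\<Sum>a\<in>?A v. if ?bad a e then 1 else 0))"
        unfolding sum_distrib_left by (rule sum.swap)
      also have "\<dots> \<le> (\<Sum>e\<in>words n. E v e * \<beta>)"
      proof (intro sum_mono mult_left_mono E0)
        fix e assume e: "e \<in> words n"
        have "(\<Sum>a\<in>?A v. if ?bad a e then 1 else 0) = real (card {a \<in> ?A v. ?bad a e})"
          by (rule sum_indicator) simp
        also have "{a \<in> ?A v. ?bad a e} = {a \<in> {..<?N}. view S (xs ! a) = view S u \<and> ?bad a e}"
          using u by auto
        finally show "(\<Sum>a\<in>?A v. if ?bad a e then 1 else 0) \<le> \<beta>" using bad[OF S u(1) e] by (simp only:)
      qed
      also have "\<dots> = \<beta>" by (simp add: sum_distrib_right[symmetric] Esum)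
      finally show "(\<Sum>a\<in>?A v. \<Sum>e\<in>words n. E (view S (xs ! a)) e * (if ?bad a e then 1 else 0)) \<le> \<beta>" .
    qed
    also have "\<dots> = 2 ^ k * \<beta>" by (simp add: card_views[OF S])
    finally show ?thesis .
  qed
  have "err_prob r n K enc dec q E = (\<Sum>S\<in>?R. q S * (\<Sum>m<K. (\<Sum>x\<in>words n. enc m x * G S m x)) / real K)"
  proof -
    have "err_prob r n K enc dec q E = (\<Sum>m<K. \<Sum>S\<in>?R. \<Sum>x\<in>words n. q S * (enc m x * G S m x) / real K)"
      unfolding err_prob_def k[symmetric] G_def
      by (intro sum.cong refl) (simp add: sum_distrib_left sum_divide_distrib mult.assoc)
    also have "\<dots> = (\<Sum>S\<in>?R. \<Sum>m<K. \<Sum>x\<in>words n. q S * (enc m x * G S m x) / real K)" by (rule sum.swap)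
    finally show ?thesis by (simp add: sum_distrib_left sum_divide_distrib)
  qed
  also have "\<dots> \<le> (\<Sum>S\<in>?R. q S * (\<beta> / (real ?N / 2 ^ k)))"
  proof (rule sum_mono)
    fix S assume S: "S \<in> ?R"
    have "(\<Sum>m<K. (\<Sum>x\<in>words n. enc m x * G S m x)) = (\<Sum>a<?N. G S (a div L) (xs ! a)) / real L"
      unfolding sum_enc sum_divide_distrib[symmetric] sum_blocks[of "\<lambda>m a. G S m (xs ! a)"] ..
    also have "\<dots> \<le> (2 ^ k * \<beta>) / real L"
    proof (intro divide_right_mono)
      have "(\<Sum>a<?N. G S (a div L) (xs ! a)) \<le> (\<Sum>a<?N. \<Sum>e\<in>words n. E (view S (xs ! a)) e * (if ?bad a e then 1 else 0))"
        by (intro sum_mono le) simp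
      then show "(\<Sum>a<?N. G S (a div L) (xs ! a)) \<le> 2 ^ k * \<beta>" using cnt[OF S] by (rule order_trans)
    qed simp
    finally have "(\<Sum>m<K. (\<Sum>x\<in>words n. enc m x * G S m x)) / real K \<le> (2 ^ k * \<beta>) / real L / real K"
      by (intro divide_right_mono) auto
    also have "\<dots> = \<beta> / (real ?N / 2 ^ k)" by (simp add: mult.commute)
    finally have h: "(\<Sum>m<K. (\<Sum>x\<in>words n. enc m x * G S m x)) / real K \<le> \<beta> / (real ?N / 2 ^ k)" .
    have "q S * (\<Sum>m<K. (\<Sum>x\<in>words n. enc m x * G S m x)) / real K = q S * ((\<Sum>m<K. (\<Sum>x\<in>words n. enc m x * G S m x)) / real K)"
      by simp
    also have "\<dots> \<le> q S * (\<beta> / (real ?N / 2 ^ k))"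
      by (rule mult_left_mono[OF h]) (use q in \<open>simp add: is_dist_def\<close>)
    finally show "q S * (\<Sum>m<K. (\<Sum>x\<in>words n. enc m x * G S m x)) / real K \<le> q S * (\<beta> / (real ?N / 2 ^ k))" .
  qed
  also have "\<dots> = \<beta> / (real ?N / 2 ^ k)"
    using q unfolding sum_distrib_right[symmetric] by (simp only: is_dist_def mult_1)
  finally show ?thesis .
qed

text \<open>A one-sided bound on the view probabilities suffices, and as it holds for each message
  separately, the estimate is uniform in \<open>PS\<close>.\<close>

lemma mutual_info_le:
  assumes S: "S \<in> rsets n k" and PS: "is_dist {..<K} PS"
    and sec: "\<And>m u. m < K \<Longrightarrow> u \<in> words n \<Longrightarrow>
       real (card {a \<in> {..<K * L}. a div L = m \<and> view S (xs ! a) = view S u}) \<le> \<Delta>"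
    and \<Delta>: "0 < \<Delta>"
  shows "mutual_info PS n K enc S \<le> log 2 (\<Delta> / (real L / 2 ^ k))"
proof -
  let ?V = "view S ` words n"
  define p where "p m v = view_mass n (enc m) S v" for m v
  have p0: "0 \<le> p m v" for m v
    unfolding p_def view_mass_def by (intro sum_nonneg enc_nonneg)
  have p_le: "p m v \<le> \<Delta> / real L" if m: "m < K" and v: "v \<in> ?V" for m v
  proof -
    obtain u where u: "u \<in> words n" "v = view S u" using v by blast
    have "p m v = (\<Sum>x\<in>words n. enc m x * (if view S x = v then 1 else 0))"
      by (simp add: p_def view_mass_def sum.inter_filter) (intro sum.cong refl, simp)
    also have "\<dots> = (\<Sum>a\<in>{a \<in> {..<K * L}. a div L = m}. if view S (xs ! a) = v then 1 else 0) / real L"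
      by (rule sum_enc)
    also have "(\<Sum>a\<in>{a \<in> {..<K * L}. a div L = m}. if view S (xs ! a) = v then 1 else 0) =
       real (card {a \<in> {a \<in> {..<K * L}. a div L = m}. view S (xs ! a) = v})"
      by (rule sum_indicator) simp
    also have "{a \<in> {a \<in> {..<K * L}. a div L = m}. view S (xs ! a) = v} = {a \<in> {..<K * L}. a div L = m \<and> view S (xs ! a) = view S u}"
      using u by auto
    finally show ?thesis using sec[OF m u(1)] by (simp add: divide_right_mono)
  qed
  have psum: "(\<Sum>v\<in>?V. p m v) = 1" if "m < K" for m
    unfolding p_def sum_view_mass using enc_dist[OF that] by (simp add: is_dist_def)
  have PS0: "0 \<le> PS m" for m using PS by (simp add: is_dist_def)
  have PS1: "(\<Sum>m<K. PS m) = 1" using PS by (simp add: is_dist_def)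
  have j: "joint PS n enc S m v = PS m * p m v" for m v
    by (simp add: joint_def p_def view_mass_def)
  define P where "P v = (\<Sum>m<K. PS m * p m v)" for v
  have Pv: "pview PS n K enc S v = P v" for v by (simp add: pview_def j P_def)
  have P0: "0 \<le> P v" for v unfolding P_def by (intro sum_nonneg mult_nonneg_nonneg PS0 p0)
  have jsum: "(\<Sum>m<K. \<Sum>v\<in>?V. PS m * p m v) = 1"
    using PS1 psum by (simp add: sum_distrib_left[symmetric])
  \<comment> \<open>The uniform law on the \<open>2 ^ k\<close> views is inserted. The first ratio
    is at most \<open>\<Delta>\<close> over its ideal value \<open>L / 2 ^ k\<close>; the second
    part sums to minus the divergence of \<open>P\<close> from uniform, which is
    nonpositive.\<close>
  have pt: "PS m * p m v * log 2 (PS m * p m v / (PS m * P v)) \<le>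
      PS m * p m v * log 2 (\<Delta> / (real L / 2 ^ k)) + PS m * p m v * log 2 ((1 / 2 ^ k) / P v)"
    if m: "m < K" and v: "v \<in> ?V" for m v
  proof (cases "PS m * p m v = 0")
    case False
    then have pos: "0 < PS m" "0 < p m v" using PS0[of m] p0[of m v] by auto
    have "PS m * p m v \<le> P v" unfolding P_def using m by (intro member_le_sum) (auto simp: PS0 p0)
    then have "0 < P v" using pos by (smt (verit) mult_pos_pos)
    have "log 2 (PS m * p m v / (PS m * P v)) = log 2 (p m v / (1 / 2 ^ k)) + log 2 ((1 / 2 ^ k) / P v)"
      using pos \<open>0 < P v\<close> by (subst log_mult_pos[symmetric]) auto
    also have "log 2 (p m v / (1 / 2 ^ k)) \<le> log 2 (\<Delta> / (real L / 2 ^ k))"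
      using pos p_le[OF m v] \<Delta> L by (subst log_le_cancel_iff) (auto simp: field_simps)
    finally have "PS m * p m v * log 2 (PS m * p m v / (PS m * P v)) \<le>
       PS m * p m v * (log 2 (\<Delta> / (real L / 2 ^ k)) + log 2 ((1 / 2 ^ k) / P v))"
      using pos by (intro mult_left_mono) auto
    then show ?thesis by (simp add: distrib_left)
  qed auto
  have "mutual_info PS n K enc S = (\<Sum>m<K. \<Sum>v\<in>?V. PS m * p m v * log 2 (PS m * p m v / (PS m * P v)))"
    by (simp add: mutual_info_def j Pv)
  also have "\<dots> \<le> (\<Sum>m<K. \<Sum>v\<in>?V. PS m * p m v * log 2 (\<Delta> / (real L / 2 ^ k)) + PS m * p m v * log 2 ((1 / 2 ^ k) / P v))"
    by (intro sum_mono pt) auto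
  also have "\<dots> = log 2 (\<Delta> / (real L / 2 ^ k)) + (\<Sum>m<K. \<Sum>v\<in>?V. PS m * p m v * log 2 ((1 / 2 ^ k) / P v))"
    unfolding sum.distrib sum_distrib_right[symmetric] jsum by simp
  also have "(\<Sum>m<K. \<Sum>v\<in>?V. PS m * p m v * log 2 ((1 / 2 ^ k) / P v)) = (\<Sum>v\<in>?V. P v * log 2 ((1 / 2 ^ k) / P v))"
    unfolding P_def sum_distrib_right by (rule sum.swap)
  also have "\<dots> \<le> sum P ?V * log 2 ((\<Sum>v\<in>?V. 1 / 2 ^ k) / sum P ?V)"
    by (intro log_sum_inequality) (auto simp: P0)
  also have "sum P ?V = 1" unfolding P_def by (subst sum.swap) (rule jsum)
  also have "(\<Sum>v\<in>?V. 1 / 2 ^ k) = (1::real)" by (simp add: card_views[OF S])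
  finally show ?thesis by simp
qed

end

section \<open>Exponential estimates and achievable rates\<close>

lemma ball_volume_le:
  assumes \<rho>: "0 < \<rho>" "\<rho> < 1/2"
  shows "real (ball_volume n (nat \<lfloor>\<rho> * real n\<rfloor>)) \<le> 2 powr (real n * bin_entropy \<rho>)"
proof -
  let ?t = "nat \<lfloor>\<rho> * real n\<rfloor>"
  have nz: "noise \<rho> e = \<rho> ^ weight e * (1 - \<rho>) ^ (length e - weight e)" and wl: "weight e \<le> length e" for e
  proof -
    have "noise \<rho> e = \<rho> ^ weight e * (1 - \<rho>) ^ (length e - weight e) \<and> weight e \<le> length e"
      by (induction e) (auto simp: Suc_diff_le)
    then show "noise \<rho> e = \<rho> ^ weight e * (1 - \<rho>) ^ (length e - weight e)" "weight e \<le> length e" by auto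
  qed
  \<comment> \<open>Since \<open>\<rho> < 1/2\<close>, the i.i.d. probability of a word decreases
    with its weight and equals the left-hand side at weight \<open>\<rho> * n\<close>. The total
    probability 1 then bounds the number of words in the ball.\<close>
  have "2 powr (- (real n * bin_entropy \<rho>)) \<le> noise \<rho> e" if e: "e \<in> words n" "weight e \<le> ?t" for e
  proof -
    have "0 \<le> \<rho> * real n" using \<rho> by simp
    then have w: "real (weight e) \<le> \<rho> * real n" using e(2) by linarith
    have n: "length e = n" using e by (simp add: words_def)
    have "log 2 \<rho> \<le> log 2 (1 - \<rho>)" using \<rho> by (subst log_le_cancel_iff) auto
    then have "0 \<le> (\<rho> * real n - real (weight e)) * (log 2 (1 - \<rho>) - log 2 \<rho>)"
      using w by (intro mult_nonneg_nonneg) auto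
    then have "- (real n * bin_entropy \<rho>) \<le> real (weight e) * log 2 \<rho> + (real n - real (weight e)) * log 2 (1 - \<rho>)"
      by (simp add: bin_entropy_def algebra_simps)
    then have "2 powr (- (real n * bin_entropy \<rho>)) \<le> 2 powr (real (weight e) * log 2 \<rho> + (real n - real (weight e)) * log 2 (1 - \<rho>))"
      by simp
    also have "\<dots> = (2 powr log 2 \<rho>) powr real (weight e) * (2 powr log 2 (1 - \<rho>)) powr real (n - weight e)"
      using wl[of e] n by (simp add: powr_add powr_powr mult.commute of_nat_diff)
    also have "\<dots> = noise \<rho> e"
      using \<rho> by (simp add: nz n powr_realpow)
    finally show ?thesis .
  qed
  then have "(\<Sum>e\<in>{e \<in> words n. weight e \<le> ?t}. 2 powr (- (real n * bin_entropy \<rho>))) \<le> (\<Sum>e\<in>{e \<in> words n. weight e \<le> ?t}. noise \<rho> e)"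
    by (intro sum_mono) auto
  also have "\<dots> \<le> (\<Sum>e\<in>words n. noise \<rho> e)"
    using \<rho> by (intro sum_mono2 noise_nonneg) auto
  finally have "real (ball_volume n ?t) * 2 powr (- (real n * bin_entropy \<rho>)) \<le> 1"
    by (simp add: sum_noise ball_volume_def)
  then show ?thesis by (simp add: powr_minus field_simps)
qed

lemma err_prob_nonneg:
  assumes "\<And>m. m < K \<Longrightarrow> is_dist (words n) (enc m)" "valid_adv r \<rho> n q E"
  shows "0 \<le> err_prob r n K enc dec q E"
  unfolding err_prob_def using assms
  by (intro sum_nonneg mult_nonneg_nonneg) (auto simp: is_dist_def valid_adv_def)

text \<open>With \<open>g\<close> the slack in the rate, \<open>c\<close> is chosen so that
  \<open>2 powr (g / 2 * n) = exp (4 * c * n)\<close>. The quantity \<open>d\<close> collects the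
  two deviations of \<open>\<Delta> / A\<close> from 1: the fluctuation term
  \<open>\<kappa> / (\<mu> * A)\<close> and the precision \<open>\<mu>\<close>.\<close>

lemma code_at_length:
  fixes r \<rho> R :: real and n :: nat
  assumes r: "0 < r" "r < 1" and \<rho>: "0 < \<rho>" "\<rho> < 1/2" and R: "0 < R" "R < 1 - bin_entropy \<rho> - r"
  defines "c \<equiv> (1 - bin_entropy \<rho> - r - R) * ln 2 / 8" and "\<kappa> \<equiv> real (n + 1) * ln 8"
    and "K \<equiv> 2 ^ nat \<lfloor>R * real n\<rfloor>"
  defines "d \<equiv> 2 * \<kappa> * exp (- 3 * c * real n) + exp (- c * real n)"
  shows "\<exists>enc dec. valid_code n K enc dec \<and>
    (\<forall>q E. valid_adv r \<rho> n q E \<longrightarrow>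
       err_prob r n K enc dec q E \<le> (5 * \<kappa> + \<kappa>\<^sup>2) * (2 * exp (- 4 * c * real n)) + exp (- 4 * c * real n) * (6 + 2 * d)) \<and>
    (\<forall>PS S. is_dist {..<K} PS \<and> S \<in> rsets n (nread r n) \<longrightarrow> mutual_info PS n K enc S \<le> d / ln 2)"
proof -
  define g where "g = 1 - bin_entropy \<rho> - r - R"
  have g: "g > 0" using R by (simp add: g_def)
  have c: "c = g * ln 2 / 8" by (simp add: c_def g_def)
  have c0: "c > 0" using g by (simp add: c)
  \<comment> \<open>Half of the slack gives each message exponentially many codewords per view; the
    other half keeps the mean number of codewords in a ball exponentially small.\<close>
  define L :: nat where "L = 2 ^ nat \<lfloor>(r + g / 2) * real n\<rfloor>"
  define k where "k = nread r n"
  define t where "t = nat \<lfloor>\<rho> * real n\<rfloor>"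
  \<comment> \<open>Small enough for an exponentially small leak, yet large enough that
    \<open>\<kappa> / \<mu>\<close> stays far below \<open>A\<close>.\<close>
  define \<mu> where "\<mu> = exp (- c * real n)"
  have \<mu>: "0 < \<mu>" "\<mu> \<le> 1" using c0 by (auto simp: \<mu>_def)
  have h0: "0 \<le> bin_entropy \<rho>" using \<rho> by (simp add: bin_entropy_nonneg)
  have ep: "2 powr x = exp (x * ln 2)" for x :: real by (simp add: powr_def)
  have up: "real (2 ^ nat \<lfloor>x * real n\<rfloor>) \<le> 2 powr (x * real n)" if "0 < x" for x
  proof -
    have "0 \<le> x * real n" using that by simp
    then have "real (nat \<lfloor>x * real n\<rfloor>) \<le> x * real n" by linarith
    then have "2 powr real (nat \<lfloor>x * real n\<rfloor>) \<le> 2 powr (x * real n)" by simp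
    then show ?thesis by (simp add: powr_realpow)
  qed
  have lo: "2 powr (x * real n - 1) \<le> real (2 ^ nat \<lfloor>x * real n\<rfloor>)" if "0 < x" for x
  proof -
    have "x * real n - 1 \<le> real (nat \<lfloor>x * real n\<rfloor>)" by linarith
    then have "2 powr (x * real n - 1) \<le> 2 powr real (nat \<lfloor>x * real n\<rfloor>)" by simp
    then show ?thesis by (simp add: powr_realpow)
  qed
  have K1: "1 \<le> K" by (simp add: K_def)
  have L1: "1 \<le> L" by (simp add: L_def)
  have Kn: "K \<le> 2 ^ n"
  proof -
    have "R * real n \<le> 1 * real n" using R r h0 by (intro mult_right_mono) auto
    then have "nat \<lfloor>R * real n\<rfloor> \<le> n" by linarith
    then show ?thesis by (simp add: K_def)
  qed
  define A where "A = real L / 2 ^ k"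
  \<comment> \<open>The factor 2 pays for rounding down the exponent of \<open>L\<close>.\<close>
  have A: "exp (4 * c * real n) / 2 \<le> A"
  proof -
    have "(2::real) ^ k \<le> 2 powr (r * real n)" using up[OF r(1)] by (simp add: k_def nread_def)
    moreover have "2 powr ((r + g / 2) * real n - 1) \<le> real L" unfolding L_def using r g by (intro lo) simp
    ultimately have "2 powr ((r + g / 2) * real n - 1) / 2 powr (r * real n) \<le> A"
      unfolding A_def by (intro frac_le) auto
    also have "2 powr ((r + g / 2) * real n - 1) / 2 powr (r * real n) = 2 powr (g / 2 * real n - 1)"
      by (simp add: powr_diff[symmetric] algebra_simps)
    also have "\<dots> = 2 powr (g / 2 * real n) / 2" by (simp add: powr_diff)
    also have "2 powr (g / 2 * real n) = exp (4 * c * real n)" by (simp add: ep c)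
    finally show ?thesis .
  qed
  have A0: "0 < A" using L1 by (simp add: A_def)
  have iA: "1 / A \<le> 2 * exp (- 4 * c * real n)"
  proof -
    have "1 / A \<le> 1 / (exp (4 * c * real n) / 2)" using A by (intro divide_left_mono) (auto simp: A0)
    then show ?thesis by (simp add: exp_minus field_simps)
  qed
  define \<epsilon> where "\<epsilon> = real (K * L) * real (ball_volume n t) / 2 ^ n"
  have \<epsilon>0: "0 \<le> \<epsilon>" by (simp add: \<epsilon>_def)
  have \<epsilon>: "\<epsilon> \<le> exp (- 4 * c * real n)"
  proof -
    have "real K \<le> 2 powr (R * real n)" unfolding K_def by (rule up[OF R(1)])
    moreover have "real L \<le> 2 powr ((r + g / 2) * real n)" unfolding L_def using r g by (intro up) simp
    moreover have "real (ball_volume n t) \<le> 2 powr (real n * bin_entropy \<rho>)" unfolding t_def by (rule ball_volume_le[OF \<rho>])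
    ultimately have "real K * real L * real (ball_volume n t) \<le> 2 powr (R * real n) * 2 powr ((r + g / 2) * real n) * 2 powr (real n * bin_entropy \<rho>)"
      by (intro mult_mono) auto
    then have "\<epsilon> \<le> 2 powr (R * real n) * 2 powr ((r + g / 2) * real n) * 2 powr (real n * bin_entropy \<rho>) / 2 powr (real n)"
      unfolding \<epsilon>_def powr_realpow[OF zero_less_numeral] of_nat_mult by (intro divide_right_mono) auto
    also have "\<dots> = 2 powr (- (g / 2) * real n)"
      unfolding powr_add[symmetric] powr_diff[symmetric] by (rule arg_cong[where f = "\<lambda>x. 2 powr x"]) (simp add: g_def algebra_simps)
    also have "\<dots> = exp (- 4 * c * real n)" by (simp add: ep c)
    finally show ?thesis .
  qed
  have \<epsilon>1: "\<epsilon> \<le> 1" using \<epsilon> c0 by (smt (verit) exp_le_one_iff mult_nonneg_nonneg of_nat_0_le_iff mult_minus_left)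
  have \<kappa>: "\<kappa> > 0" by (simp add: \<kappa>_def)
  define \<Delta> where "\<Delta> = \<kappa> / \<mu> + (1 + \<mu>) * A"
  have \<Delta>0: "0 < \<Delta>" using \<kappa> \<mu> A0 by (simp add: \<Delta>_def add_pos_pos)
  have d0: "0 \<le> d" using \<kappa> by (simp add: d_def)
  have \<Delta>A: "\<Delta> / A \<le> 1 + d"
  proof -
    have "\<Delta> / A = \<kappa> / \<mu> * (1 / A) + (1 + \<mu>)" using A0 by (simp add: \<Delta>_def add_divide_distrib)
    also have "\<kappa> / \<mu> * (1 / A) \<le> \<kappa> / \<mu> * (2 * exp (- 4 * c * real n))"
      using iA \<kappa> \<mu> by (intro mult_left_mono) auto
    also have "\<dots> = 2 * \<kappa> * (exp (- 4 * c * real n) / exp (- c * real n))" by (simp add: \<mu>_def)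
    also have "exp (- 4 * c * real n) / exp (- c * real n) = exp (- 3 * c * real n)"
      by (simp add: exp_diff[symmetric])
    finally show ?thesis by (simp add: d_def \<mu>_def)
  qed
  have K0: "0 < K" and L0: "0 < L" using K1 L1 by auto
  obtain xs where xs: "length xs = K * L" "set xs \<subseteq> words n"
    and sec: "\<And>m S u. m < K \<Longrightarrow> S \<in> rsets n k \<Longrightarrow> u \<in> words n \<Longrightarrow>
       real (card {a \<in> {..<K * L}. a div L = m \<and> view S (xs ! a) = view S u}) \<le> \<Delta>"
    and bad: "\<And>S u e. S \<in> rsets n k \<Longrightarrow> u \<in> words n \<Longrightarrow> e \<in> words n \<Longrightarrow>
       real (card {a \<in> {..<K * L}. view S (xs ! a) = view S u \<and>
         (\<exists>b<K * L. b \<noteq> a \<and> hdist (xorw (xs ! a) e) (xs ! b) \<le> t)})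
       \<le> \<kappa> + 2 * \<epsilon> * (\<kappa> + 2 * (real (K * L) / 2 ^ k)) + (\<kappa> + 2 * \<epsilon>) * \<kappa> + 2 * \<epsilon> * (real K * \<Delta>)"
    using good_codebook[OF K0 Kn L0 \<mu>, of k t] unfolding \<Delta>_def A_def \<epsilon>_def \<kappa>_def by blast
  interpret B: code_from_book n k t K L xs
    by unfold_locales (use K0 L0 xs in auto)
  have "\<exists>dec. valid_code n K B.enc dec" by (rule exists_decoder[OF K0]) (rule B.enc_dist)
  then obtain dec where dec: "valid_code n K B.enc dec" ..
  define \<beta> where "\<beta> = \<kappa> + 2 * \<epsilon> * (\<kappa> + 2 * (real (K * L) / 2 ^ k)) + (\<kappa> + 2 * \<epsilon>) * \<kappa> + 2 * \<epsilon> * (real K * \<Delta>)"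
  have KA: "real (K * L) / 2 ^ k = real K * A" by (simp add: A_def)
  have \<beta>: "\<beta> / (real (K * L) / 2 ^ k) \<le> (5 * \<kappa> + \<kappa>\<^sup>2) * (2 * exp (- 4 * c * real n)) + exp (- 4 * c * real n) * (6 + 2 * d)"
  proof -
    have M: "0 < real K * A" using K0 A0 by simp
    have "\<epsilon> * \<kappa> \<le> 1 * \<kappa>" using \<epsilon>1 \<kappa> by (intro mult_right_mono) auto
    \<comment> \<open>One \<open>\<kappa>\<close> stands alone, and each of the two terms
      \<open>2 * \<epsilon> * \<kappa>\<close> is at most \<open>2 * \<kappa>\<close>.\<close>
    then have "\<beta> \<le> (5 * \<kappa> + \<kappa>\<^sup>2) + 4 * \<epsilon> * (real K * A) + 2 * \<epsilon> * (real K * \<Delta>)"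
      unfolding \<beta>_def KA by (simp add: algebra_simps power2_eq_square)
    then have "\<beta> / (real K * A) \<le> ((5 * \<kappa> + \<kappa>\<^sup>2) + 4 * \<epsilon> * (real K * A) + 2 * \<epsilon> * (real K * \<Delta>)) / (real K * A)"
      using M by (intro divide_right_mono) auto
    also have "\<dots> = (5 * \<kappa> + \<kappa>\<^sup>2) * (1 / (real K * A)) + \<epsilon> * (4 + 2 * (\<Delta> / A))"
      using K0 A0 by (simp add: field_simps)
    also have "\<dots> \<le> (5 * \<kappa> + \<kappa>\<^sup>2) * (2 * exp (- 4 * c * real n)) + exp (- 4 * c * real n) * (6 + 2 * d)"
    proof (rule add_mono; rule mult_mono)
      have "1 / (real K * A) \<le> 1 / A" using K1 A0 by (intro divide_left_mono) auto
      then show "1 / (real K * A) \<le> 2 * exp (- 4 * c * real n)" using iA by linarith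
      show "4 + 2 * (\<Delta> / A) \<le> 6 + 2 * d" using \<Delta>A by simp
    qed (use \<kappa> \<epsilon> A0 \<Delta>0 in auto)
    finally show ?thesis unfolding KA .
  qed
  have "err_prob r n K B.enc dec q E \<le> (5 * \<kappa> + \<kappa>\<^sup>2) * (2 * exp (- 4 * c * real n)) + exp (- 4 * c * real n) * (6 + 2 * d)"
    if "valid_adv r \<rho> n q E" for q E
    using B.err_prob_le[OF dec that k_def t_def bad] \<beta> unfolding \<beta>_def by linarith
  moreover have "mutual_info PS n K B.enc S \<le> d / ln 2" if "is_dist {..<K} PS" "S \<in> rsets n (nread r n)" for PS S
  proof -
    have S: "S \<in> rsets n k" using that by (simp add: k_def)
    have "mutual_info PS n K B.enc S \<le> log 2 (\<Delta> / (real L / 2 ^ k))"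
      using S by (intro B.mutual_info_le sec that \<Delta>0) auto
    also have "\<dots> = log 2 (\<Delta> / A)" by (simp add: A_def)
    also have "\<dots> \<le> log 2 (1 + d)" using \<Delta>A \<Delta>0 A0 d0 by (subst log_le_cancel_iff) auto
    also have "\<dots> \<le> d / ln 2" using ln_add_one_self_le_self[OF d0] by (simp add: log_def divide_right_mono)
    finally show ?thesis .
  qed
  ultimately show ?thesis using dec by blast
qed

lemma sem_capacity_ge:
  fixes r \<rho> R :: real
  assumes r: "0 < r" "r < 1" and \<rho>: "0 < \<rho>" "\<rho> < 1/2" and R: "0 < R" "R < 1 - bin_entropy \<rho> - r"
  shows "ereal R \<le> sem_capacity r \<rho>"
proof -
  define c where "c = (1 - bin_entropy \<rho> - r - R) * ln 2 / 8"
  have c: "c > 0" using R by (simp add: c_def)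
  define \<kappa> where "\<kappa> n = real (n + 1) * ln 8" for n
  define d where "d n = 2 * \<kappa> n * exp (- 3 * c * real n) + exp (- c * real n)" for n
  define K :: "nat \<Rightarrow> nat" where "K n = 2 ^ nat \<lfloor>R * real n\<rfloor>" for n
  define \<eta> where "\<eta> n = (5 * \<kappa> n + (\<kappa> n)\<^sup>2) * (2 * exp (- 4 * c * real n)) + exp (- 4 * c * real n) * (6 + 2 * d n)" for n
  have "\<forall>n. \<exists>enc dec. valid_code n (K n) enc dec \<and>
      (\<forall>q E. valid_adv r \<rho> n q E \<longrightarrow> err_prob r n (K n) enc dec q E \<le> \<eta> n) \<and>
      (\<forall>PS S. is_dist {..<K n} PS \<and> S \<in> rsets n (nread r n) \<longrightarrow> mutual_info PS n (K n) enc S \<le> d n / ln 2)"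
    unfolding \<eta>_def d_def \<kappa>_def K_def c_def using code_at_length[OF r \<rho> R] by blast
  then obtain enc dec where code: "\<And>n. valid_code n (K n) (enc n) (dec n)"
    and err: "\<And>n q E. valid_adv r \<rho> n q E \<Longrightarrow> err_prob r n (K n) (enc n) (dec n) q E \<le> \<eta> n"
    and mi: "\<And>n PS S. is_dist {..<K n} PS \<Longrightarrow> S \<in> rsets n (nread r n) \<Longrightarrow> mutual_info PS n (K n) (enc n) S \<le> d n / ln 2"
    by metis
  have "\<eta> \<longlonglongrightarrow> 0"
    unfolding \<eta>_def[abs_def] d_def \<kappa>_def using c by real_asymp
  have rel: "reliable r \<rho> K enc dec"
    unfolding reliable_def
  proof (intro allI impI)
    fix q E assume adv: "\<forall>n. valid_adv r \<rho> n (q n) (E n)"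
    show "(\<lambda>n. err_prob r n (K n) (enc n) (dec n) (q n) (E n)) \<longlonglongrightarrow> 0"
    proof (rule tendsto_sandwich[OF _ _ tendsto_const \<open>\<eta> \<longlonglongrightarrow> 0\<close>])
      have "0 \<le> err_prob r n (K n) (enc n) (dec n) (q n) (E n)" for n
        using code[of n] adv by (intro err_prob_nonneg) (auto simp: valid_code_def)
      then show "\<forall>\<^sub>F n in sequentially. 0 \<le> err_prob r n (K n) (enc n) (dec n) (q n) (E n)" by simp
      show "\<forall>\<^sub>F n in sequentially. err_prob r n (K n) (enc n) (dec n) (q n) (E n) \<le> \<eta> n"
        using err adv by simp
    qed
  qed
  \<comment> \<open>Halving the exponent absorbs the constant \<open>1 / ln 2\<close> and the factor
    linear in \<open>n\<close>.\<close>
  have "\<forall>\<^sub>F n in sequentially. d n / ln 2 \<le> exp (- (c / 2) * real n)"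
    unfolding d_def \<kappa>_def using c by real_asymp
  then have sec: "semantic_secret r K enc"
    unfolding semantic_secret_def using c
    by (intro exI[of _ "c / 2"] conjI) (auto elim!: eventually_mono intro: order_trans[OF mi])
  have "(\<lambda>n. real (nat \<lfloor>R * real n\<rfloor>) / real n) \<longlonglongrightarrow> R"
  proof (rule tendsto_sandwich)
    show "(\<lambda>n. R - 1 / real n) \<longlonglongrightarrow> R" "(\<lambda>n. R) \<longlonglongrightarrow> R" by real_asymp+
    show "\<forall>\<^sub>F n in sequentially. R - 1 / real n \<le> real (nat \<lfloor>R * real n\<rfloor>) / real n"
      using eventually_gt_at_top[of 0]
    proof eventually_elim
      case (elim n)
      have "R * real n - 1 \<le> real (nat \<lfloor>R * real n\<rfloor>)" by linarith
      then have "(R * real n - 1) / real n \<le> real (nat \<lfloor>R * real n\<rfloor>) / real n" by (intro divide_right_mono) auto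
      then show ?case using elim by (simp add: diff_divide_distrib)
    qed
    show "\<forall>\<^sub>F n in sequentially. real (nat \<lfloor>R * real n\<rfloor>) / real n \<le> R"
      using eventually_gt_at_top[of 0]
    proof eventually_elim
      case (elim n)
      have "0 \<le> R * real n" using R by simp
      then have "real (nat \<lfloor>R * real n\<rfloor>) \<le> R * real n" by linarith
      then show ?case using elim by (simp add: divide_le_eq)
    qed
  qed
  then have "(\<lambda>n. ereal (log 2 (real (K n)) / real n)) \<longlonglongrightarrow> ereal R"
    by (simp add: K_def)
  then have "family_rate K = ereal R"
    unfolding family_rate_def by (intro lim_imp_Liminf) auto
  moreover have "valid_family K enc dec" using code by (simp add: valid_family_def)
  ultimately have "\<exists>K enc dec. valid_family K enc dec \<and> reliable r \<rho> K enc dec \<and> semantic_secret r K enc \<and> ereal R = family_rate K"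
    using rel sec by metis
  then show ?thesis unfolding sem_capacity_def using R by (intro Sup_upper) simp
qed

theorem theorem1:
  fixes \<rho>r \<rho>w :: real
  assumes "0 < \<rho>r" "\<rho>r < 1" "0 < \<rho>w" "\<rho>w < 1/2"
  defines "f \<equiv> (\<lambda>p. bin_entropy ((2 * \<rho>w - 1) * p + 1 - \<rho>w) - bin_entropy \<rho>w - \<rho>r * bin_entropy p)"
  shows "ereal (max (1 - bin_entropy \<rho>w - \<rho>r) 0) \<le> sem_capacity \<rho>r \<rho>w
       \<and> sem_capacity \<rho>r \<rho>w \<le> ereal (1 - bin_entropy \<rho>w - \<rho>r - (INF p\<in>{0..1}. f p))
       \<and> weak_capacity \<rho>r \<rho>w \<le> ereal (1 - bin_entropy \<rho>w - \<rho>r - (INF p\<in>{0..1}. f p))"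
proof -
  interpret gap_params \<rho>r \<rho>w using assms by unfold_locales
  have f: "f p = gap \<rho>r \<rho>w p - bin_entropy \<rho>w" for p
  proof -
    have "(2 * \<rho>w - 1) * p + 1 - \<rho>w = 1 - (\<rho>w + (1 - 2 * \<rho>w) * p)" by (simp add: algebra_simps)
    then have "bin_entropy ((2 * \<rho>w - 1) * p + 1 - \<rho>w) = bin_entropy (\<rho>w + (1 - 2 * \<rho>w) * p)"
      by (simp only: bin_entropy_flip)
    then show ?thesis by (simp add: f_def gap_def)
  qed
  define I where "I = (INF p\<in>{0..1}. f p)"
  \<comment> \<open>A real infimum is a lower bound only for a set bounded below, which compactness
    provides here.\<close>
  have "continuous_on {0..1} f"
    unfolding f by (intro continuous_intros continuous_on_gap)
  then have "compact (f ` {0..1})" by (rule compact_continuous_image) simp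
  then have "bdd_below (f ` {0..1})" by (intro bounded_imp_bdd_below compact_imp_bounded)
  then have "I \<le> f q" if "0 \<le> q" "q \<le> 1" for q
    unfolding I_def using that by (intro cINF_lower) auto
  then have I: "I + bin_entropy \<rho>w \<le> gap \<rho>r \<rho>w q" if "0 \<le> q" "q \<le> 1" for q
    using that f by fastforce
  have U: "1 - \<rho>r - (I + bin_entropy \<rho>w) = 1 - bin_entropy \<rho>w - \<rho>r - I" by simp
  have pos: "0 \<le> sem_capacity \<rho>r \<rho>w" unfolding sem_capacity_def by (intro Sup_upper) simp
  have "ereal (max (1 - bin_entropy \<rho>w - \<rho>r) 0) \<le> sem_capacity \<rho>r \<rho>w"
  \<comment> \<open>The construction needs a rate strictly below the bound, which is therefore
    approached from below.\<close>
  proof (rule dense_le)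
    fix x assume x: "x < ereal (max (1 - bin_entropy \<rho>w - \<rho>r) 0)"
    show "x \<le> sem_capacity \<rho>r \<rho>w"
    proof (cases "x \<le> 0")
      case True
      then show ?thesis using pos by (rule order_trans)
    next
      case False
      with x obtain R where "x = ereal R" "0 < R" "R < 1 - bin_entropy \<rho>w - \<rho>r"
        by (cases x) (auto simp: max_def split: if_splits)
      then show ?thesis using sem_capacity_ge[OF assms(1-4)] by simp
    qed
  qed
  moreover have "sem_capacity \<rho>r \<rho>w \<le> ereal (1 - \<rho>r - (I + bin_entropy \<rho>w))"
    by (rule sem_capacity_le[OF assms(1-4)]) (rule I)
  moreover have "weak_capacity \<rho>r \<rho>w \<le> ereal (1 - \<rho>r - (I + bin_entropy \<rho>w))"
    by (rule weak_capacity_le[OF assms(1-4)]) (rule I)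
  ultimately show ?thesis unfolding U unfolding I_def by blast
qed

end
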